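(* Let $\mathbb{G}$ be a Carnot group with sub-gradient $\nabla$ and Carnot–Carathéodory distance $d$, let $d\mu=\frac1Ze^{-U(d(x))}d\lambda(x)$ be a probability measure, and let $\rho>0$. Assume $\mu$ satisfies the 2-Logarithmic Sobolev inequality $$\rho\left(\int f^2\log f^2\,d\mu-\int f^2d\mu\,\log\int f^2d\mu\right)\le 2\int|\nabla f|^2\,d\mu$$ for all (sufficiently regular) $f$. For a bounded measurable $f$ on $\mathbb{G}$ let $Q_tf(x)=\inf_{y\in\mathbb{G}}\{\frac{d(x,y)^2}{2t}+f(y)\}$ for $t>0$ and $Q_0f=f$ (the Hopf–Lax solution of $\partial_tu+\frac12|\nabla u|^2=0$, $u(\cdot,0)=f$). Then for every bounded measurable $f$, every $t\ge0$ and every $a\in\mathbb{R}$, $$\|e^{Q_tf}\|_{a+\rho t}\le\|e^{f}\|_a .$$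
   Context: A (homogeneous) Carnot group is $\mathbb{G}=(\mathbb{R}^N,\circ,\delta_\lambda)$ with dilations acting as group automorphisms and left-invariant generators $Z_1,\dots,Z_{N_1}$ (with $Z_j(0)=\partial_{x_j}|_0$) satisfying the Hörmander rank condition; sub-gradient $\nabla=(Z_1,\dots,Z_{N_1})$, $|\nabla f|=(\sum_i|Z_if|^2)^{1/2}$; $d$ is the Carnot–Carathéodory (control) distance associated to $Z_1,\dots,Z_{N_1}$, $d(x)=d(x,0)$; $U$ is an increasing function with $e^{-U(d)}$ integrable, $\lambda$ Lebesgue measure, $Z$ the normalization constant. For $a\in\mathbb{R}\setminus\{0\}$, $\|g\|_a=(\int|g|^a d\mu)^{1/a}$, and $\|g\|_0=\exp(\int\log|g|\,d\mu)$. *)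

theory Defs
  imports "HOL-Analysis.Analysis"
begin

fun diffk :: "nat \<Rightarrow> ('a::real_normed_vector \<Rightarrow> 'b::real_normed_vector) \<Rightarrow> bool" where
  "diffk 0 f = continuous_on UNIV f"
| "diffk (Suc k) f = ((\<forall>x. f differentiable (at x)) \<and> continuous_on UNIV f \<and>
      (\<forall>v. diffk k (\<lambda>x. frechet_derivative f (at x) v)))"

definition smooth_fun :: "('a::real_normed_vector \<Rightarrow> 'b::real_normed_vector) \<Rightarrow> bool" where
  "smooth_fun f \<longleftrightarrow> (\<forall>k. diffk k f)"

text \<open>Coordinates are indexed by the finite type 'n; deg i is the homogeneity degree of
  coordinate i, so the dilations are delta_lam(x)_i = lam^(deg i) x_i. The coordinates
  of degree 1 form the first layer R^{N_1}.\<close>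

definition dil :: "('n \<Rightarrow> nat) \<Rightarrow> real \<Rightarrow> real^'n \<Rightarrow> real^'n" where
  "dil deg lam x = (\<chi> i. lam ^ deg i * x $ i)"

text \<open>Left-invariant vector field Z_j, determined by Z_j(0) = e_j:
  Z_j(x) = d(tau_x)(0) e_j where tau_x(y) = x o y.\<close>
definition Zvf :: "(real^'n \<Rightarrow> real^'n \<Rightarrow> real^'n) \<Rightarrow> 'n \<Rightarrow> real^'n \<Rightarrow> real^'n" where
  "Zvf op j x = frechet_derivative (\<lambda>y. op x y) (at 0) (axis j 1)"

definition vf_bracket :: "(real^'n \<Rightarrow> real^'n) \<Rightarrow> (real^'n \<Rightarrow> real^'n) \<Rightarrow> real^'n \<Rightarrow> real^'n" where
  "vf_bracket X Y x = frechet_derivative Y (at x) (X x) - frechet_derivative X (at x) (Y x)"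

inductive_set lie_gen :: "(real^'n \<Rightarrow> real^'n \<Rightarrow> real^'n) \<Rightarrow> ('n \<Rightarrow> nat) \<Rightarrow> (real^'n \<Rightarrow> real^'n) set"
  for op deg where
  base: "deg j = 1 \<Longrightarrow> Zvf op j \<in> lie_gen op deg"
| br: "X \<in> lie_gen op deg \<Longrightarrow> Y \<in> lie_gen op deg \<Longrightarrow> vf_bracket X Y \<in> lie_gen op deg"

definition carnot_group :: "(real^'n \<Rightarrow> real^'n \<Rightarrow> real^'n) \<Rightarrow> ('n \<Rightarrow> nat) \<Rightarrow> bool" where
  "carnot_group op deg \<longleftrightarrow>
     \<comment> \<open>Lie group structure on R^N (identity 0), smooth group law and inversion\<close>
     (\<forall>x y z. op (op x y) z = op x (op y z)) \<and>
     (\<forall>x. op x 0 = x \<and> op 0 x = x) \<and>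
     (\<exists>inv. smooth_fun inv \<and> (\<forall>x. op x (inv x) = 0 \<and> op (inv x) x = 0)) \<and>
     smooth_fun (\<lambda>p :: (real^'n) \<times> (real^'n). op (fst p) (snd p)) \<and>
     \<comment> \<open>homogeneous dilations, acting as group automorphisms\<close>
     (\<forall>i. 1 \<le> deg i) \<and>
     (\<forall>lam>0. \<forall>x y. dil deg lam (op x y) = op (dil deg lam x) (dil deg lam y)) \<and>
     \<comment> \<open>Hoermander rank condition for Z_1..Z_{N_1}\<close>
     (\<forall>x. span ((\<lambda>V. V x) ` lie_gen op deg) = UNIV)"

definition abs_cont_on :: "real \<Rightarrow> real \<Rightarrow> (real \<Rightarrow> 'a::real_normed_vector) \<Rightarrow> bool" where
  "abs_cont_on a b g \<longleftrightarrow>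
     (\<forall>e>0. \<exists>\<delta>>0. \<forall>(n::nat) (l::nat \<Rightarrow> real) r.
        (\<forall>k<n. a \<le> l k \<and> l k \<le> r k \<and> r k \<le> b) \<and>
        (\<forall>k. Suc k < n \<longrightarrow> r k \<le> l (Suc k)) \<and>
        (\<Sum>k<n. r k - l k) < \<delta> \<longrightarrow>
        (\<Sum>k<n. norm (g (r k) - g (l k))) < e)"

definition subunit :: "(real^'n \<Rightarrow> real^'n \<Rightarrow> real^'n) \<Rightarrow> ('n \<Rightarrow> nat) \<Rightarrow> real \<Rightarrow> (real \<Rightarrow> real^'n) \<Rightarrow> bool" where
  "subunit op deg T g \<longleftrightarrow> abs_cont_on 0 T g \<and>
     (AE t in lebesgue. t \<in> {0..T} \<longrightarrow>
        (\<exists>h :: 'n \<Rightarrow> real. (\<Sum>j\<in>{j. deg j = 1}. (h j)\<^sup>2) \<le> 1 \<and>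
           (g has_vector_derivative (\<Sum>j\<in>{j. deg j = 1}. h j *\<^sub>R Zvf op j (g t))) (at t)))"

definition ccdist :: "(real^'n \<Rightarrow> real^'n \<Rightarrow> real^'n) \<Rightarrow> ('n \<Rightarrow> nat) \<Rightarrow> real^'n \<Rightarrow> real^'n \<Rightarrow> real" where
  "ccdist op deg x y = Inf {T. T \<ge> 0 \<and> (\<exists>g. subunit op deg T g \<and> g 0 = x \<and> g T = y)}"

definition Zder :: "(real^'n \<Rightarrow> real^'n \<Rightarrow> real^'n) \<Rightarrow> 'n \<Rightarrow> (real^'n \<Rightarrow> real) \<Rightarrow> real^'n \<Rightarrow> real" where
  "Zder op j f x = frechet_derivative f (at x) (Zvf op j x)"

definition subgrad_norm :: "(real^'n \<Rightarrow> real^'n \<Rightarrow> real^'n) \<Rightarrow> ('n \<Rightarrow> nat) \<Rightarrow> (real^'n \<Rightarrow> real) \<Rightarrow> real^'n \<Rightarrow> real" where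
  "subgrad_norm op deg f x = sqrt (\<Sum>j\<in>{j. deg j = 1}. (Zder op j f x)\<^sup>2)"

definition hopf_lax :: "('a \<Rightarrow> 'a \<Rightarrow> real) \<Rightarrow> real \<Rightarrow> ('a \<Rightarrow> real) \<Rightarrow> 'a \<Rightarrow> real" where
  "hopf_lax d t f x = (if t = 0 then f x else (INF y. (d x y)\<^sup>2 / (2 * t) + f y))"

definition anorm :: "'a measure \<Rightarrow> real \<Rightarrow> ('a \<Rightarrow> real) \<Rightarrow> real" where
  "anorm M a g = (if a = 0 then exp (\<integral>x. ln \<bar>g x\<bar> \<partial>M)
                  else (\<integral>x. \<bar>g x\<bar> powr a \<partial>M) powr (1 / a))"

end

theory Submission
  imports Defs
begin

text \<open>The function \<open>u t = Q_t f\<close> satisfies \<open>u (t + s) x \<le> u t z + d x z ^ 2 / (2 s)\<close>. This inequality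
  is linear in \<open>u\<close> and, as \<open>d\<close> is left invariant, survives averaging over left translates. The
  average \<open>v\<close> with a smooth kernel is smooth in \<open>x\<close>, and moving along the horizontal one-parameter
  subgroup in direction \<open>- \<nabla>v\<close> gives \<open>\<partial>_t v + |\<nabla>v|^2 / 2 \<le> 0\<close> for the upper right derivative.
  By the logarithmic Sobolev inequality for \<open>exp (q v / 2)\<close> with \<open>q = a + \<rho> t\<close>, the function
  \<open>t \<mapsto> log (norm_q (exp v))\<close> then has nonpositive right Dini derivative wherever \<open>q \<noteq> 0\<close>; it is
  continuous also at \<open>q = 0\<close>, hence decreasing. Removing the mollification and letting the initial
  time tend to 0, where \<open>u \<le> f\<close>, gives the claim.

  Chow's theorem is not needed: since \<open>exp (- U (d x 0))\<close> is integrable and Lebesgue measure is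
  invariant under right translations, the points not reachable by subunit curves would fill a set of
  finite measure, which is impossible if there are any, and a Steinhaus argument with the level sets
  of that function shows that \<open>d\<close> is continuous.\<close>

section \<open>Smooth functions\<close>

text \<open>Left translates are the right ones to average over, since they are isometries of
  \<open>ccdist\<close>. Smoothness of the average in \<open>x\<close> appears only after
  substituting \<open>z = op y x\<close>, a right translation in \<open>y\<close>, so right
  invariance of Lebesgue measure is used here as well. That invariance comes from homogeneity: the
  Jacobian of a right translation is unchanged by dilations, and shrinking to the origin gives 1.
  The mollified function is only a subsolution, so its time quotient is controlled from above by
  \<open>- |\<nabla>v|^2 / 2\<close> in the limit and need not converge. Cutting the quotient off
  from below at this value forces convergence, and dominated convergence then gives an exact
  derivative of the integrals. The logarithmic Sobolev inequality is assumed for smooth compactly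
  supported functions; exponentials are reached through cutoffs stretched by the group dilations,
  whose horizontal gradients shrink by the dilation factor. The exponent
  \<open>a + \<rho> * t\<close> vanishes at no more than one time. There the quotient
  \<open>log / q\<close> is singular, and continuity is read off from the regularised quotients
  \<open>exp1q\<close> and \<open>ln1q\<close>.\<close>

lemma diffk_SucI:
  assumes "\<And>x. (f has_derivative f' x) (at x)" "\<And>v. diffk k (\<lambda>x. f' x v)"
  shows "diffk (Suc k) f"
proof -
  have "frechet_derivative f (at x) = f' x" for x
    using assms(1) frechet_derivative_at by metis
  moreover have "continuous_on UNIV f"
    using assms(1) has_derivative_continuous continuous_at_imp_continuous_on by blast
  ultimately show ?thesis
    using assms by (auto simp: differentiable_def)
qed

lemma diffk_SucD:
  assumes "diffk (Suc k) f"
  shows "(f has_derivative frechet_derivative f (at x)) (at x)"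
    "diffk k (\<lambda>x. frechet_derivative f (at x) v)"
  using assms frechet_derivative_works by auto

lemma diffk_Suc_imp: "diffk (Suc k) f \<Longrightarrow> diffk k f"
proof (induction k arbitrary: f)
  case (Suc k)
  show ?case
    by (rule diffk_SucI[OF diffk_SucD(1)[OF Suc.prems] Suc.IH[OF diffk_SucD(2)[OF Suc.prems]]])
qed auto

lemma diffk_imp_continuous_on: "diffk k f \<Longrightarrow> continuous_on UNIV f"
  by (cases k) auto

lemma diffk_const [simp, intro]: "diffk k (\<lambda>x. c)"
proof (induction k arbitrary: c)
  case (Suc k)
  show ?case by (rule diffk_SucI[where f'="\<lambda>x v. 0"]) (auto intro: Suc)
qed auto

lemma diffk_linear: "bounded_linear L \<Longrightarrow> diffk k L"
proof (cases k)
  case (Suc m)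
  assume L: "bounded_linear L"
  show ?thesis unfolding Suc
    by (rule diffk_SucI[where f'="\<lambda>x. L"]) (auto intro: bounded_linear_imp_has_derivative L)
qed (auto intro: linear_continuous_on)

lemma diffk_linear_compose:
  "bounded_linear L \<Longrightarrow> diffk k f \<Longrightarrow> diffk k (\<lambda>x. L (f x))"
proof (induction k arbitrary: f)
  case 0
  then show ?case by (auto intro: bounded_linear.continuous_on)
next
  case (Suc k)
  show ?case
    by (rule diffk_SucI[where f'="\<lambda>x v. L (frechet_derivative f (at x) v)"])
      (rule bounded_linear.has_derivative[OF Suc.prems(1) diffk_SucD(1)[OF Suc.prems(2)]],
       rule Suc.IH[OF Suc.prems(1) diffk_SucD(2)[OF Suc.prems(2)]])
qed

lemma diffk_add:
  "diffk k f \<Longrightarrow> diffk k g \<Longrightarrow> diffk k (\<lambda>x. f x + g x)"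
proof (induction k arbitrary: f g)
  case 0
  then show ?case by (auto intro: continuous_intros)
next
  case (Suc k)
  show ?case
    by (rule diffk_SucI[where f'="\<lambda>x v. frechet_derivative f (at x) v + frechet_derivative g (at x) v"])
      (rule has_derivative_add[OF diffk_SucD(1)[OF Suc.prems(1)] diffk_SucD(1)[OF Suc.prems(2)]],
       rule Suc.IH[OF diffk_SucD(2)[OF Suc.prems(1)] diffk_SucD(2)[OF Suc.prems(2)]])
qed

lemma diffk_sum:
  "(\<And>i. i \<in> I \<Longrightarrow> diffk k (f i)) \<Longrightarrow> diffk k (\<lambda>x. \<Sum>i\<in>I. f i x)"
  by (induction I rule: infinite_finite_induct) (auto intro!: diffk_add)

lemma diffk_bilinear:
  assumes B: "bounded_bilinear B"
  shows "diffk k f \<Longrightarrow> diffk k g \<Longrightarrow> diffk k (\<lambda>x. B (f x) (g x))"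
proof (induction k arbitrary: f g)
  case 0
  then show ?case by (auto intro: bounded_bilinear.continuous_on[OF B])
next
  case (Suc k)
  show ?case
    by (rule diffk_SucI[where f'="\<lambda>x v. B (f x) (frechet_derivative g (at x) v) + B (frechet_derivative f (at x) v) (g x)"])
      (rule bounded_bilinear.FDERIV[OF B diffk_SucD(1)[OF Suc.prems(1)] diffk_SucD(1)[OF Suc.prems(2)]],
       intro diffk_add Suc.IH diffk_SucD(2)[OF Suc.prems(1)] diffk_SucD(2)[OF Suc.prems(2)]
         diffk_Suc_imp[OF Suc.prems(1)] diffk_Suc_imp[OF Suc.prems(2)])
qed

lemmas diffk_mult = diffk_bilinear[OF bounded_bilinear_mult]
lemmas diffk_scaleR = diffk_bilinear[OF bounded_bilinear_scaleR]
lemmas diffk_inner = diffk_bilinear[OF bounded_bilinear_inner]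

text \<open>In the chain rule the direction fed to the derivative of \<open>g\<close> varies with
  \<open>x\<close>, whereas \<open>diffk\<close> speaks of fixed directions. Expanding that
  direction in the basis leaves sums of products of scalar coefficients and derivatives in fixed
  directions, to which the induction applies.\<close>

lemma diffk_compose:
  fixes f :: "'a::real_normed_vector \<Rightarrow> 'b::euclidean_space"
  shows "diffk k g \<Longrightarrow> diffk k f \<Longrightarrow> diffk k (\<lambda>x. g (f x))"
proof (induction k arbitrary: f g)
  case 0
  then show ?case using continuous_on_compose2[of UNIV g UNIV f] by auto
next
  case (Suc k)
  let ?D = "\<lambda>x v. frechet_derivative g (at (f x)) (frechet_derivative f (at x) v)"
  have "?D x v = (\<Sum>b\<in>Basis. (frechet_derivative f (at x) v \<bullet> b) *\<^sub>R frechet_derivative g (at (f x)) b)" for x v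
  proof -
    interpret linear "frechet_derivative g (at (f x))"
      using diffk_SucD(1)[OF Suc.prems(1)] has_derivative_linear by blast
    show ?thesis
      by (subst euclidean_representation[of "frechet_derivative f (at x) v", symmetric], subst sum)
        (simp add: scaleR)
  qed
  moreover have "diffk k (\<lambda>x. \<Sum>b\<in>Basis. (frechet_derivative f (at x) v \<bullet> b) *\<^sub>R frechet_derivative g (at (f x)) b)" for v
    by (intro diffk_sum diffk_scaleR diffk_inner diffk_const diffk_SucD(2)[OF Suc.prems(2)]
      Suc.IH[OF diffk_SucD(2)[OF Suc.prems(1)] diffk_Suc_imp[OF Suc.prems(2)]])
  ultimately show ?case
    by (intro diffk_SucI[where f'="?D"]
      has_derivative_compose[OF diffk_SucD(1)[OF Suc.prems(2)] diffk_SucD(1)[OF Suc.prems(1)]]) simp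
qed

text \<open>Serves mollification, where an integral over one fixed box represents the function only
  near a given point.\<close>

lemma diffk_local:
  assumes "\<And>x. \<exists>N h. open N \<and> x \<in> N \<and> diffk k h \<and> (\<forall>y\<in>N. f y = h y)"
  shows "diffk k f"
  using assms
proof (induction k arbitrary: f)
  case 0
  have "isCont f x" for x
  proof -
    from 0 obtain N h where "open N" "x \<in> N" "diffk 0 h" and eq: "\<forall>y\<in>N. f y = h y" by metis
    moreover from this have "isCont h x" by (auto simp: continuous_on_eq_continuous_at)
    moreover have "\<forall>\<^sub>F y in nhds x. f y = h y"
      using eventually_nhds \<open>open N\<close> \<open>x \<in> N\<close> eq by blast
    ultimately show ?thesis by (simp add: isCont_cong)
  qed
  then show ?case by (simp add: continuous_on_eq_continuous_at)
next
  case (Suc k)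
  have D: "\<exists>N h. open N \<and> x \<in> N \<and> diffk (Suc k) h
      \<and> (\<forall>y\<in>N. (f has_derivative frechet_derivative h (at y)) (at y))" for x
  proof -
    from Suc.prems obtain N h where N: "open N" "x \<in> N" "diffk (Suc k) h" and eq: "\<forall>y\<in>N. f y = h y" by metis
    have "(f has_derivative frechet_derivative h (at y)) (at y)" if "y \<in> N" for y
      using diffk_SucD(1)[OF N(3), of y] N(1) that eq
      by (rule_tac has_derivative_transform_within_open[of h]) auto
    with N show ?thesis by blast
  qed
  show ?case
  proof (rule diffk_SucI)
    show "(f has_derivative frechet_derivative f (at x)) (at x)" for x
      using D[of x] frechet_derivative_at by metis
    show "diffk k (\<lambda>x. frechet_derivative f (at x) v)" for v
    proof (rule Suc.IH)
      fix x
      obtain N h where N: "open N" "x \<in> N" "diffk (Suc k) h"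
        and eq: "\<forall>y\<in>N. (f has_derivative frechet_derivative h (at y)) (at y)" using D by metis
      have "\<forall>y\<in>N. frechet_derivative f (at y) v = frechet_derivative h (at y) v"
        using eq frechet_derivative_at by metis
      then show "\<exists>N h. open N \<and> x \<in> N \<and> diffk k h \<and> (\<forall>y\<in>N. frechet_derivative f (at y) v = h y)"
        using N diffk_SucD(2)[OF N(3)] by blast
    qed
  qed
qed

lemma diffk_Pair:
  "diffk k f \<Longrightarrow> diffk k g \<Longrightarrow> diffk k (\<lambda>x. (f x, g x))"
  using diffk_add[OF diffk_linear_compose[OF bounded_linear_Pair[OF bounded_linear_ident bounded_linear_zero], of k f]
    diffk_linear_compose[OF bounded_linear_Pair[OF bounded_linear_zero bounded_linear_ident], of k g]]
  by simp

text \<open>All derivatives fall on the kernel: differentiating under the integral replaces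
  \<open>\<Phi>\<close> by its partial derivative in direction \<open>(v, 0)\<close>, a kernel of
  the same kind, while the merely continuous \<open>u\<close> stays untouched. Hence the induction
  with \<open>\<Phi>\<close> arbitrary.\<close>

lemma diffk_integral:
  fixes \<Phi> :: "'a::euclidean_space \<times> 'b::euclidean_space \<Rightarrow> real"
  assumes u: "continuous_on UNIV u"
  shows "diffk k \<Phi> \<Longrightarrow> diffk k (\<lambda>x. integral (cbox a b) (\<lambda>z. \<Phi> (x, z) * u z))"
proof (induction k arbitrary: \<Phi>)
  case 0
  have *: "continuous_on (UNIV \<times> cbox a b) (\<lambda>(x, z). \<Phi> (x, z) * u z)"
    using 0 continuous_on_compose2[OF u continuous_on_snd[OF continuous_on_id], of "UNIV \<times> cbox a b"]
    by (auto simp: split_beta intro!: continuous_intros elim: continuous_on_subset)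
  show ?case
    using integral_continuous_on_param[OF *] by simp
next
  case (Suc k)
  define D where "D x z v = frechet_derivative \<Phi> (at (x, z)) (v, 0)" for x z v
  have der: "((\<lambda>x. \<Phi> (x, z)) has_derivative D x z) (at x)" for x z
    unfolding D_def
    by (rule has_derivative_compose[OF _ diffk_SucD(1)[OF Suc.prems], of "\<lambda>x. (x, z)" "\<lambda>v. (v, 0)"])
      (auto intro!: derivative_eq_intros)
  have Dk: "diffk k (\<lambda>p. D (fst p) (snd p) v)" for v
    unfolding D_def using diffk_SucD(2)[OF Suc.prems] by simp
  have Dc: "continuous_on UNIV (\<lambda>p. D (fst p) (snd p) v)" for v
    using diffk_imp_continuous_on[OF Dk] .
  have bl: "bounded_linear (\<lambda>v. D x z v * u z)" for x z
    using bounded_linear_mult_const[OF has_derivative_bounded_linear[OF der]] by fast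
  define B where "B x z = Blinfun (\<lambda>v. D x z v * u z)" for x z
  have B: "blinfun_apply (B x z) = (\<lambda>v. D x z v * u z)" for x z
    unfolding B_def by (rule bounded_linear_Blinfun_apply[OF bl])
  have Bc: "continuous_on (UNIV \<times> cbox a b) (\<lambda>(x, z). B x z)"
    by (rule continuous_on_blinfun_componentwise)
      (auto simp: split_beta B intro!: continuous_intros continuous_on_subset[OF Dc]
        intro: continuous_on_compose2[OF u])
  have Bcx: "continuous_on (cbox a b) (B x)" for x
    using continuous_on_compose2[OF Bc continuous_on_Pair[OF continuous_on_const continuous_on_id], of x "cbox a b"]
    by auto
  have "((\<lambda>x. integral (cbox a b) (\<lambda>z. \<Phi> (x, z) * u z)) has_derivative integral (cbox a b) (B x)) (at x)" for x
  proof (rule leibniz_rule[where U=UNIV, simplified])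
    show "((\<lambda>x. \<Phi> (x, t) * u t) has_derivative blinfun_apply (B x t)) (at x)" for x t
      unfolding B by (rule has_derivative_mult_left[OF der])
    show "(\<lambda>z. \<Phi> (x, z) * u z) integrable_on cbox a b" for x
      using diffk_imp_continuous_on[OF Suc.prems] u
      by (intro integrable_continuous continuous_intros)
        (auto intro!: continuous_intros intro: continuous_on_compose2[of UNIV \<Phi>] continuous_on_subset)
    show "continuous_on (UNIV \<times> cbox a b) (\<lambda>(x, z). B x z)" by (rule Bc)
  qed
  moreover have "blinfun_apply (integral (cbox a b) (B x)) v = integral (cbox a b) (\<lambda>z. D x z v * u z)" for x v
    by (subst blinfun_apply_integral) (auto simp: B intro!: integrable_continuous Bcx)
  ultimately show ?case
    using Suc.IH[OF Dk] by (intro diffk_SucI[where f'="\<lambda>x. blinfun_apply (integral (cbox a b) (B x))"]) auto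
qed

text \<open>The powers in the denominator make the family closed under differentiation up to linear
  combinations, so smoothness of the standard flat function \<open>flat_exp 0\<close> is proved for
  all \<open>m\<close> at once.\<close>

fun flat_exp :: "nat \<Rightarrow> real \<Rightarrow> real" where
  "flat_exp m s = (if 0 < s then exp (- (1 / s)) / s ^ m else 0)"

declare flat_exp.simps [simp del]

lemma flat_exp_pos: "0 < s \<Longrightarrow> flat_exp m s = exp (- (1 / s)) / s ^ m"
  and flat_exp_nonpos: "s \<le> 0 \<Longrightarrow> flat_exp m s = 0"
  by (simp_all add: flat_exp.simps)

lemma flat_exp_tendsto_0: "(flat_exp m \<longlongrightarrow> 0) (at 0)"
proof -
  \<comment> \<open>With \<open>x = 1 / s\<close> the claim is that an exponential beats every power
    at infinity.\<close>
  have "(((\<lambda>x. x ^ m / exp x) \<circ> inverse) \<longlongrightarrow> (0::real)) (at_right 0)"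
    unfolding comp_def
    by (rule filterlim_compose[OF tendsto_power_div_exp_0 filterlim_inverse_at_top_right])
  moreover have "\<forall>\<^sub>F s in at_right 0. ((\<lambda>x. x ^ m / exp x) \<circ> inverse) s = flat_exp m s"
    unfolding eventually_at_right_field
    by (rule exI[of _ 1]) (auto simp: flat_exp_pos exp_minus field_simps power_inverse)
  ultimately have "(flat_exp m \<longlongrightarrow> 0) (at_right 0)"
    using tendsto_cong by blast
  moreover have "(flat_exp m \<longlongrightarrow> 0) (at_left 0)"
  proof (rule tendsto_eventually)
    show "\<forall>\<^sub>F s in at_left 0. flat_exp m s = 0"
      unfolding eventually_at_left_field by (rule exI[of _ "-1"]) (auto simp: flat_exp_nonpos)
  qed
  ultimately show ?thesis
    by (simp add: filterlim_at_split)
qed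

lemma flat_exp_deriv:
  "(flat_exp m has_field_derivative flat_exp (m + 2) s - m * flat_exp (m + 1) s) (at s)"
proof -
  consider "s > 0" | "s < 0" | "s = 0" by linarith
  then show ?thesis
  proof cases
    case 1
    have "((\<lambda>s. exp (- (1 / s)) / s ^ m) has_field_derivative flat_exp (m + 2) s - m * flat_exp (m + 1) s) (at s)"
    proof (cases m)
      case 0
      then show ?thesis using 1
        by (auto intro!: derivative_eq_intros simp: flat_exp_pos field_simps power2_eq_square)
    next
      case (Suc n)
      then show ?thesis using 1
        by (auto intro!: derivative_eq_intros simp: flat_exp_pos field_simps power2_eq_square)
          (cases n; simp)
    qed
    then show ?thesis
      by (rule has_field_derivative_transform_within_open[where S="{0<..}"]) (use 1 in \<open>auto simp: flat_exp_pos\<close>)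
  next
    case 2
    have "((\<lambda>s. 0) has_field_derivative flat_exp (m + 2) s - m * flat_exp (m + 1) s) (at s)"
      using 2 by (simp add: flat_exp_nonpos)
    then show ?thesis
      by (rule has_field_derivative_transform_within_open[where S="{..<0}"]) (use 2 in \<open>auto simp: flat_exp_nonpos\<close>)
  next
    case 3
    \<comment> \<open>Dividing by \<open>h\<close> merely raises the power in the denominator, so
      the difference quotient at 0 is again a member of the family and tends to 0.\<close>
    have "(flat_exp m (0 + h) - flat_exp m 0) / h = flat_exp (m + 1) h" for h
      by (cases "h > 0") (auto simp: flat_exp_nonpos flat_exp_pos)
    then show ?thesis
      using flat_exp_tendsto_0[of "m + 1"] 3 by (simp add: DERIV_def flat_exp_nonpos)
  qed
qed

lemma diffk_flat_exp: "diffk k (flat_exp m)"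
proof (induction k arbitrary: m)
  case 0
  show ?case
    using DERIV_isCont[OF flat_exp_deriv] by (simp add: continuous_on_eq_continuous_at)
next
  case (Suc k)
  have "diffk k (\<lambda>x. (flat_exp (m + 2) x + (- real m) * flat_exp (m + 1) x) * v)" for v
    by (intro diffk_mult diffk_add diffk_const Suc)
  then show ?case
    by (intro diffk_SucI[where f'="\<lambda>x v. (flat_exp (m + 2) x - m * flat_exp (m + 1) x) * v"])
      (use flat_exp_deriv in \<open>auto simp: has_field_derivative_def\<close>)
qed

lemma diffk_exp: "diffk k (exp :: real \<Rightarrow> real)"
proof (induction k)
  case (Suc k)
  show ?case
  proof (rule diffk_SucI)
    show "((exp :: real \<Rightarrow> real) has_derivative (\<lambda>v. exp x * v)) (at x)" for x
      using DERIV_exp has_field_derivative_def by blast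
    show "diffk k (\<lambda>x :: real. exp x * v)" for v
      by (intro diffk_mult diffk_const Suc)
  qed
qed (auto intro: continuous_intros)

section \<open>Absolutely continuous curves\<close>

lemma abs_cont_onD:
  assumes "abs_cont_on a b g" "e > 0"
  obtains \<delta> where "\<delta> > 0" "\<And>(n::nat) l r. \<lbrakk>\<And>k. k < n \<Longrightarrow> a \<le> l k \<and> l k \<le> r k \<and> r k \<le> b;
     \<And>k. Suc k < n \<Longrightarrow> r k \<le> l (Suc k); (\<Sum>k<n. r k - l k) < \<delta>\<rbrakk> \<Longrightarrow>
     (\<Sum>k<n. norm (g (r k) - g (l k))) < e"
proof -
  from assms(1)[unfolded abs_cont_on_def, rule_format, OF assms(2)]
  obtain \<delta> where d: "\<delta> > 0" and *: "\<forall>(n::nat) l r.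
        (\<forall>k<n. a \<le> l k \<and> l k \<le> r k \<and> r k \<le> b) \<and>
        (\<forall>k. Suc k < n \<longrightarrow> r k \<le> l (Suc k)) \<and>
        (\<Sum>k<n. r k - l k) < \<delta> \<longrightarrow>
        (\<Sum>k<n. norm (g (r k) - g (l k))) < e"
    by (elim exE conjE)
  show thesis
    by (rule that[OF d], rule *[THEN spec, THEN spec, THEN spec, THEN mp], intro conjI allI impI; simp)
qed

lemma abs_cont_onI:
  assumes "\<And>e. e > 0 \<Longrightarrow> \<exists>\<delta>>0. \<forall>(n::nat) l r. (\<forall>k<n. a \<le> l k \<and> l k \<le> r k \<and> r k \<le> b) \<longrightarrow>
        (\<forall>k. Suc k < n \<longrightarrow> r k \<le> l (Suc k)) \<longrightarrow>
        (\<Sum>k<n. r k - l k) < \<delta> \<longrightarrow>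
        (\<Sum>k<n. norm (g (r k) - g (l k))) < e"
  shows "abs_cont_on a b g"
  unfolding abs_cont_on_def imp_conjL by (intro allI impI assms)

lemma abs_cont_on_continuous:
  assumes "abs_cont_on a b g"
  shows "continuous_on {a..b} g"
  unfolding continuous_on_iff
proof (intro ballI allI impI)
  fix x e :: real assume x: "x \<in> {a..b}" and "e > 0"
  from abs_cont_onD[OF assms this(2)] obtain \<delta> where \<delta>: "\<delta> > 0"
    and *: "\<And>(n::nat) l r. \<lbrakk>\<And>k. k < n \<Longrightarrow> a \<le> l k \<and> l k \<le> r k \<and> r k \<le> b;
     \<And>k. Suc k < n \<Longrightarrow> r k \<le> l (Suc k); (\<Sum>k<n. r k - l k) < \<delta>\<rbrakk> \<Longrightarrow>
     (\<Sum>k<n. norm (g (r k) - g (l k))) < e" by blast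
  have "dist (g y) (g x) < e" if "y \<in> {a..b}" "dist y x < \<delta>" for y
    using *[of 1 "\<lambda>_. min x y" "\<lambda>_. max x y"] that x
    by (cases "x \<le> y") (auto simp: dist_norm norm_minus_commute min_def max_def)
  with \<delta> show "\<exists>d>0. \<forall>x'\<in>{a..b}. dist x' x < d \<longrightarrow> dist (g x') (g x) < e" by blast
qed

text \<open>The Lipschitz bound is required only on the values of \<open>g\<close>, so that it can
  be supplied by a smooth map on the compact image of the curve.\<close>

lemma abs_cont_on_lipschitz_comp:
  assumes g: "abs_cont_on a b g"
    and L: "\<And>s t. s \<in> {a..b} \<Longrightarrow> t \<in> {a..b} \<Longrightarrow> norm (h (g s) - h (g t)) \<le> K * norm (g s - g t)"
  shows "abs_cont_on a b (\<lambda>t. h (g t))"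
proof (rule abs_cont_onI)
  fix e :: real assume "e > 0"
  \<comment> \<open>\<open>K\<close> may be zero or negative; \<open>K'\<close> is a positive
    majorant by which one can divide.\<close>
  define K' where "K' = \<bar>K\<bar> + 1"
  have "K' > 0" "K \<le> K'" unfolding K'_def by auto
  with \<open>e > 0\<close> have "e / K' > 0" by simp
  from abs_cont_onD[OF g this] obtain \<delta> where \<delta>: "\<delta> > 0"
    and *: "\<And>(n::nat) l r. \<lbrakk>\<And>k. k < n \<Longrightarrow> a \<le> l k \<and> l k \<le> r k \<and> r k \<le> b;
     \<And>k. Suc k < n \<Longrightarrow> r k \<le> l (Suc k); (\<Sum>k<n. r k - l k) < \<delta>\<rbrakk> \<Longrightarrow>
     (\<Sum>k<n. norm (g (r k) - g (l k))) < e / K'" by blast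
  show "\<exists>\<delta>>0. \<forall>(n::nat) l r. (\<forall>k<n. a \<le> l k \<and> l k \<le> r k \<and> r k \<le> b) \<longrightarrow>
        (\<forall>k. Suc k < n \<longrightarrow> r k \<le> l (Suc k)) \<longrightarrow> (\<Sum>k<n. r k - l k) < \<delta> \<longrightarrow>
        (\<Sum>k<n. norm (h (g (r k)) - h (g (l k)))) < e"
  proof (intro exI[of _ \<delta>] conjI allI impI \<delta>)
    fix n :: nat and l r :: "nat \<Rightarrow> real"
    assume 1: "\<forall>k<n. a \<le> l k \<and> l k \<le> r k \<and> r k \<le> b" "\<forall>k. Suc k < n \<longrightarrow> r k \<le> l (Suc k)"
      "(\<Sum>k<n. r k - l k) < \<delta>"
    have "(\<Sum>k<n. norm (h (g (r k)) - h (g (l k)))) \<le> (\<Sum>k<n. K' * norm (g (r k) - g (l k)))"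
    proof (rule sum_mono)
      fix k assume "k \<in> {..<n}"
      then have "r k \<in> {a..b}" "l k \<in> {a..b}" using 1(1) by force+
      then show "norm (h (g (r k)) - h (g (l k))) \<le> K' * norm (g (r k) - g (l k))"
        using L \<open>K \<le> K'\<close> by (meson mult_right_mono norm_ge_zero order_trans)
    qed
    also have "\<dots> = K' * (\<Sum>k<n. norm (g (r k) - g (l k)))" by (simp add: sum_distrib_left)
    also have "\<dots> < e" using *[of n l r] 1 \<open>K' > 0\<close> by (simp add: field_simps)
    finally show "(\<Sum>k<n. norm (h (g (r k)) - h (g (l k)))) < e" .
  qed
qed

text \<open>A monotone map keeps an ordered family of intervals ordered and non-overlapping, and its
  growth bound controls the total length. Used for the rescaled time \<open>t / l\<close> and the
  clamped times \<open>min t S\<close> and \<open>max (t - S) 0\<close>.\<close>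

lemma abs_cont_on_compose_mono:
  assumes g: "abs_cont_on c d g" and m: "mono_on {a..b} m" "m ` {a..b} \<subseteq> {c..d}"
    and K: "\<And>s t. a \<le> s \<Longrightarrow> s \<le> t \<Longrightarrow> t \<le> b \<Longrightarrow> m t - m s \<le> K * (t - s)"
  shows "abs_cont_on a b (\<lambda>t. g (m t))"
proof (rule abs_cont_onI)
  fix e :: real assume "e > 0"
  define K' where "K' = \<bar>K\<bar> + 1"
  have K': "K' > 0" "K \<le> K'" unfolding K'_def by auto
  from abs_cont_onD[OF g \<open>e > 0\<close>] obtain \<delta> where \<delta>: "\<delta> > 0"
    and *: "\<And>(n::nat) l r. \<lbrakk>\<And>k. k < n \<Longrightarrow> c \<le> l k \<and> l k \<le> r k \<and> r k \<le> d;
     \<And>k. Suc k < n \<Longrightarrow> r k \<le> l (Suc k); (\<Sum>k<n. r k - l k) < \<delta>\<rbrakk> \<Longrightarrow>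
     (\<Sum>k<n. norm (g (r k) - g (l k))) < e" by blast
  show "\<exists>\<delta>>0. \<forall>(n::nat) l r. (\<forall>k<n. a \<le> l k \<and> l k \<le> r k \<and> r k \<le> b) \<longrightarrow>
        (\<forall>k. Suc k < n \<longrightarrow> r k \<le> l (Suc k)) \<longrightarrow> (\<Sum>k<n. r k - l k) < \<delta> \<longrightarrow>
        (\<Sum>k<n. norm (g (m (r k)) - g (m (l k)))) < e"
  proof (intro exI[of _ "\<delta> / K'"] conjI allI impI)
    show "\<delta> / K' > 0" using \<delta> K' by simp
    fix n :: nat and l r :: "nat \<Rightarrow> real"
    assume 1: "\<forall>k<n. a \<le> l k \<and> l k \<le> r k \<and> r k \<le> b" "\<forall>k. Suc k < n \<longrightarrow> r k \<le> l (Suc k)"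
      "(\<Sum>k<n. r k - l k) < \<delta> / K'"
    have in_ab: "r k \<in> {a..b}" "l k \<in> {a..b}" if "k < n" for k using 1(1) that by force+
    have "(\<Sum>k<n. m (r k) - m (l k)) \<le> (\<Sum>k<n. K' * (r k - l k))"
    proof (rule sum_mono)
      fix k assume "k \<in> {..<n}"
      then have "m (r k) - m (l k) \<le> K * (r k - l k)" "0 \<le> r k - l k" using 1(1) K by force+
      then show "m (r k) - m (l k) \<le> K' * (r k - l k)"
        using K'(2) by (meson mult_right_mono order_trans)
    qed
    also have "\<dots> = K' * (\<Sum>k<n. r k - l k)" by (simp add: sum_distrib_left)
    also have "\<dots> < \<delta>" using 1 K' by (simp add: field_simps)
    finally show "(\<Sum>k<n. norm (g (m (r k)) - g (m (l k)))) < e"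
    proof (intro *)
      show "c \<le> m (l k) \<and> m (l k) \<le> m (r k) \<and> m (r k) \<le> d" if "k < n" for k
        using m(2) in_ab[OF that] mono_onD[OF m(1)] 1(1) that by (force simp: image_subset_iff)
      show "m (r k) \<le> m (l (Suc k))" if "Suc k < n" for k
        using in_ab[OF that] in_ab[of k] mono_onD[OF m(1)] 1(2) that by force
    qed auto
  qed
qed

lemma abs_cont_on_reflect:
  assumes g: "abs_cont_on 0 T g"
  shows "abs_cont_on 0 T (\<lambda>t. g (T - t))"
proof (rule abs_cont_onI)
  fix e :: real assume "e > 0"
  from abs_cont_onD[OF g \<open>e > 0\<close>] obtain \<delta> where \<delta>: "\<delta> > 0"
    and *: "\<And>(n::nat) l r. \<lbrakk>\<And>k. k < n \<Longrightarrow> 0 \<le> l k \<and> l k \<le> r k \<and> r k \<le> T;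
     \<And>k. Suc k < n \<Longrightarrow> r k \<le> l (Suc k); (\<Sum>k<n. r k - l k) < \<delta>\<rbrakk> \<Longrightarrow>
     (\<Sum>k<n. norm (g (r k) - g (l k))) < e" by blast
  show "\<exists>\<delta>>0. \<forall>(n::nat) l r. (\<forall>k<n. 0 \<le> l k \<and> l k \<le> r k \<and> r k \<le> T) \<longrightarrow>
        (\<forall>k. Suc k < n \<longrightarrow> r k \<le> l (Suc k)) \<longrightarrow> (\<Sum>k<n. r k - l k) < \<delta> \<longrightarrow>
        (\<Sum>k<n. norm (g (T - r k) - g (T - l k))) < e"
  proof (intro exI[of _ \<delta>] conjI allI impI \<delta>)
    fix n :: nat and l r :: "nat \<Rightarrow> real"
    assume 1: "\<forall>k<n. 0 \<le> l k \<and> l k \<le> r k \<and> r k \<le> T" "\<forall>k. Suc k < n \<longrightarrow> r k \<le> l (Suc k)"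
      "(\<Sum>k<n. r k - l k) < \<delta>"
    \<comment> \<open>The definition lists the intervals from left to right, so reflection must
      reverse the indices as well as exchange the endpoints.\<close>
    define l' r' where "l' k = T - r (n - Suc k)" and "r' k = T - l (n - Suc k)" for k
    have "(\<Sum>k<n. norm (g (r' k) - g (l' k))) < e"
    proof (rule *)
      show "0 \<le> l' k \<and> l' k \<le> r' k \<and> r' k \<le> T" if "k < n" for k
      proof -
        have "n - Suc k < n" using that by simp
        then show ?thesis using 1(1) unfolding l'_def r'_def by force
      qed
      show "r' k \<le> l' (Suc k)" if "Suc k < n" for k
      proof -
        have "Suc (n - Suc (Suc k)) = n - Suc k" "n - Suc k < n" using that by simp_all
        then show ?thesis using 1(2)[rule_format, of "n - Suc (Suc k)"] unfolding l'_def r'_def by simp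
      qed
      have "(\<Sum>k<n. r' k - l' k) = (\<Sum>k<n. r k - l k)"
        unfolding l'_def r'_def using sum.nat_diff_reindex[of "\<lambda>k. r k - l k" n] by simp
      with 1(3) show "(\<Sum>k<n. r' k - l' k) < \<delta>" by simp
    qed
    moreover have "(\<Sum>k<n. norm (g (r' k) - g (l' k))) = (\<Sum>k<n. norm (g (T - r k) - g (T - l k)))"
      unfolding l'_def r'_def
      using sum.nat_diff_reindex[of "\<lambda>k. norm (g (T - l k) - g (T - r k))" n] by (simp add: norm_minus_commute)
    ultimately show "(\<Sum>k<n. norm (g (T - r k) - g (T - l k))) < e" by simp
  qed
qed

lemma abs_cont_on_add:
  assumes f: "abs_cont_on a b f" and g: "abs_cont_on a b g"
  shows "abs_cont_on a b (\<lambda>t. f t + g t)"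
proof (rule abs_cont_onI)
  fix e :: real assume "e > 0"
  then have e2: "e / 2 > 0" by simp
  from abs_cont_onD[OF f e2] obtain \<delta>1 where \<delta>1: "\<delta>1 > 0"
    and *: "\<And>(n::nat) l r. \<lbrakk>\<And>k. k < n \<Longrightarrow> a \<le> l k \<and> l k \<le> r k \<and> r k \<le> b;
     \<And>k. Suc k < n \<Longrightarrow> r k \<le> l (Suc k); (\<Sum>k<n. r k - l k) < \<delta>1\<rbrakk> \<Longrightarrow>
     (\<Sum>k<n. norm (f (r k) - f (l k))) < e / 2" by blast
  from abs_cont_onD[OF g e2] obtain \<delta>2 where \<delta>2: "\<delta>2 > 0"
    and **: "\<And>(n::nat) l r. \<lbrakk>\<And>k. k < n \<Longrightarrow> a \<le> l k \<and> l k \<le> r k \<and> r k \<le> b;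
     \<And>k. Suc k < n \<Longrightarrow> r k \<le> l (Suc k); (\<Sum>k<n. r k - l k) < \<delta>2\<rbrakk> \<Longrightarrow>
     (\<Sum>k<n. norm (g (r k) - g (l k))) < e / 2" by blast
  show "\<exists>\<delta>>0. \<forall>(n::nat) l r. (\<forall>k<n. a \<le> l k \<and> l k \<le> r k \<and> r k \<le> b) \<longrightarrow>
        (\<forall>k. Suc k < n \<longrightarrow> r k \<le> l (Suc k)) \<longrightarrow> (\<Sum>k<n. r k - l k) < \<delta> \<longrightarrow>
        (\<Sum>k<n. norm (f (r k) + g (r k) - (f (l k) + g (l k)))) < e"
  proof (intro exI[of _ "min \<delta>1 \<delta>2"] conjI allI impI)
    show "min \<delta>1 \<delta>2 > 0" using \<delta>1 \<delta>2 by simp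
    fix n :: nat and l r :: "nat \<Rightarrow> real"
    assume 1: "\<forall>k<n. a \<le> l k \<and> l k \<le> r k \<and> r k \<le> b" "\<forall>k. Suc k < n \<longrightarrow> r k \<le> l (Suc k)"
      "(\<Sum>k<n. r k - l k) < min \<delta>1 \<delta>2"
    have "(\<Sum>k<n. norm (f (r k) + g (r k) - (f (l k) + g (l k))))
      \<le> (\<Sum>k<n. norm (f (r k) - f (l k)) + norm (g (r k) - g (l k)))"
      by (intro sum_mono norm_diff_triangle_ineq)
    also have "\<dots> < e" using *[of n l r] **[of n l r] 1 by (simp add: sum.distrib)
    finally show "(\<Sum>k<n. norm (f (r k) + g (r k) - (f (l k) + g (l k)))) < e" .
  qed
qed

lemma abs_cont_on_id: "abs_cont_on a b (\<lambda>t. t :: real)"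
proof (rule abs_cont_onI)
  fix e :: real assume "e > 0"
  show "\<exists>\<delta>>0. \<forall>(n::nat) l r. (\<forall>k<n. a \<le> l k \<and> l k \<le> r k \<and> r k \<le> b) \<longrightarrow>
        (\<forall>k. Suc k < n \<longrightarrow> r k \<le> l (Suc k)) \<longrightarrow> (\<Sum>k<n. r k - l k) < \<delta> \<longrightarrow>
        (\<Sum>k<n. norm (r k - l k)) < e"
  proof (intro exI[of _ e] conjI allI impI \<open>e > 0\<close>)
    fix n :: nat and l r :: "nat \<Rightarrow> real"
    assume 1: "\<forall>k<n. a \<le> l k \<and> l k \<le> r k \<and> r k \<le> b" "(\<Sum>k<n. r k - l k) < e"
    have "(\<Sum>k<n. norm (r k - l k)) = (\<Sum>k<n. r k - l k)"
      using 1(1) by (intro sum.cong) auto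
    with 1 show "(\<Sum>k<n. norm (r k - l k)) < e" by simp
  qed
qed

lemma abs_cont_on_lipschitz:
  assumes "\<And>s t. s \<in> {a..b} \<Longrightarrow> t \<in> {a..b} \<Longrightarrow> norm (g s - g t) \<le> K * \<bar>s - t\<bar>"
  shows "abs_cont_on a b g"
  using abs_cont_on_lipschitz_comp[OF abs_cont_on_id, of a b g K] assms by auto

lemma abs_cont_on_cong:
  assumes "abs_cont_on a b f" "\<And>t. t \<in> {a..b} \<Longrightarrow> g t = f t"
  shows "abs_cont_on a b g"
proof (rule abs_cont_onI)
  fix e :: real assume "e > 0"
  from abs_cont_onD[OF assms(1) \<open>e > 0\<close>] obtain \<delta> where \<delta>: "\<delta> > 0"
    and *: "\<And>(n::nat) l r. \<lbrakk>\<And>k. k < n \<Longrightarrow> a \<le> l k \<and> l k \<le> r k \<and> r k \<le> b;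
     \<And>k. Suc k < n \<Longrightarrow> r k \<le> l (Suc k); (\<Sum>k<n. r k - l k) < \<delta>\<rbrakk> \<Longrightarrow>
     (\<Sum>k<n. norm (f (r k) - f (l k))) < e" by blast
  show "\<exists>\<delta>>0. \<forall>(n::nat) l r. (\<forall>k<n. a \<le> l k \<and> l k \<le> r k \<and> r k \<le> b) \<longrightarrow>
        (\<forall>k. Suc k < n \<longrightarrow> r k \<le> l (Suc k)) \<longrightarrow> (\<Sum>k<n. r k - l k) < \<delta> \<longrightarrow>
        (\<Sum>k<n. norm (g (r k) - g (l k))) < e"
  proof (intro exI[of _ \<delta>] conjI allI impI \<delta>)
    fix n :: nat and l r :: "nat \<Rightarrow> real"
    assume 1: "\<forall>k<n. a \<le> l k \<and> l k \<le> r k \<and> r k \<le> b" "\<forall>k. Suc k < n \<longrightarrow> r k \<le> l (Suc k)"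
      "(\<Sum>k<n. r k - l k) < \<delta>"
    have "g (r k) = f (r k)" "g (l k) = f (l k)" if "k < n" for k
      using 1(1) that by (force intro!: assms(2))+
    then have "(\<Sum>k<n. norm (g (r k) - g (l k))) = (\<Sum>k<n. norm (f (r k) - f (l k)))" by simp
    with *[of n l r] 1 show "(\<Sum>k<n. norm (g (r k) - g (l k))) < e" by simp
  qed
qed

text \<open>The exceptional set of the transformed property lies in the image of a null set under
  the inverse affine map.\<close>

lemma AE_lebesgue_affine:
  fixes c b :: real
  assumes P: "AE t in lebesgue. P t" and c: "c \<noteq> 0"
  shows "AE t in lebesgue. P (c * t + b)"
proof -
  obtain N where N: "negligible N" "{t. \<not> P t} \<subseteq> N"
    using P unfolding eventually_ae_filter_negligible by auto
  have "negligible ((\<lambda>s. (1/c) *\<^sub>R s + (- b / c)) ` N)"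
    using N(1) c by (intro negligible_differentiable_image_negligible)
      (simp_all add: differentiable_on_def)
  moreover have "{t. \<not> P (c * t + b)} \<subseteq> (\<lambda>s. (1/c) *\<^sub>R s + (- b / c)) ` N"
  proof
    fix t assume "t \<in> {t. \<not> P (c * t + b)}"
    then have "c * t + b \<in> N" using N by auto
    moreover have "t = (1/c) *\<^sub>R (c * t + b) + (- b / c)" using c by (simp add: field_simps)
    ultimately show "t \<in> (\<lambda>s. (1/c) *\<^sub>R s + (- b / c)) ` N" by blast
  qed
  ultimately show ?thesis unfolding eventually_ae_filter_negligible by blast
qed

section \<open>Left-invariant vector fields and their flows\<close>

lemma dil_nth [simp]: "dil deg lam x $ i = lam ^ deg i * x $ i"
  by (simp add: dil_def)

lemma dil_zero [simp]: "dil deg lam 0 = 0"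
  by (simp add: vec_eq_iff)

lemma dil_one [simp]: "dil deg 1 x = x"
  by (simp add: vec_eq_iff)

lemma dil_dil: "dil deg a (dil deg b x) = dil deg (a * b) x"
  by (simp add: vec_eq_iff power_mult_distrib)

lemma bounded_linear_dil: "bounded_linear (dil deg lam)"
  by (rule linear_conv_bounded_linear[THEN iffD1])
    (auto intro!: linearI simp: vec_eq_iff algebra_simps)

lemma dil_scaleR: "dil deg lam (c *\<^sub>R x) = c *\<^sub>R dil deg lam x"
  by (simp add: vec_eq_iff)

lemma dil_axis: "dil deg lam (axis j 1) = lam ^ deg j *\<^sub>R axis j 1"
  by (simp add: vec_eq_iff axis_def)

lemma continuous_on_dil [continuous_intros]:
  "continuous_on S a \<Longrightarrow> continuous_on S f \<Longrightarrow> continuous_on S (\<lambda>x. dil deg (a x) (f x))"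
  unfolding dil_def by (intro continuous_intros)

lemma tendsto_dil [tendsto_intros]:
  "(a \<longlongrightarrow> l) F \<Longrightarrow> (f \<longlongrightarrow> m) F \<Longrightarrow> ((\<lambda>x. dil deg (a x) (f x)) \<longlongrightarrow> dil deg l m) F"
  unfolding dil_def by (intro tendsto_intros)

lemma has_vector_derivative_compose:
  assumes f: "(f has_vector_derivative f') (at t within S)" and g: "(g has_derivative g') (at (f t))"
  shows "((\<lambda>t. g (f t)) has_vector_derivative g' f') (at t within S)"
  using has_derivative_compose[OF f[unfolded has_vector_derivative_def] g]
  by (simp add: has_vector_derivative_def linear_cmul[OF has_derivative_linear[OF g]])

section \<open>Group operations and homogeneity of the generators\<close>

locale carnot =
  fixes op :: "real^'n \<Rightarrow> real^'n \<Rightarrow> real^'n" and deg :: "'n \<Rightarrow> nat"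
  assumes carnot: "carnot_group op deg"
begin

lemma op_assoc: "op (op x y) z = op x (op y z)"
  and op_0 [simp]: "op x 0 = x" "op 0 x = x"
  and deg_ge_1: "1 \<le> deg i"
  and dil_op: "lam > 0 \<Longrightarrow> dil deg lam (op x y) = op (dil deg lam x) (dil deg lam y)"
  and smooth_op: "smooth_fun (\<lambda>p. op (fst p) (snd p))"
proof -
  note c = carnot[unfolded carnot_group_def]
  show "op (op x y) z = op x (op y z)" using c[THEN conjunct1] by blast
  show "op x 0 = x" "op 0 x = x" using c[THEN conjunct2, THEN conjunct1] by blast+
  note c' = c[THEN conjunct2, THEN conjunct2, THEN conjunct2]
  show "smooth_fun (\<lambda>p. op (fst p) (snd p))" using c'[THEN conjunct1] .
  show "1 \<le> deg i" using c'[THEN conjunct2, THEN conjunct1] by blast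
  show "lam > 0 \<Longrightarrow> dil deg lam (op x y) = op (dil deg lam x) (dil deg lam y)"
    using c'[THEN conjunct2, THEN conjunct2, THEN conjunct1] by blast
qed

definition ginv :: "real^'n \<Rightarrow> real^'n" where
  "ginv = (SOME inv. smooth_fun inv \<and> (\<forall>x. op x (inv x) = 0 \<and> op (inv x) x = 0))"

lemma smooth_ginv: "smooth_fun ginv" and op_ginv [simp]: "op x (ginv x) = 0" "op (ginv x) x = 0"
proof -
  have "smooth_fun ginv \<and> (\<forall>x. op x (ginv x) = 0 \<and> op (ginv x) x = 0)"
    unfolding ginv_def
    by (rule someI_ex[OF carnot[unfolded carnot_group_def, THEN conjunct2, THEN conjunct2, THEN conjunct1]])
  then show "smooth_fun ginv" "op x (ginv x) = 0" "op (ginv x) x = 0" by auto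
qed

lemma op_ginv_cancel [simp]: "op (ginv x) (op x y) = y" "op x (op (ginv x) y) = y"
  by (simp_all flip: op_assoc)

lemma op_right_cancel [simp]: "op (op y x) (ginv x) = y" "op (op y (ginv x)) x = y"
  by (simp_all add: op_assoc)

lemma ginv_unique: "op x y = 0 \<Longrightarrow> y = ginv x"
  using op_ginv_cancel(1)[of x y] by simp

lemma diffk_op: "diffk k f \<Longrightarrow> diffk k g \<Longrightarrow> diffk k (\<lambda>x. op (f x) (g x))"
  using diffk_compose[of k "\<lambda>p. op (fst p) (snd p)" "\<lambda>x. (f x, g x)"] smooth_op diffk_Pair[of k f g]
  by (simp add: smooth_fun_def)

lemma diffk_ginv: "diffk k f \<Longrightarrow> diffk k (\<lambda>x. ginv (f x))"
  using diffk_compose smooth_ginv smooth_fun_def by blast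

lemma continuous_on_op [continuous_intros]:
  assumes "continuous_on S f" "continuous_on S g"
  shows "continuous_on S (\<lambda>x. op (f x) (g x))"
proof -
  have "continuous_on UNIV (\<lambda>p. op (fst p) (snd p))"
    using smooth_op diffk_imp_continuous_on smooth_fun_def by blast
  from continuous_on_compose2[OF this continuous_on_Pair[OF assms]] show ?thesis by simp
qed

lemma tendsto_op [tendsto_intros]:
  assumes "(f \<longlongrightarrow> a) F" "(g \<longlongrightarrow> b) F"
  shows "((\<lambda>x. op (f x) (g x)) \<longlongrightarrow> op a b) F"
proof -
  have "isCont (\<lambda>p. op (fst p) (snd p)) (a, b)"
    using smooth_op diffk_imp_continuous_on smooth_fun_def continuous_on_eq_continuous_at open_UNIV by blast
  from isCont_tendsto_compose[OF this tendsto_Pair[OF assms]] show ?thesis by simp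
qed

definition ldiff :: "real^'n \<Rightarrow> real^'n \<Rightarrow> real^'n \<Rightarrow> real^'n" where
  "ldiff x y = frechet_derivative (op x) (at y)"

lemma has_derivative_op: "(op x has_derivative ldiff x y) (at y)"
proof -
  have "diffk 1 (op x)"
    using diffk_op[OF diffk_const diffk_linear[OF bounded_linear_ident], of 1 x] by simp
  then show ?thesis unfolding ldiff_def using diffk_SucD(1)[of 0 "op x"] by simp
qed

lemma Zvf_eq_ldiff: "Zvf op j x = ldiff x 0 (axis j 1)"
  by (simp add: Zvf_def ldiff_def)

text \<open>Associativity says that left translation by \<open>z\<close> after left translation by
  \<open>x\<close> is left translation by \<open>op z x\<close>; differentiate this at 0.\<close>

lemma Zvf_left_invariant: "ldiff z x (Zvf op j x) = Zvf op j (op z x)"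
proof -
  have "((\<lambda>y. op z (op x y)) has_derivative (\<lambda>v. ldiff z (op x 0) (ldiff x 0 v))) (at 0)"
    by (rule has_derivative_compose[OF has_derivative_op has_derivative_op])
  moreover have "(\<lambda>y. op z (op x y)) = op (op z x)" by (simp add: op_assoc fun_eq_iff)
  ultimately have "(op (op z x) has_derivative (\<lambda>v. ldiff z x (ldiff x 0 v))) (at 0)" by simp
  from has_derivative_unique[OF this has_derivative_op] show ?thesis
    by (simp add: Zvf_eq_ldiff fun_eq_iff)
qed

text \<open>\<open>Zvf\<close> differentiates a separate map for each \<open>x\<close>. Smoothness
  in \<open>x\<close> becomes visible once it is written as the joint derivative of the group law at
  \<open>(x, 0)\<close> in the fixed direction \<open>(0, axis j 1)\<close>.\<close>

lemma diffk_Zvf: "diffk k (Zvf op j)"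
proof -
  have s: "diffk (Suc k) (\<lambda>p. op (fst p) (snd p))" using smooth_op smooth_fun_def by blast
  let ?D = "frechet_derivative (\<lambda>p. op (fst p) (snd p))"
  have "Zvf op j x = ?D (at (x, 0)) (0, axis j 1)" for x
  proof -
    have "((\<lambda>y. op (fst (x, y)) (snd (x, y))) has_derivative (\<lambda>v. ?D (at (x, 0)) (0, v))) (at 0)"
      by (rule has_derivative_compose[OF _ diffk_SucD(1)[OF s], of "\<lambda>y. (x, y)" "\<lambda>v. (0, v)"])
        (auto intro!: derivative_eq_intros)
    then have "(op x has_derivative (\<lambda>v. ?D (at (x, 0)) (0, v))) (at 0)" by simp
    from has_derivative_unique[OF this has_derivative_op] show ?thesis
      by (simp add: Zvf_eq_ldiff fun_eq_iff)
  qed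
  moreover have "diffk k (\<lambda>x. ?D (at (x, 0)) (0, axis j 1))"
    by (rule diffk_compose[OF diffk_SucD(2)[OF s] diffk_Pair[OF diffk_linear[OF bounded_linear_ident] diffk_const]])
  ultimately show ?thesis by presburger
qed

text \<open>Conjugating a left translation with dilations gives the left translation by the dilated
  point, and \<open>axis j 1\<close> is an eigenvector of the dilation with eigenvalue
  \<open>lam\<close> because \<open>deg j = 1\<close>.\<close>

lemma Zvf_dil_pos:
  assumes j: "deg j = 1" and lam: "lam > 0"
  shows "Zvf op j (dil deg lam x) = (1 / lam) *\<^sub>R dil deg lam (Zvf op j x)"
proof -
  have eq: "op (dil deg lam x) = (\<lambda>y. dil deg lam (op x (dil deg (1 / lam) y)))"
    using lam by (simp add: dil_op dil_dil fun_eq_iff)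
  have "((\<lambda>y. dil deg lam (op x (dil deg (1 / lam) y))) has_derivative
      (\<lambda>v. dil deg lam (ldiff x (dil deg (1 / lam) 0) (dil deg (1 / lam) v)))) (at 0)"
    by (intro bounded_linear.has_derivative[OF bounded_linear_dil]
      has_derivative_compose[OF bounded_linear_imp_has_derivative[OF bounded_linear_dil] has_derivative_op])
  then have "(op (dil deg lam x) has_derivative
      (\<lambda>v. dil deg lam (ldiff x 0 (dil deg (1 / lam) v)))) (at 0)" unfolding eq by simp
  from has_derivative_unique[OF this has_derivative_op]
  have "ldiff (dil deg lam x) 0 v = dil deg lam (ldiff x 0 (dil deg (1 / lam) v))" for v
    by (simp add: fun_eq_iff)
  moreover have "ldiff x 0 (c *\<^sub>R v) = c *\<^sub>R ldiff x 0 v" for c v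
    using linear_cmul[OF has_derivative_linear[OF has_derivative_op]] by blast
  ultimately show ?thesis
    by (simp add: Zvf_eq_ldiff dil_axis j dil_scaleR)
qed

text \<open>In coordinates the division by \<open>lam\<close> disappears, since every degree is at
  least 1, and the identity extends to \<open>lam = 0\<close> by continuity. The convention
  \<open>0 ^ 0 = 1\<close> is then the right one for first-layer coordinates.\<close>

lemma Zvf_dil:
  assumes j: "deg j = 1" and lam: "lam \<ge> 0"
  shows "Zvf op j (dil deg lam x) $ i = lam ^ (deg i - 1) * Zvf op j x $ i"
proof -
  have pos: "Zvf op j (dil deg l x) $ i = l ^ (deg i - 1) * Zvf op j x $ i" if "l > 0" for l
    using that deg_ge_1[of i] by (simp add: Zvf_dil_pos[OF j that] power_diff)
  show ?thesis
  proof (cases "lam = 0")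
    case True
    have c: "isCont (Zvf op j) (dil deg 0 x)"
      using diffk_imp_continuous_on[OF diffk_Zvf] by (simp add: continuous_on_eq_continuous_at)
    have 1: "((\<lambda>l. Zvf op j (dil deg l x) $ i) \<longlongrightarrow> Zvf op j (dil deg 0 x) $ i) (at_right 0)"
      by (intro tendsto_vec_nth isCont_tendsto_compose[OF c] tendsto_intros)
    have 2: "((\<lambda>l. l ^ (deg i - 1) * Zvf op j x $ i) \<longlongrightarrow> 0 ^ (deg i - 1) * Zvf op j x $ i) (at_right 0)"
      by (intro tendsto_intros)
    have 3: "\<forall>\<^sub>F l in at_right 0. Zvf op j (dil deg l x) $ i = l ^ (deg i - 1) * Zvf op j x $ i"
      unfolding eventually_at_right_field using pos by (intro exI[of _ 1]) auto
    show ?thesis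
      unfolding True
      by (rule tendsto_unique[OF trivial_limit_at_right_real Lim_transform_eventually[OF 1 3] 2])
  qed (use pos lam in auto)
qed

text \<open>The component is homogeneous of degree \<open>deg i - 1\<close>, so its partial
  derivative in a coordinate of degree at least \<open>deg i\<close> has negative homogeneity. Being
  continuous at the origin, that derivative must vanish, and the component is constant on the
  segment from \<open>x\<close> to \<open>y\<close>.\<close>

lemma Zvf_depends_on_lower:
  assumes j: "deg j = 1" and eq: "\<And>k. deg k < deg i \<Longrightarrow> x $ k = y $ k"
  shows "Zvf op j x $ i = Zvf op j y $ i"
proof -
  define a where "a x = Zvf op j x $ i" for x
  define a' where "a' x = frechet_derivative a (at x)" for x
  have ak: "diffk (Suc 0) a" unfolding a_def
    by (rule diffk_linear_compose[OF bounded_linear_vec_nth diffk_Zvf])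
  have a': "(a has_derivative a' x) (at x)" for x
    unfolding a'_def using diffk_SucD(1)[OF ak] .
  have hom: "a (dil deg l x) = l ^ (deg i - 1) * a x" if "l > 0" for l x
    unfolding a_def using Zvf_dil[OF j] that by simp
  have zero: "a' x (axis k 1) = 0" if k: "deg k \<ge> deg i" for x k
  proof -
    have 1: "a' x (axis k 1) = l ^ (deg k - (deg i - 1)) * a' (dil deg l x) (axis k 1)" if "l > 0" for l
    proof -
      have "((\<lambda>x. a (dil deg l x)) has_derivative (\<lambda>v. a' (dil deg l x) (dil deg l v))) (at x)"
        by (rule has_derivative_compose[OF bounded_linear_imp_has_derivative[OF bounded_linear_dil] a'])
      moreover have "((\<lambda>x. l ^ (deg i - 1) * a x) has_derivative (\<lambda>v. l ^ (deg i - 1) * a' x v)) (at x)"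
        using a' by (rule has_derivative_mult_right)
      ultimately have "a' (dil deg l x) (dil deg l (axis k 1)) = l ^ (deg i - 1) * a' x (axis k 1)"
        using has_derivative_unique hom[OF that] by (metis (no_types, lifting) ext)
      moreover have "a' (dil deg l x) (dil deg l (axis k 1)) = l ^ deg k * a' (dil deg l x) (axis k 1)"
        using linear_cmul[OF has_derivative_linear[OF a'], of "dil deg l x" "l ^ deg k" "axis k 1"]
        by (simp add: dil_axis)
      moreover have "l ^ deg k = l ^ (deg i - 1) * l ^ (deg k - (deg i - 1))"
        using k by (simp flip: power_add)
      ultimately show ?thesis using that by simp
    qed
    \<comment> \<open>Letting \<open>l\<close> tend to 0 in the scaling relation: the derivative on
      the right converges, while the exponent of \<open>l\<close> is at least 1.\<close>
    have c: "isCont (\<lambda>x. a' x (axis k 1)) (dil deg 0 x)"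
      using diffk_imp_continuous_on[OF diffk_SucD(2)[OF ak]] unfolding a'_def
      by (simp add: continuous_on_eq_continuous_at)
    have "((\<lambda>l. l ^ (deg k - (deg i - 1)) * a' (dil deg l x) (axis k 1)) \<longlongrightarrow>
        0 ^ (deg k - (deg i - 1)) * a' (dil deg 0 x) (axis k 1)) (at_right 0)"
      by (intro tendsto_intros isCont_tendsto_compose[OF c])
    moreover have "(0::real) ^ (deg k - (deg i - 1)) = 0" using k deg_ge_1[of i] by (simp add: power_0_left)
    ultimately have "((\<lambda>l. l ^ (deg k - (deg i - 1)) * a' (dil deg l x) (axis k 1)) \<longlongrightarrow> 0) (at_right 0)"
      by (simp only: mult_zero_left)
    moreover have "\<forall>\<^sub>F l in at_right 0. l ^ (deg k - (deg i - 1)) * a' (dil deg l x) (axis k 1) = a' x (axis k 1)"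
      unfolding eventually_at_right_field using 1 by (intro exI[of _ 1]) auto
    ultimately have "((\<lambda>l::real. a' x (axis k 1)) \<longlongrightarrow> 0) (at_right 0)"
      using tendsto_cong by force
    then show ?thesis by (simp add: tendsto_const_iff)
  qed
  have "a' z (y - x) = 0" for z
  proof -
    have eq': "y - x = (\<Sum>k\<in>UNIV. (y - x) $ k *\<^sub>R axis k 1)"
      by (simp add: vec_eq_iff axis_def if_distrib cong: if_cong)
    have "a' z (y - x) = (\<Sum>k\<in>UNIV. (y - x) $ k * a' z (axis k 1))"
      by (subst eq', simp only: linear_sum[OF has_derivative_linear[OF a']]
          linear_cmul[OF has_derivative_linear[OF a']] real_scaleR_def)
    also have "\<dots> = 0"
    proof (rule sum.neutral, rule ballI)
      fix k show "(y - x) $ k * a' z (axis k 1) = 0"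
        using zero[of k z] eq[of k] by (cases "deg k < deg i") auto
    qed
    finally show ?thesis .
  qed
  moreover have "((\<lambda>s. x + s *\<^sub>R (y - x)) has_vector_derivative (y - x)) (at s)" for s
    by (auto intro!: derivative_eq_intros)
  ultimately have "((\<lambda>s. a (x + s *\<^sub>R (y - x))) has_real_derivative 0) (at s)" for s :: real
    using has_vector_derivative_compose[OF _ a', of "\<lambda>s. x + s *\<^sub>R (y - x)" "y - x" s]
    by (simp add: has_real_derivative_iff_has_vector_derivative)
  then have "a (x + 0 *\<^sub>R (y - x)) = a (x + 1 *\<^sub>R (y - x))"
    using DERIV_isconst_all by blast
  then show ?thesis by (simp add: a_def)
qed

section \<open>Horizontal one-parameter subgroups\<close>

definition hvec :: "('n \<Rightarrow> real) \<Rightarrow> real^'n \<Rightarrow> real^'n" where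
  "hvec h x = (\<Sum>j\<in>{j. deg j = 1}. h j *\<^sub>R Zvf op j x)"

lemma hvec_depends_on_lower:
  assumes "\<And>k. deg k < deg i \<Longrightarrow> x $ k = y $ k"
  shows "hvec h x $ i = hvec h y $ i"
  unfolding hvec_def using Zvf_depends_on_lower[OF _ assms] by simp

lemma hvec_dil: "lam \<ge> 0 \<Longrightarrow> hvec h (dil deg lam x) $ i = lam ^ (deg i - 1) * hvec h x $ i"
  unfolding hvec_def by (auto simp: Zvf_dil sum_distrib_left intro!: sum.cong)

lemma hvec_scale: "hvec (\<lambda>j. c * h j) x = c *\<^sub>R hvec h x"
  unfolding hvec_def by (simp add: scaleR_sum_right)

lemma hvec_left_invariant: "ldiff z x (hvec h x) = hvec h (op z x)"
  unfolding hvec_def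
  by (simp add: linear_sum[OF has_derivative_linear[OF has_derivative_op]]
    linear_cmul[OF has_derivative_linear[OF has_derivative_op]] Zvf_left_invariant)

text \<open>The coordinates of the time-one point of the one-parameter subgroup with velocity
  \<open>h\<close> can be solved for degree by degree.\<close>

lemma exp_point_exists: "\<exists>c. \<forall>i. real (deg i) * c $ i = hvec h c $ i"
proof -
  have "\<exists>c. \<forall>i. deg i \<le> m \<longrightarrow> real (deg i) * c $ i = hvec h c $ i" for m
  proof (induction m)
    case 0
    show ?case using deg_ge_1 by (metis not_one_le_zero le_zero_eq)
  next
    case (Suc m)
    then obtain c where c: "\<And>i. deg i \<le> m \<Longrightarrow> real (deg i) * c $ i = hvec h c $ i" by blast
    define c' where "c' = (\<chi> i. if deg i = Suc m then hvec h c $ i / real (Suc m) else c $ i)"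
    have low: "hvec h c' $ i = hvec h c $ i" if "deg i \<le> Suc m" for i
      using that by (intro hvec_depends_on_lower) (auto simp: c'_def)
    have "real (deg i) * c' $ i = hvec h c' $ i" if "deg i \<le> Suc m" for i
      using that low[OF that] c[of i] by (cases "deg i = Suc m") (auto simp: c'_def)
    then show ?case by blast
  qed
  from this[of "Max (range deg)"] obtain c
    where c: "\<forall>i. deg i \<le> Max (range deg) \<longrightarrow> real (deg i) * c $ i = hvec h c $ i" by blast
  have "deg i \<le> Max (range deg)" for i by simp
  with c show ?thesis by blast
qed

text \<open>The equation is the velocity condition at time 1 for the curve
  \<open>\<lambda>r. dil deg r c\<close>, whose \<open>i\<close>-th coordinate has derivative
  \<open>deg i * c $ i\<close> there.\<close>

definition exp_point :: "('n \<Rightarrow> real) \<Rightarrow> real^'n" where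
  "exp_point h = (SOME c. \<forall>i. real (deg i) * c $ i = hvec h c $ i)"

lemma exp_point: "real (deg i) * exp_point h $ i = hvec h (exp_point h) $ i"
  unfolding exp_point_def using someI_ex[OF exp_point_exists] by blast

text \<open>As the velocity lies in the first layer, the time-\<open>r\<close> point of the subgroup
  is the dilation by \<open>r\<close> of its time-one point; the integral curve through
  \<open>x\<close> is its left translate.\<close>

definition flow :: "('n \<Rightarrow> real) \<Rightarrow> real^'n \<Rightarrow> real \<Rightarrow> real^'n" where
  "flow h x r = op x (dil deg r (exp_point h))"

lemma dil_at_0 [simp]: "dil deg 0 x = 0"
proof -
  have "deg i \<noteq> 0" for i using deg_ge_1[of i] by simp
  then show ?thesis by (simp add: vec_eq_iff)
qed

lemma flow_0 [simp]: "flow h x 0 = x"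
  by (simp add: flow_def)

text \<open>Homogeneity carries the equation of \<open>exp_point\<close> from time 1 to every
  \<open>r >= 0\<close>, and left invariance carries the curve from 0 to \<open>x\<close>.\<close>

lemma flow_derivative:
  assumes "r \<ge> 0"
  shows "(flow h x has_vector_derivative hvec h (flow h x r)) (at r)"
proof -
  have "((\<lambda>r. dil deg r (exp_point h)) has_vector_derivative hvec h (dil deg r (exp_point h))) (at r)"
    unfolding has_vector_derivative_def
  proof (rule has_derivative_componentwise_within[THEN iffD2], rule ballI)
    fix b :: "real^'n" assume "b \<in> Basis"
    then obtain i where b: "b = axis i 1" by (auto simp: Basis_vec_def)
    have "((\<lambda>r. r ^ deg i * exp_point h $ i) has_real_derivative (deg i * r ^ (deg i - 1)) * exp_point h $ i) (at r)"
      by (auto intro!: derivative_eq_intros)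
    moreover have "(deg i * r ^ (deg i - 1)) * exp_point h $ i = hvec h (dil deg r (exp_point h)) $ i"
      using exp_point[of i h] by (simp add: hvec_dil[OF assms])
    ultimately show "((\<lambda>r. dil deg r (exp_point h) \<bullet> b) has_derivative
        (\<lambda>v. (v *\<^sub>R hvec h (dil deg r (exp_point h))) \<bullet> b)) (at r)"
      by (simp add: b inner_axis has_field_derivative_def mult.commute[of _ "hvec _ _ $ _"])
  qed
  from has_vector_derivative_compose[OF this has_derivative_op] show ?thesis
    by (simp add: hvec_left_invariant flow_def[abs_def])
qed

end

section \<open>Invariance of Lebesgue measure under right translations\<close>

text \<open>The change of variables theorem of the library needs a well-ordered index type,
  hence a copy of the index type carrying an arbitrary well-order.\<close>

typedef 'a ordered_copy = "UNIV :: 'a set" by simp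

definition finite_code :: "'a::finite \<Rightarrow> nat" where
  "finite_code = (SOME f. inj f)"

lemma inj_finite_code: "inj (finite_code :: 'a::finite \<Rightarrow> nat)"
proof -
  obtain f :: "'a \<Rightarrow> nat" where "inj f"
    using finite_imp_inj_to_nat_seg[of "UNIV :: 'a set"] by auto
  then show ?thesis unfolding finite_code_def by (rule someI[of inj])
qed

instantiation ordered_copy :: (finite) wellorder
begin

definition less_eq_ordered_copy :: "'a ordered_copy \<Rightarrow> 'a ordered_copy \<Rightarrow> bool" where
  "x \<le> y \<longleftrightarrow> finite_code (Rep_ordered_copy x) \<le> finite_code (Rep_ordered_copy y)"

definition less_ordered_copy :: "'a ordered_copy \<Rightarrow> 'a ordered_copy \<Rightarrow> bool" where
  "x < y \<longleftrightarrow> finite_code (Rep_ordered_copy x) < finite_code (Rep_ordered_copy y)"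

instance
proof
  fix x y z :: "'a ordered_copy" and P :: "'a ordered_copy \<Rightarrow> bool"
  show "x = y" if "x \<le> y" "y \<le> x"
    using that injD[OF inj_finite_code] unfolding less_eq_ordered_copy_def
    by (metis Rep_ordered_copy_inject antisym)
  show "P x" if "\<And>x. (\<And>y. y < x \<Longrightarrow> P y) \<Longrightarrow> P x"
    using that unfolding less_ordered_copy_def
    by (induction x rule: measure_induct_rule[of "\<lambda>x. finite_code (Rep_ordered_copy x)"]) blast
qed (auto simp: less_eq_ordered_copy_def less_ordered_copy_def)

end

instance ordered_copy :: (finite) finite
proof
  have eq: "(UNIV :: 'a ordered_copy set) = range Abs_ordered_copy"
    using type_definition.Abs_image[OF type_definition_ordered_copy, symmetric] .
  show "finite (UNIV :: 'a ordered_copy set)" by (subst eq) (rule finite_imageI[OF finite])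
qed

definition reindex :: "real^('n::finite) \<Rightarrow> real^('n ordered_copy)" where
  "reindex x = (\<chi> i. x $ Rep_ordered_copy i)"

definition unindex :: "real^('n::finite ordered_copy) \<Rightarrow> real^'n" where
  "unindex x = (\<chi> i. x $ Abs_ordered_copy i)"

lemma unindex_reindex [simp]: "unindex (reindex x) = x" "reindex (unindex y) = y"
  by (simp_all add: reindex_def unindex_def vec_eq_iff Abs_ordered_copy_inverse Rep_ordered_copy_inverse)

lemma reindex_nth [simp]: "reindex x $ i = x $ Rep_ordered_copy i"
  by (simp add: reindex_def)

lemma unindex_nth [simp]: "unindex x $ i = x $ Abs_ordered_copy i"
  by (simp add: unindex_def)

lemma bounded_linear_reindex: "bounded_linear reindex"
  and bounded_linear_unindex: "bounded_linear unindex"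
  by (auto intro!: linear_conv_bounded_linear[THEN iffD1] linearI simp: vec_eq_iff)

lemma prod_Basis_vec:
  fixes f :: "real^'n \<Rightarrow> 'c::comm_monoid_mult"
  shows "(\<Prod>b\<in>Basis. f b) = (\<Prod>i\<in>UNIV. f (axis i 1))"
proof -
  have eq: "Basis = range (\<lambda>i::'n. axis i (1::real))" by (auto simp: Basis_vec_def)
  have "inj (\<lambda>i::'n. axis i (1::real))" by (auto simp: inj_def axis_eq_axis)
  from prod.reindex[OF this, of f] show ?thesis unfolding eq by (simp add: o_def)
qed

lemma reindex_vimage_box: "reindex -` box l u = box (unindex l) (unindex u)"
  unfolding set_eq_iff vimage_eq mem_box_cart reindex_nth unindex_nth
  by (metis Rep_ordered_copy_inverse Abs_ordered_copy_inverse UNIV_I)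

lemma distr_reindex: "distr lborel borel reindex = (lborel :: (real^('n::finite ordered_copy)) measure)"
proof (rule lborel_eqI[symmetric])
  fix l u :: "real^('n::finite ordered_copy)" assume lu: "\<And>b. b \<in> Basis \<Longrightarrow> l \<bullet> b \<le> u \<bullet> b"
  have m: "(reindex :: real^'n \<Rightarrow> _) \<in> borel_measurable borel"
    by (intro borel_measurable_continuous_onI linear_continuous_on bounded_linear_reindex)
  have le: "l $ i \<le> u $ i" for i using lu[of "axis i 1"] by (simp add: inner_axis)
  have "emeasure (distr lborel borel reindex) (box l u) = emeasure lborel (box (unindex l) (unindex u))"
    using m by (simp add: emeasure_distr reindex_vimage_box)
  also have "\<dots> = (\<Prod>b\<in>Basis. (unindex u - unindex l) \<bullet> b)"
    using le by (intro emeasure_lborel_box) (auto simp: Basis_vec_def inner_axis)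
  also have "\<dots> = (\<Prod>b\<in>Basis. (u - l) \<bullet> b)"
    unfolding prod_Basis_vec
    by (auto simp: inner_axis Abs_ordered_copy_inverse intro!: arg_cong[where f=ennreal]
        prod.reindex_bij_witness[where i=Rep_ordered_copy and j=Abs_ordered_copy] Rep_ordered_copy_inverse)
  finally show "emeasure (distr lborel borel reindex) (box l u) = (\<Prod>b\<in>Basis. (u - l) \<bullet> b)" .
qed simp

lemma emeasure_reindex_image:
  fixes S :: "(real^'n::finite) set"
  assumes "S \<in> sets borel"
  shows "emeasure lborel (reindex ` S) = emeasure lborel S" "reindex ` S \<in> sets borel"
proof -
  have m: "(unindex :: _ \<Rightarrow> real^'n) \<in> borel_measurable borel"
    "(reindex :: real^'n \<Rightarrow> _) \<in> borel_measurable borel"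
    by (auto intro!: borel_measurable_continuous_onI linear_continuous_on bounded_linear_reindex bounded_linear_unindex)
  have eq: "reindex ` S = unindex -` S" by (force simp: image_iff)
  show 1: "reindex ` S \<in> sets borel" unfolding eq using measurable_sets_borel[OF m(1) assms] .
  have "emeasure lborel (reindex ` S) = emeasure (distr lborel borel reindex) (reindex ` S)"
    by (simp add: distr_reindex)
  also have "\<dots> = emeasure lborel (reindex -` (reindex ` S))"
    using m 1 by (simp add: emeasure_distr)
  also have "reindex -` (reindex ` S) = S" by (auto dest: arg_cong[where f=unindex])
  finally show "emeasure lborel (reindex ` S) = emeasure lborel S" .
qed

section \<open>The Jacobian of right translations\<close>

context carnot
begin

text \<open>Expressed through the joint derivative of the group law so that continuity in both
  points, used when both shrink to the origin, is immediate.\<close>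

definition rdiff :: "real^'n \<Rightarrow> real^'n \<Rightarrow> real^'n \<Rightarrow> real^'n" where
  "rdiff x y v = frechet_derivative (\<lambda>p. op (fst p) (snd p)) (at (y, x)) (v, 0)"

lemma has_derivative_op_right: "((\<lambda>y. op y x) has_derivative rdiff x y) (at y)"
proof -
  have s: "diffk (Suc 0) (\<lambda>p. op (fst p) (snd p))" using smooth_op smooth_fun_def by blast
  have "((\<lambda>y. op (fst (y, x)) (snd (y, x))) has_derivative rdiff x y) (at y)"
    unfolding rdiff_def[abs_def]
    by (rule has_derivative_compose[OF _ diffk_SucD(1)[OF s], of "\<lambda>y. (y, x)" "\<lambda>v. (v, 0)"])
      (auto intro!: derivative_eq_intros)
  then show ?thesis by simp
qed

lemma rdiff_continuous: "isCont (\<lambda>p. rdiff (snd p) (fst p) v) q"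
proof -
  have s: "diffk (Suc 0) (\<lambda>p. op (fst p) (snd p))" using smooth_op smooth_fun_def by blast
  show ?thesis unfolding rdiff_def prod.collapse
    using diffk_imp_continuous_on[OF diffk_SucD(2)[OF s, of "(v, 0)"]]
    by (cases q) (simp add: continuous_on_eq_continuous_at)
qed

lemma rdiff_dil:
  assumes "l > 0"
  shows "rdiff (dil deg l x) (dil deg l y) (dil deg l v) = dil deg l (rdiff x y v)"
proof -
  have "((\<lambda>y. op (dil deg l y) (dil deg l x)) has_derivative (\<lambda>v. rdiff (dil deg l x) (dil deg l y) (dil deg l v))) (at y)"
    by (rule has_derivative_compose[OF bounded_linear_imp_has_derivative[OF bounded_linear_dil] has_derivative_op_right])
  moreover have "((\<lambda>y. dil deg l (op y x)) has_derivative (\<lambda>v. dil deg l (rdiff x y v))) (at y)"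
    by (rule bounded_linear.has_derivative[OF bounded_linear_dil has_derivative_op_right])
  ultimately show ?thesis
    unfolding dil_op[OF assms] by (rule has_derivative_unique[THEN fun_cong])
qed

text \<open>The Jacobian determinant of \<open>\<lambda>y. op y x\<close> at \<open>y\<close>, taken
  in the reindexed coordinates in which the change of variables is carried out.\<close>

definition jac :: "real^'n \<Rightarrow> real^'n \<Rightarrow> real" where
  "jac x y = det (matrix (\<lambda>v. reindex (rdiff x y (unindex v))))"

text \<open>A dilation intertwines right translation by \<open>x\<close> with right translation by
  the dilated \<open>x\<close>, and its determinant cancels on the two sides.\<close>

lemma jac_dil:
  assumes l: "l > 0"
  shows "jac (dil deg l x) (dil deg l y) = jac x y"
proof -
  let ?D = "\<lambda>l v. reindex (dil deg l (unindex v))" and ?R = "\<lambda>x y v. reindex (rdiff x y (unindex v))"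
  have lin: "linear (?D l)" "linear (?R x y)" for l x y
    by (rule bounded_linear.linear[OF bounded_linear_compose[OF bounded_linear_reindex
          bounded_linear_compose[OF bounded_linear_dil bounded_linear_unindex]]],
        rule bounded_linear.linear[OF bounded_linear_compose[OF bounded_linear_reindex
          bounded_linear_compose[OF has_derivative_bounded_linear[OF has_derivative_op_right] bounded_linear_unindex]]])
  have "?R (dil deg l x) (dil deg l y) \<circ> ?D l = ?D l \<circ> ?R x y"
    using rdiff_dil[OF l] by (simp add: fun_eq_iff)
  then have "matrix (?R (dil deg l x) (dil deg l y)) ** matrix (?D l) = matrix (?D l) ** matrix (?R x y)"
    using lin by (simp flip: matrix_compose)
  then have *: "jac (dil deg l x) (dil deg l y) * det (matrix (?D l)) = det (matrix (?D l)) * jac x y"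
    unfolding jac_def by (simp flip: det_mul)
  \<comment> \<open>The dilation by \<open>1 / l\<close> is an inverse, so the determinant to be
    cancelled is nonzero.\<close>
  have "?D l \<circ> ?D (1 / l) = id" using l by (simp add: fun_eq_iff dil_dil)
  then have "matrix (?D l) ** matrix (?D (1 / l)) = mat 1"
    using lin by (simp flip: matrix_compose add: matrix_id_mat_1)
  then have "det (matrix (?D l)) * det (matrix (?D (1 / l))) = 1"
    by (metis det_I det_mul)
  then have "det (matrix (?D l)) \<noteq> 0" by auto
  with * show ?thesis by simp
qed

text \<open>By \<open>jac_dil\<close> the value is constant while both points are dilated towards 0;
  there right translation by the identity element has the identity as derivative.\<close>

lemma jac_eq_1: "jac x y = 1"
proof -
  have entry: "((\<lambda>l. reindex (rdiff (dil deg l x) (dil deg l y) v) $ i) \<longlongrightarrow>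
      reindex (rdiff (dil deg 0 x) (dil deg 0 y) v) $ i) (at_right 0)" for v i
  proof -
    have "((\<lambda>l. (dil deg l y, dil deg l x)) \<longlongrightarrow> (dil deg 0 y, dil deg 0 x)) (at_right 0)"
      by (intro tendsto_intros)
    from isCont_tendsto_compose[OF rdiff_continuous this] show ?thesis
      unfolding reindex_nth by (intro tendsto_vec_nth) simp
  qed
  have "((\<lambda>l. jac (dil deg l x) (dil deg l y)) \<longlongrightarrow> jac (dil deg 0 x) (dil deg 0 y)) (at_right 0)"
    unfolding jac_def det_def matrix_def vec_lambda_beta
    by (intro tendsto_sum tendsto_prod tendsto_mult tendsto_const entry)
  moreover have "\<forall>\<^sub>F l in at_right 0. jac (dil deg l x) (dil deg l y) = jac x y"
    unfolding eventually_at_right_field using jac_dil by (intro exI[of _ 1]) auto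
  ultimately have "((\<lambda>l::real. jac x y) \<longlongrightarrow> jac (dil deg 0 x) (dil deg 0 y)) (at_right 0)"
    using tendsto_cong by force
  then have "jac x y = jac (dil deg 0 x) (dil deg 0 y)"
    by (simp add: tendsto_const_iff)
  moreover have "rdiff 0 0 = (\<lambda>v. v)"
    using has_derivative_unique[OF has_derivative_op_right[of 0 0]] has_derivative_ident by simp
  ultimately show ?thesis
    by (simp add: jac_def matrix_id_mat_1[unfolded id_def])
qed

text \<open>The preimage of a box under right translation by \<open>x\<close> is its image under
  right translation by \<open>ginv x\<close>, a diffeomorphism of Jacobian 1. Equality on boxes
  determines the measure.\<close>

lemma distr_op_right: "distr lborel borel (\<lambda>y. op y x) = lborel"
proof (rule lborel_eqI[symmetric])
  fix l u :: "real^'n" assume lu: "\<And>b. b \<in> Basis \<Longrightarrow> l \<bullet> b \<le> u \<bullet> b"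
  define B where "B = reindex ` box l u"
  define q where "q v = reindex (op (unindex v) (ginv x))" for v
  define q' where "q' v w = reindex (rdiff (ginv x) (unindex v) (unindex w))" for v w
  have der: "(q has_derivative q' v) (at v)" for v
    unfolding q_def[abs_def] q'_def
    by (rule bounded_linear.has_derivative[OF bounded_linear_reindex
        has_derivative_compose[OF bounded_linear_imp_has_derivative[OF bounded_linear_unindex] has_derivative_op_right]])
  have det1: "det (matrix (q' v)) = 1" for v
    unfolding q'_def using jac_eq_1 by (simp add: jac_def)
  have inj: "inj_on q B"
    by (rule inj_on_inverseI[where g="\<lambda>w. reindex (op (unindex w) x)"]) (simp add: q_def)
  have Bm: "B \<in> sets borel" "emeasure lborel B = emeasure lborel (box l u)"
    unfolding B_def by (auto intro!: emeasure_reindex_image)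
  then have "B \<in> lmeasurable"
    by (intro fmeasurableI) (auto simp: emeasure_lborel_box_eq)
  then have "(\<lambda>_. 1 :: real) integrable_on B"
    by (simp add: lmeasurable_iff_integrable_on)
  from integrable_integral[OF this]
  have "((\<lambda>v. \<bar>det (matrix (q' v))\<bar>) has_integral measure lebesgue B) B"
    unfolding det1 by (simp add: lmeasure_integral[OF \<open>B \<in> lmeasurable\<close>])
  with has_measure_differentiable_image[of B q q'] inj der Bm(1)
  have qB: "q ` B \<in> lmeasurable" "measure lebesgue (q ` B) = measure lebesgue B"
    by (auto intro: has_derivative_at_withinI)
  have mR: "(\<lambda>y. op y x) \<in> borel_measurable borel"
    by (intro borel_measurable_continuous_onI continuous_intros)
  have Sb: "(\<lambda>y. op y x) -` box l u \<in> sets borel" using measurable_sets_borel[OF mR] by simp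
  have "q ` B = reindex ` ((\<lambda>y. op y x) -` box l u)"
    unfolding B_def q_def image_image
    by (auto simp: image_iff) (metis op_right_cancel(1))
  then have *: "emeasure lborel ((\<lambda>y. op y x) -` box l u) = emeasure lborel (q ` B)" "q ` B \<in> sets borel"
    using emeasure_reindex_image[OF Sb] by auto
  have "emeasure (distr lborel borel (\<lambda>y. op y x)) (box l u) = emeasure lborel (q ` B)"
    using mR * by (simp add: emeasure_distr)
  also have "\<dots> = emeasure lebesgue (q ` B)" using *(2) by simp
  also have "\<dots> = emeasure lebesgue B"
    using qB \<open>B \<in> lmeasurable\<close> by (simp add: emeasure_eq_measure2)
  also have "\<dots> = emeasure lborel (box l u)" using Bm by simp
  also have "\<dots> = (\<Prod>b\<in>Basis. (u - l) \<bullet> b)" using lu by (rule emeasure_lborel_box)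
  finally show "emeasure (distr lborel borel (\<lambda>y. op y x)) (box l u) = (\<Prod>b\<in>Basis. (u - l) \<bullet> b)" .
qed simp

end

section \<open>Subunit curves and the Carnot-Caratheodory distance\<close>

text \<open>The set is enlarged to a ball because the mean value bound needs convexity.
  \<open>diffk\<close> gives continuity of each directional derivative only, so the operator norm is
  bounded by the sum over the basis directions.\<close>

lemma diffk_1_lipschitz_on_bounded:
  fixes f :: "'a::euclidean_space \<Rightarrow> 'b::real_normed_vector"
  assumes f: "diffk (Suc 0) f" and S: "bounded S"
  obtains K where "\<And>x y. x \<in> S \<Longrightarrow> y \<in> S \<Longrightarrow> norm (f x - f y) \<le> K * norm (x - y)"
proof -
  obtain R where "\<forall>x\<in>S. norm x \<le> R" using S unfolding bounded_iff by blast
  then have R: "S \<subseteq> cball 0 R" by auto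
  let ?D = "\<lambda>x. frechet_derivative f (at x)"
  have "\<exists>M. \<forall>x\<in>cball 0 R. norm (?D x b) \<le> M" for b
  proof -
    have "continuous_on (cball 0 R) (\<lambda>x. ?D x b)"
      using diffk_SucD(2)[OF f] by (auto intro: continuous_on_subset)
    from compact_continuous_image[OF this] have "bounded ((\<lambda>x. ?D x b) ` cball 0 R)"
      by (simp add: compact_imp_bounded)
    then show ?thesis unfolding bounded_iff by simp
  qed
  then obtain M where M: "\<And>b x. x \<in> cball 0 R \<Longrightarrow> norm (?D x b) \<le> M b" by metis
  have D: "(f has_derivative ?D x) (at x)" for x using diffk_SucD(1)[OF f] .
  have on: "onorm (?D x) \<le> (\<Sum>b\<in>Basis. M b)" if x: "x \<in> cball 0 R" for x
  proof (rule onorm_bound)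
    show "0 \<le> (\<Sum>b\<in>Basis. M b)" using M[OF x] by (intro sum_nonneg) (meson norm_ge_zero order_trans)
    fix v
    interpret linear "?D x" using has_derivative_linear[OF D] .
    have "?D x v = (\<Sum>b\<in>Basis. (v \<bullet> b) *\<^sub>R ?D x b)"
      by (subst euclidean_representation[of v, symmetric]) (simp only: sum scaleR)
    also have "norm \<dots> \<le> (\<Sum>b\<in>Basis. norm v * M b)"
      using M[OF x] by (intro sum_norm_le) (auto intro!: mult_mono Basis_le_norm)
    finally show "norm (?D x v) \<le> (\<Sum>b\<in>Basis. M b) * norm v"
      by (simp add: sum_distrib_left mult.commute)
  qed
  have "norm (f x - f y) \<le> (\<Sum>b\<in>Basis. M b) * norm (x - y)" if "x \<in> S" "y \<in> S" for x y
    using that R on has_derivative_at_withinI[OF D]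
    by (intro differentiable_bound[of "cball 0 R" f ?D]) auto
  then show thesis using that by blast
qed

lemma abs_cont_on_C1:
  fixes g :: "real \<Rightarrow> 'a::real_normed_vector"
  assumes d: "\<And>t. t \<in> {a..b} \<Longrightarrow> (g has_vector_derivative g' t) (at t within {a..b})"
    and c: "continuous_on {a..b} g'"
  shows "abs_cont_on a b g"
proof -
  have "bounded (g' ` {a..b})"
    using compact_continuous_image[OF c] by (simp add: compact_imp_bounded)
  then obtain K where "\<forall>t\<in>{a..b}. norm (g' t) \<le> K"
    unfolding bounded_iff by auto
  then have K: "\<And>t. t \<in> {a..b} \<Longrightarrow> norm (g' t) \<le> K" by blast
  have "norm (g s - g t) \<le> K * norm (s - t)" if "s \<in> {a..b}" "t \<in> {a..b}" for s t
  proof (rule differentiable_bound[of "{a..b}" g "\<lambda>t x. x *\<^sub>R g' t"])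
    fix x assume x: "x \<in> {a..b}"
    show "(g has_derivative (\<lambda>s. s *\<^sub>R g' x)) (at x within {a..b})"
      using d[OF x] by (simp add: has_vector_derivative_def)
    show "onorm (\<lambda>s. s *\<^sub>R g' x) \<le> K"
      using K[OF x] by (intro onorm_bound) (auto intro: order_trans[OF norm_ge_zero] simp: mult.commute[of K] mult_left_mono)
  qed (use that in auto)
  then show ?thesis by (intro abs_cont_on_lipschitz) auto
qed

lemma has_vector_derivative_affine:
  fixes c b t :: real
  assumes "(g has_vector_derivative g') (at (c * t + b))"
  shows "((\<lambda>t. g (c * t + b)) has_vector_derivative c *\<^sub>R g') (at t)"
proof -
  have "((\<lambda>t. c * t + b) has_vector_derivative c) (at t)"
    by (auto intro!: derivative_eq_intros simp flip: has_real_derivative_iff_has_vector_derivative)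
  from vector_diff_chain_at[OF this assms] show ?thesis by (simp add: o_def)
qed

context carnot
begin

lemma subunit_iff: "subunit op deg T g \<longleftrightarrow> abs_cont_on 0 T g \<and>
     (AE t in lebesgue. t \<in> {0..T} \<longrightarrow>
        (\<exists>h. (\<Sum>j\<in>{j. deg j = 1}. (h j)\<^sup>2) \<le> 1 \<and> (g has_vector_derivative hvec h (g t)) (at t)))"
  by (simp add: subunit_def hvec_def)

lemma subunit_const: "subunit op deg T (\<lambda>_. x)"
  unfolding subunit_iff
proof
  show "abs_cont_on 0 T (\<lambda>_. x)"
    by (rule abs_cont_on_lipschitz[where K=0]) simp
  show "AE t in lebesgue. t \<in> {0..T} \<longrightarrow>
        (\<exists>h. (\<Sum>j\<in>{j. deg j = 1}. (h j)\<^sup>2) \<le> 1 \<and> ((\<lambda>_. x) has_vector_derivative hvec h x) (at t))"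
    by (intro AE_I2 impI exI[of _ "\<lambda>_. 0"]) (simp add: hvec_def)
qed

text \<open>Left invariance allows the same coefficients \<open>h\<close> for the translated
  curve.\<close>

lemma subunit_translate:
  assumes "subunit op deg T g"
  shows "subunit op deg T (\<lambda>t. op z (g t))"
proof -
  have ac: "abs_cont_on 0 T g" and ae: "AE t in lebesgue. t \<in> {0..T} \<longrightarrow>
        (\<exists>h. (\<Sum>j\<in>{j. deg j = 1}. (h j)\<^sup>2) \<le> 1 \<and> (g has_vector_derivative hvec h (g t)) (at t))"
    using assms by (auto simp: subunit_iff)
  have "diffk (Suc 0) (op z)"
    using diffk_op[OF diffk_const diffk_linear[OF bounded_linear_ident]] .
  moreover have "bounded (g ` {0..T})"
    using compact_continuous_image[OF abs_cont_on_continuous[OF ac]] by (simp add: compact_imp_bounded)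
  ultimately obtain K where K: "\<And>x y. x \<in> g ` {0..T} \<Longrightarrow> y \<in> g ` {0..T} \<Longrightarrow> norm (op z x - op z y) \<le> K * norm (x - y)"
    by (rule diffk_1_lipschitz_on_bounded) blast
  have "abs_cont_on 0 T (\<lambda>t. op z (g t))"
    by (rule abs_cont_on_lipschitz_comp[OF ac K]) auto
  moreover have "AE t in lebesgue. t \<in> {0..T} \<longrightarrow>
        (\<exists>h. (\<Sum>j\<in>{j. deg j = 1}. (h j)\<^sup>2) \<le> 1 \<and> ((\<lambda>t. op z (g t)) has_vector_derivative hvec h (op z (g t))) (at t))"
    using ae
  proof eventually_elim
    case (elim t)
    show ?case
    proof
      assume "t \<in> {0..T}"
      with elim obtain h where h: "(\<Sum>j\<in>{j. deg j = 1}. (h j)\<^sup>2) \<le> 1"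
        "(g has_vector_derivative hvec h (g t)) (at t)" by blast
      from h(1) has_vector_derivative_compose[OF h(2) has_derivative_op, of z]
      show "\<exists>h. (\<Sum>j\<in>{j. deg j = 1}. (h j)\<^sup>2) \<le> 1 \<and>
          ((\<lambda>t. op z (g t)) has_vector_derivative hvec h (op z (g t))) (at t)"
        unfolding hvec_left_invariant by blast
    qed
  qed
  ultimately show ?thesis by (simp add: subunit_iff)
qed

lemma subunit_reverse:
  assumes "subunit op deg T g"
  shows "subunit op deg T (\<lambda>t. g (T - t))"
proof -
  have ac: "abs_cont_on 0 T g" and ae: "AE t in lebesgue. t \<in> {0..T} \<longrightarrow>
        (\<exists>h. (\<Sum>j\<in>{j. deg j = 1}. (h j)\<^sup>2) \<le> 1 \<and> (g has_vector_derivative hvec h (g t)) (at t))"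
    using assms by (auto simp: subunit_iff)
  from AE_lebesgue_affine[OF ae, of "-1" T]
  have "AE t in lebesgue. (-1) * t + T \<in> {0..T} \<longrightarrow> (\<exists>h. (\<Sum>j\<in>{j. deg j = 1}. (h j)\<^sup>2) \<le> 1 \<and>
      (g has_vector_derivative hvec h (g ((-1) * t + T))) (at ((-1) * t + T)))" by fastforce
  then have "AE t in lebesgue. t \<in> {0..T} \<longrightarrow>
        (\<exists>h. (\<Sum>j\<in>{j. deg j = 1}. (h j)\<^sup>2) \<le> 1 \<and> ((\<lambda>t. g (T - t)) has_vector_derivative hvec h (g (T - t))) (at t))"
  proof eventually_elim
    case (elim t)
    show ?case
    proof
      assume "t \<in> {0..T}"
      then have "(-1) * t + T \<in> {0..T}" by simp
      with elim obtain h where h: "(\<Sum>j\<in>{j. deg j = 1}. (h j)\<^sup>2) \<le> 1"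
        "(g has_vector_derivative hvec h (g ((-1) * t + T))) (at ((-1) * t + T))" by blast
      from has_vector_derivative_affine[OF h(2)]
      have "((\<lambda>t. g (T - t)) has_vector_derivative hvec (\<lambda>j. (-1) * h j) (g (T - t))) (at t)"
        unfolding hvec_scale by simp
      then show "\<exists>h. (\<Sum>j\<in>{j. deg j = 1}. (h j)\<^sup>2) \<le> 1 \<and> ((\<lambda>t. g (T - t)) has_vector_derivative hvec h (g (T - t))) (at t)"
        using h(1) by (intro exI[of _ "\<lambda>j. (-1) * h j"]) simp
    qed
  qed
  then show ?thesis using abs_cont_on_reflect[OF ac] by (simp add: subunit_iff)
qed

text \<open>Running the curve slower by the factor \<open>l\<close> compensates exactly for the
  factor that the dilation puts on first-layer velocities.\<close>

lemma subunit_dil: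
  assumes "subunit op deg T g" and l: "l > 0"
  shows "subunit op deg (l * T) (\<lambda>t. dil deg l (g (t / l)))"
proof -
  have ac: "abs_cont_on 0 T g" and ae: "AE t in lebesgue. t \<in> {0..T} \<longrightarrow>
        (\<exists>h. (\<Sum>j\<in>{j. deg j = 1}. (h j)\<^sup>2) \<le> 1 \<and> (g has_vector_derivative hvec h (g t)) (at t))"
    using assms by (auto simp: subunit_iff)
  have "abs_cont_on 0 (l * T) (\<lambda>t. g (t / l))"
    using l by (intro abs_cont_on_compose_mono[OF ac, where K="1/l"])
      (auto simp: mono_on_def divide_right_mono field_simps)
  moreover obtain K where K: "\<And>x. norm (dil deg l x) \<le> norm x * K"
    using bounded_linear.bounded[OF bounded_linear_dil] by blast
  have "norm (dil deg l x - dil deg l y) \<le> K * norm (x - y)" for x y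
    using K[of "x - y"] linear_diff[OF bounded_linear.linear[OF bounded_linear_dil], of deg l x y]
    by (simp add: mult.commute)
  ultimately have 1: "abs_cont_on 0 (l * T) (\<lambda>t. dil deg l (g (t / l)))"
    by (rule abs_cont_on_lipschitz_comp)
  have "AE t in lebesgue. t / l \<in> {0..T} \<longrightarrow>
        (\<exists>h. (\<Sum>j\<in>{j. deg j = 1}. (h j)\<^sup>2) \<le> 1 \<and> (g has_vector_derivative hvec h (g (t / l))) (at (t / l)))"
    using AE_lebesgue_affine[OF ae, of "1 / l" 0] l by simp
  then have "AE t in lebesgue. t \<in> {0..l * T} \<longrightarrow>
        (\<exists>h. (\<Sum>j\<in>{j. deg j = 1}. (h j)\<^sup>2) \<le> 1 \<and>
          ((\<lambda>t. dil deg l (g (t / l))) has_vector_derivative hvec h (dil deg l (g (t / l)))) (at t))"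
  proof eventually_elim
    case (elim t)
    show ?case
    proof
      assume t: "t \<in> {0..l * T}"
      with elim l obtain h where h: "(\<Sum>j\<in>{j. deg j = 1}. (h j)\<^sup>2) \<le> 1"
        "(g has_vector_derivative hvec h (g (t / l))) (at (t / l))" by (auto simp: field_simps)
      have "((\<lambda>t. g (t / l)) has_vector_derivative (1 / l) *\<^sub>R hvec h (g (t / l))) (at t)"
        using has_vector_derivative_affine[of g _ "1 / l" t 0] h(2) by simp
      from has_vector_derivative_compose[OF this bounded_linear_imp_has_derivative[OF bounded_linear_dil]]
      have "((\<lambda>t. dil deg l (g (t / l))) has_vector_derivative dil deg l ((1 / l) *\<^sub>R hvec h (g (t / l)))) (at t)" .
      moreover have "dil deg l ((1 / l) *\<^sub>R hvec h (g (t / l))) = hvec h (dil deg l (g (t / l)))"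
        unfolding hvec_def using l
        by (simp add: linear_sum[OF bounded_linear.linear[OF bounded_linear_dil]] dil_scaleR scaleR_sum_right Zvf_dil_pos)
      ultimately show "\<exists>h. (\<Sum>j\<in>{j. deg j = 1}. (h j)\<^sup>2) \<le> 1 \<and>
          ((\<lambda>t. dil deg l (g (t / l))) has_vector_derivative hvec h (dil deg l (g (t / l)))) (at t)"
        using h(1) by auto
    qed
  qed
  with 1 show ?thesis by (simp add: subunit_iff)
qed

lemma subunit_append:
  assumes "subunit op deg S f" "subunit op deg T g" and S: "S \<ge> 0" and T: "T \<ge> 0" and eq: "f S = g 0"
  shows "subunit op deg (S + T) (\<lambda>t. if t \<le> S then f t else g (t - S))"
proof -
  have ac: "abs_cont_on 0 S f" "abs_cont_on 0 T g"
    and ae1: "AE t in lebesgue. t \<in> {0..S} \<longrightarrow>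
        (\<exists>h. (\<Sum>j\<in>{j. deg j = 1}. (h j)\<^sup>2) \<le> 1 \<and> (f has_vector_derivative hvec h (f t)) (at t))"
    and ae2: "AE t in lebesgue. t \<in> {0..T} \<longrightarrow>
        (\<exists>h. (\<Sum>j\<in>{j. deg j = 1}. (h j)\<^sup>2) \<le> 1 \<and> (g has_vector_derivative hvec h (g t)) (at t))"
    using assms by (auto simp: subunit_iff)
  let ?k = "\<lambda>t. if t \<le> S then f t else g (t - S)"
  \<comment> \<open>The concatenation is the sum of \<open>f (min t S)\<close> and
    \<open>g (max (t - S) 0) - g 0\<close>; each summand stands still while the other moves, and
    \<open>f S = g 0\<close> makes them fit.\<close>
  have "abs_cont_on 0 (S + T) (\<lambda>t. f (min t S))"
    using S T by (intro abs_cont_on_compose_mono[OF ac(1), where K=1]) (auto simp: mono_on_def)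
  moreover have "abs_cont_on 0 (S + T) (\<lambda>t. g (max (t - S) 0) - g 0)"
    using S T by (intro abs_cont_on_lipschitz_comp[where K=1 and h="\<lambda>x. x - g 0"]
      abs_cont_on_compose_mono[OF ac(2), where K=1]) (auto simp: mono_on_def)
  ultimately have 1: "abs_cont_on 0 (S + T) ?k"
    by (rule abs_cont_on_cong[OF abs_cont_on_add]) (use eq in auto)
  have "AE t in lebesgue. t + - S \<in> {0..T} \<longrightarrow>
        (\<exists>h. (\<Sum>j\<in>{j. deg j = 1}. (h j)\<^sup>2) \<le> 1 \<and> (g has_vector_derivative hvec h (g (t + - S))) (at (t + - S)))"
    using AE_lebesgue_affine[OF ae2, of 1 "- S"] by simp
  \<comment> \<open>At the junction the one-sided derivatives may differ, so this single time is
    discarded.\<close>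
  moreover have "AE t in lebesgue. t \<noteq> S"
    by (rule AE_completion[OF AE_lborel_singleton])
  ultimately have "AE t in lebesgue. t \<in> {0..S + T} \<longrightarrow>
        (\<exists>h. (\<Sum>j\<in>{j. deg j = 1}. (h j)\<^sup>2) \<le> 1 \<and> (?k has_vector_derivative hvec h (?k t)) (at t))"
    using ae1
  proof eventually_elim
    case (elim t)
    show ?case
    proof
      assume t: "t \<in> {0..S + T}"
      show "\<exists>h. (\<Sum>j\<in>{j. deg j = 1}. (h j)\<^sup>2) \<le> 1 \<and> (?k has_vector_derivative hvec h (?k t)) (at t)"
      proof (cases "t < S")
        case True
        with elim t obtain h where h: "(\<Sum>j\<in>{j. deg j = 1}. (h j)\<^sup>2) \<le> 1"
          "(f has_vector_derivative hvec h (f t)) (at t)" by auto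
        have "(?k has_vector_derivative hvec h (f t)) (at t)"
          by (rule has_vector_derivative_transform_within_open[OF h(2), of "{..<S}"]) (use True in auto)
        then show ?thesis using h(1) True by auto
      next
        case False
        with elim t obtain h where h: "(\<Sum>j\<in>{j. deg j = 1}. (h j)\<^sup>2) \<le> 1"
          "(g has_vector_derivative hvec h (g (t - S))) (at (t - S))" by auto
        have "((\<lambda>t. g (t - S)) has_vector_derivative hvec h (g (t - S))) (at t)"
          using has_vector_derivative_affine[of g _ 1 t "- S"] h(2) by simp
        then have "(?k has_vector_derivative hvec h (g (t - S))) (at t)"
          by (rule has_vector_derivative_transform_within_open[of _ _ _ "{S<..}"]) (use False elim in auto)
        then show ?thesis using h(1) False elim by auto
      qed
    qed
  qed
  with 1 show ?thesis by (simp add: subunit_iff)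
qed

text \<open>As long as the admissible times might form an empty set, whose \<open>Inf\<close> is an
  unspecified value, statements about curves are made with \<open>reach\<close> instead of
  \<open>ccdist\<close>.\<close>

definition reach :: "real^'n \<Rightarrow> real^'n \<Rightarrow> real \<Rightarrow> bool" where
  "reach x y T \<longleftrightarrow> T \<ge> 0 \<and> (\<exists>g. subunit op deg T g \<and> g 0 = x \<and> g T = y)"

lemma ccdist_eq: "ccdist op deg x y = Inf {T. reach x y T}"
  by (simp add: ccdist_def reach_def)

lemma reach_refl: "reach x x 0"
  unfolding reach_def using subunit_const by auto

lemma reach_sym: "reach x y T \<Longrightarrow> reach y x T"
  unfolding reach_def using subunit_reverse by fastforce

lemma reach_trans:
  assumes "reach x y S" "reach y z T"
  shows "reach x z (S + T)"
proof -
  obtain f g where *: "subunit op deg S f" "f 0 = x" "f S = y" "subunit op deg T g" "g 0 = y" "g T = z" "S \<ge> 0" "T \<ge> 0"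
    using assms unfolding reach_def by auto
  from subunit_append[OF *(1,4)] * show ?thesis
    unfolding reach_def by (intro conjI exI[of _ "\<lambda>t. if t \<le> S then f t else g (t - S)"]) auto
qed

lemma reach_translate: "reach (op z x) (op z y) T \<longleftrightarrow> reach x y T"
proof
  have *: "reach (op w a) (op w b) T" if "reach a b T" for a b w
    using that subunit_translate unfolding reach_def by fastforce
  show "reach x y T \<Longrightarrow> reach (op z x) (op z y) T" by (rule *)
  show "reach x y T" if "reach (op z x) (op z y) T" using *[OF that, of "ginv z"] by simp
qed

lemma reach_dil:
  assumes "reach x y T" "l > 0"
  shows "reach (dil deg l x) (dil deg l y) (l * T)"
proof -
  obtain g where "subunit op deg T g" "g 0 = x" "g T = y" "T \<ge> 0" using assms(1) unfolding reach_def by auto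
  with subunit_dil[OF this(1) assms(2)] show ?thesis
    using assms(2) unfolding reach_def by (intro conjI exI[of _ "\<lambda>t. dil deg l (g (t / l))"]) auto
qed

text \<open>Dividing time by the length \<open>n\<close> of \<open>h\<close> turns the integral
  curve into one with coefficients of unit norm.\<close>

lemma reach_flow:
  assumes r: "r \<ge> 0" and n: "n > 0" "(\<Sum>j\<in>{j. deg j = 1}. (h j)\<^sup>2) = n\<^sup>2"
  shows "reach x (flow h x r) (r * n)"
proof -
  let ?g = "\<lambda>t. flow h x (t / n)"
  have der: "(?g has_vector_derivative hvec (\<lambda>j. (1 / n) * h j) (?g t)) (at t)" if "t \<ge> 0" for t
    unfolding hvec_scale
    using has_vector_derivative_affine[of "flow h x" _ "1 / n" t 0] flow_derivative[of "t / n" h x] that n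
    by simp
  have "continuous_on {0..r * n} ?g"
    using der has_vector_derivative_continuous by (fastforce intro!: continuous_at_imp_continuous_on)
  then have c: "continuous_on {0..r * n} (\<lambda>t. hvec (\<lambda>j. (1 / n) * h j) (?g t))"
    unfolding hvec_def
    by (intro continuous_intros continuous_on_compose2[OF diffk_imp_continuous_on[OF diffk_Zvf]]) auto
  have "abs_cont_on 0 (r * n) ?g"
    by (rule abs_cont_on_C1[OF _ c]) (use der in \<open>auto intro: has_vector_derivative_at_within\<close>)
  moreover have "(\<Sum>j\<in>{j. deg j = 1}. ((1 / n) * h j)\<^sup>2) \<le> 1"
    using n by (simp add: power_mult_distrib power_divide flip: sum_divide_distrib)
  then have "AE t in lebesgue. t \<in> {0..r * n} \<longrightarrow>
        (\<exists>h. (\<Sum>j\<in>{j. deg j = 1}. (h j)\<^sup>2) \<le> 1 \<and> (?g has_vector_derivative hvec h (?g t)) (at t))"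
    using der by (intro AE_I2 impI exI[of _ "\<lambda>j. (1 / n) * h j"]) auto
  ultimately have "subunit op deg (r * n) ?g" by (simp add: subunit_iff)
  then show ?thesis using r n unfolding reach_def by (intro conjI exI[of _ ?g]) auto
qed

lemma ccdist_translate [simp]: "ccdist op deg (op z x) (op z y) = ccdist op deg x y"
  by (simp add: ccdist_eq reach_translate)

lemma ccdist_le: "reach x y T \<Longrightarrow> ccdist op deg x y \<le> T"
  unfolding ccdist_eq by (rule cInf_lower) (auto simp: reach_def intro!: bdd_belowI[of _ 0])

lemma ccdist_sym: "ccdist op deg x y = ccdist op deg y x"
proof -
  have "{T. reach x y T} = {T. reach y x T}" using reach_sym by blast
  then show ?thesis by (simp add: ccdist_eq)
qed

end

locale carnot_connected = carnot +
  assumes connected: "\<exists>T. reach x y T"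
begin

lemma ccdist_nonneg: "ccdist op deg x y \<ge> 0"
  unfolding ccdist_eq
proof (rule cInf_greatest)
  show "{T. reach x y T} \<noteq> {}" using connected by blast
qed (simp add: reach_def)

lemma ccdist_approx:
  assumes "e > 0"
  obtains T where "reach x y T" "T < ccdist op deg x y + e"
proof -
  have "{T. reach x y T} \<noteq> {}" using connected by auto
  moreover have "Inf {T. reach x y T} < ccdist op deg x y + e" using assms by (simp add: ccdist_eq)
  ultimately obtain T where "T \<in> {T. reach x y T}" "T < ccdist op deg x y + e"
    using cInf_lessD by metis
  then show thesis using that[of T] by simp
qed

lemma ccdist_triangle: "ccdist op deg x z \<le> ccdist op deg x y + ccdist op deg y z"
proof (rule field_le_epsilon)
  fix e :: real assume "e > 0"
  then have e2: "e / 2 > 0" by simp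
  obtain S where S: "reach x y S" "S < ccdist op deg x y + e / 2" by (rule ccdist_approx[OF e2])
  obtain T where T: "reach y z T" "T < ccdist op deg y z + e / 2" by (rule ccdist_approx[OF e2])
  show "ccdist op deg x z \<le> ccdist op deg x y + ccdist op deg y z + e"
    using ccdist_le[OF reach_trans[OF S(1) T(1)]] S(2) T(2) by simp
qed

lemma ccdist_refl [simp]: "ccdist op deg x x = 0"
  using ccdist_le[OF reach_refl] ccdist_nonneg[of x x] by (simp add: antisym)

lemma ccdist_dil_le:
  assumes l: "l > 0"
  shows "ccdist op deg (dil deg l x) (dil deg l y) \<le> l * ccdist op deg x y"
proof (rule field_le_epsilon)
  fix e :: real assume "e > 0"
  then have "e / l > 0" using l by simp
  from ccdist_approx[OF this, of x y] obtain T where T: "reach x y T" "T < ccdist op deg x y + e / l" .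
  then have "l * T < l * ccdist op deg x y + e" using l by (simp add: field_simps)
  with ccdist_le[OF reach_dil[OF T(1) l]]
  show "ccdist op deg (dil deg l x) (dil deg l y) \<le> l * ccdist op deg x y + e" by simp
qed

end

section \<open>Connectedness and continuity of the distance from integrability\<close>

lemma finite_superlevel_set:
  fixes E :: "'a::euclidean_space \<Rightarrow> real"
  assumes "integrable lborel E" "\<And>x. E x \<ge> 0" "c > 0"
  shows "{x. c \<le> E x} \<in> sets borel" "emeasure lborel {x. c \<le> E x} < \<infinity>"
proof -
  have [measurable]: "E \<in> borel_measurable borel" using assms(1) by (simp add: integrable_iff_bounded)
  show "{x. c \<le> E x} \<in> sets borel" by measurable
  show "emeasure lborel {x. c \<le> E x} < \<infinity>"
    using integral_Markov_inequality[OF assms(1) _ assms(3)] assms(2)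
    by (auto simp: le_less_trans[OF _ ennreal_less_top])
qed

lemma (in carnot) emeasure_op_right_vimage:
  assumes "A \<in> sets borel"
  shows "emeasure lborel ((\<lambda>y. op y x) -` A) = emeasure lborel A" "(\<lambda>y. op y x) -` A \<in> sets borel"
proof -
  have m: "(\<lambda>y. op y x) \<in> borel_measurable borel"
    by (intro borel_measurable_continuous_onI continuous_intros)
  show "(\<lambda>y. op y x) -` A \<in> sets borel" using measurable_sets_borel[OF m assms] .
  have "emeasure lborel A = emeasure (distr lborel borel (\<lambda>y. op y x)) A" by (simp add: distr_op_right)
  also have "\<dots> = emeasure lborel ((\<lambda>y. op y x) -` A)" using m assms by (simp add: emeasure_distr)
  finally show "emeasure lborel ((\<lambda>y. op y x) -` A) = emeasure lborel A" by simp
qed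

text \<open>Inner regularity supplies a closed subset of positive measure; cutting it with balls of
  growing radius, one of the countably many compact pieces keeps positive measure.\<close>

lemma exists_compact_positive_subset:
  fixes A :: "'a::euclidean_space set"
  assumes A: "A \<in> sets borel" "emeasure lborel A > 0" "emeasure lborel A < \<infinity>"
  obtains K where "compact K" "K \<subseteq> A" "emeasure lborel K > 0"
proof -
  have "measure lborel A > 0" using A by (simp add: measure_def enn2real_positive_iff)
  moreover have "A \<in> sets lebesgue" using A by simp
  ultimately obtain T where T: "closed T" "T \<subseteq> A" "emeasure lebesgue (A - T) < ennreal (measure lborel A)"
    using sets_lebesgue_inner_closed by metis
  have [measurable]: "T \<in> sets borel" "A \<in> sets borel" using T A by auto
  have "emeasure lborel T > 0"
  proof (rule ccontr)
    assume "\<not> emeasure lborel T > 0"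
    then have "T \<in> null_sets lborel" by auto
    then have "emeasure lborel (A - T) = emeasure lborel A" by (rule emeasure_Diff_null_set) simp
    also have "\<dots> = ennreal (measure lborel A)" using A by (simp add: emeasure_eq_ennreal_measure less_top)
    finally show False using T(3) by simp
  qed
  moreover have "T = (\<Union>n::nat. T \<inter> cball 0 (real n))"
    using real_arch_simple by (auto simp: dist_norm)
  ultimately obtain n :: nat where "emeasure lborel (T \<inter> cball 0 (real n)) > 0"
    using emeasure_UN_eq_0[of lborel "\<lambda>n::nat. T \<inter> cball 0 (real n)"]
    by (metis (no_types, lifting) \<open>T \<in> sets borel\<close> borel_closed closed_cball image_subset_iff not_gr_zero
        sets.Int sets_lborel subset_iff UNIV_I subsetI)
  then show thesis
    using that[OF closed_Int_compact[OF T(1) compact_cball]] T(2) by blast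
qed

context carnot
begin

text \<open>Points not reachable from the identity all have the same (junk) distance, so
  integrability confines them to a set of finite measure; but if there were one such point,
  a right translate of its complement would consist of such points as well.\<close>

lemma connected_if_integrable:
  fixes U :: "real \<Rightarrow> real"
  assumes int: "integrable lborel (\<lambda>x. exp (- U (ccdist op deg x 0)))"
  shows "\<exists>T. reach x y T"
proof (rule ccontr)
  assume no: "\<nexists>T. reach x y T"
  define p where "p = op (ginv x) y"
  define A where "A = {z. exp (- U (Inf {})) \<le> exp (- U (ccdist op deg z 0))}"
  have A: "A \<in> sets borel" "emeasure lborel A < \<infinity>"
    unfolding A_def
    by (rule finite_superlevel_set(1)[OF int], simp_all only: exp_ge_zero exp_gt_zero)
      (rule finite_superlevel_set(2)[OF int], simp_all only: exp_ge_zero exp_gt_zero)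
  have p: "\<not> reach p 0 T" for T
    using no reach_sym[of p 0 T] reach_translate[of x 0 p T] by (auto simp: p_def)
  have inA: "z \<in> A" if "\<And>T. \<not> reach z 0 T" for z
  proof -
    have "{T. reach z 0 T} = {}" using that by blast
    then show ?thesis by (simp only: A_def ccdist_eq mem_Collect_eq order_refl)
  qed
  have "UNIV \<subseteq> A \<union> (\<lambda>z. op z p) -` A"
  proof
    fix z show "z \<in> A \<union> (\<lambda>z. op z p) -` A"
    proof (cases "\<exists>T. reach z 0 T")
      case True
      then obtain T where T: "reach z 0 T" by blast
      have "\<not> reach (op z p) 0 S" for S
      proof
        assume "reach (op z p) 0 S"
        from reach_trans[OF this reach_sym[OF T]] have "reach (op z p) (op z 0) (S + T)" by simp
        then show False using p reach_translate by blast
      qed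
      then show ?thesis using inA by auto
    qed (use inA in auto)
  qed
  then have "emeasure lborel (UNIV :: (real^'n) set) \<le> emeasure lborel (A \<union> (\<lambda>z. op z p) -` A)"
    using A emeasure_op_right_vimage by (intro emeasure_mono) auto
  also have "\<dots> \<le> emeasure lborel A + emeasure lborel ((\<lambda>z. op z p) -` A)"
    using A emeasure_op_right_vimage by (intro emeasure_subadditive) auto
  also have "\<dots> < \<infinity>" using A emeasure_op_right_vimage by (simp add: less_top)
  finally show False by (simp add: emeasure_lborel_UNIV)
qed

text \<open>Choose an open \<open>V\<close> around \<open>K\<close> with \<open>V - K\<close>
  smaller in measure than \<open>K\<close>. For small \<open>x\<close> the right translate of
  \<open>K\<close> by \<open>x\<close> stays in \<open>V\<close>; if it missed \<open>K\<close> it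
  would lie in \<open>V - K\<close>, although it has the measure of \<open>K\<close>.\<close>

lemma steinhaus:
  assumes K: "compact K" "emeasure lborel K > 0"
  obtains N where "open N" "0 \<in> N" "\<And>x. x \<in> N \<Longrightarrow> \<exists>k\<in>K. op k x \<in> K"
proof -
  have Kb: "K \<in> sets borel" and Kf: "emeasure lborel K < \<infinity>"
    using borel_compact[OF K(1)] emeasure_bounded_finite[OF compact_imp_bounded[OF K(1)]] .
  obtain m where m: "emeasure lborel K = ennreal m" "m > 0"
    using K(2) Kf by (cases "emeasure lborel K") (auto simp: ennreal_zero_less_top)
  obtain V where V: "open V" "K \<subseteq> V" "emeasure lborel (V - K) < ennreal m"
    using outer_regular_lborel[OF Kb m(2)] by blast
  have "closed ((\<lambda>p. op (fst p) (snd p)) -` (- V))"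
    using V(1) by (intro closed_vimage continuous_intros) auto
  \<comment> \<open>Compactness of \<open>K\<close> makes the set of those \<open>x\<close> that
    push some point of \<open>K\<close> out of \<open>V\<close> closed.\<close>
  from closed_compact_projection[OF K(1) this]
  have "open (- {x. \<exists>k. k \<in> K \<and> (k, x) \<in> (\<lambda>p. op (fst p) (snd p)) -` (- V)})" by (simp add: open_closed)
  moreover have "- {x. \<exists>k. k \<in> K \<and> (k, x) \<in> (\<lambda>p. op (fst p) (snd p)) -` (- V)} = {x. \<forall>k\<in>K. op k x \<in> V}" by auto
  ultimately have "open {x. \<forall>k\<in>K. op k x \<in> V}" by simp
  then show thesis
  proof (rule that)
    show "0 \<in> {x. \<forall>k\<in>K. op k x \<in> V}" using V by auto
    fix x assume x: "x \<in> {x. \<forall>k\<in>K. op k x \<in> V}"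
    show "\<exists>k\<in>K. op k x \<in> K"
    proof (rule ccontr)
      assume no: "\<not> (\<exists>k\<in>K. op k x \<in> K)"
      let ?Kx = "(\<lambda>y. op y (ginv x)) -` K"
      have "?Kx \<subseteq> V - K"
      proof
        fix y assume y: "y \<in> ?Kx"
        then have "op y (ginv x) \<in> K" "op (op y (ginv x)) x = y" by auto
        then show "y \<in> V - K" using x no by (metis (no_types, lifting) DiffI mem_Collect_eq)
      qed
      then have "emeasure lborel ?Kx \<le> emeasure lborel (V - K)"
        using V Kb by (intro emeasure_mono) auto
      then show False using V(3) emeasure_op_right_vimage(1)[OF Kb] m by simp
    qed
  qed
qed

end

context carnot_connected
begin

text \<open>Some superlevel set of the density has positive finite measure. Were the distance
  unbounded on it, monotonicity of \<open>U\<close> would make it the whole space. If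
  \<open>k\<close> and \<open>op k x\<close> both lie in this set, left invariance and the triangle
  inequality bound the distance of \<open>x\<close> by \<open>2 R\<close>.\<close>

lemma ccdist_bounded_near_0:
  fixes U :: "real \<Rightarrow> real"
  assumes U: "mono U" and int: "integrable lborel (\<lambda>x. exp (- U (ccdist op deg x 0)))"
  obtains N R where "open N" "0 \<in> N" "\<And>x. x \<in> N \<Longrightarrow> ccdist op deg x 0 \<le> R"
proof -
  define A where "A n = {x. 1 / real (Suc n) \<le> exp (- U (ccdist op deg x 0))}" for n
  have A: "A n \<in> sets borel" "emeasure lborel (A n) < \<infinity>" for n
    unfolding A_def
    by (rule finite_superlevel_set(1)[OF int], simp, simp)
      (rule finite_superlevel_set(2)[OF int], simp, simp)
  have un: "(\<Union>n. A n) = UNIV"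
  proof -
    have "\<exists>n. x \<in> A n" for x
      using nat_approx_posE[of "exp (- U (ccdist op deg x 0))"] unfolding A_def
      by (metis exp_gt_zero less_imp_le mem_Collect_eq)
    then show ?thesis by blast
  qed
  have "\<exists>n. emeasure lborel (A n) > 0"
  proof (rule ccontr)
    assume "\<not> ?thesis"
    then have "emeasure lborel (\<Union>n. A n) = 0" using A(1) by (intro emeasure_UN_eq_0) auto
    then show False by (simp add: un emeasure_lborel_UNIV)
  qed
  then obtain n where n: "emeasure lborel (A n) > 0" by blast
  have "\<exists>R. \<forall>x\<in>A n. ccdist op deg x 0 \<le> R"
  proof (rule ccontr)
    assume no: "\<not> ?thesis"
    have "x \<in> A n" for x
    proof -
      obtain y where y: "y \<in> A n" "ccdist op deg x 0 < ccdist op deg y 0"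
        using no by (meson not_le)
      then have "U (ccdist op deg x 0) \<le> U (ccdist op deg y 0)" using U by (simp add: monoD)
      then have "exp (- U (ccdist op deg y 0)) \<le> exp (- U (ccdist op deg x 0))" by simp
      with y(1) show ?thesis unfolding A_def by (blast intro: order_trans)
    qed
    then have "A n = UNIV" by blast
    with A(2)[of n] show False by (simp add: emeasure_lborel_UNIV)
  qed
  then obtain R where R: "\<And>x. x \<in> A n \<Longrightarrow> ccdist op deg x 0 \<le> R" by blast
  obtain K where K: "compact K" "K \<subseteq> A n" "emeasure lborel K > 0"
    using exists_compact_positive_subset[OF A(1) n A(2)] .
  obtain N where N: "open N" "0 \<in> N" "\<And>x. x \<in> N \<Longrightarrow> \<exists>k\<in>K. op k x \<in> K"
    using steinhaus[OF K(1,3)] by metis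
  show thesis
  proof (rule that[OF N(1,2)])
    fix x assume "x \<in> N"
    then obtain k where k: "k \<in> K" "op k x \<in> K" using N(3) by blast
    have "ccdist op deg x 0 = ccdist op deg (op k x) (op k 0)" by (simp only: ccdist_translate)
    also have "\<dots> \<le> ccdist op deg (op k x) 0 + ccdist op deg 0 k" using ccdist_triangle by simp
    also have "\<dots> \<le> R + R" using R K(2) k ccdist_sym[of 0 k] by (metis add_mono subsetD)
    finally show "ccdist op deg x 0 \<le> R + R" .
  qed
qed

lemma ccdist_tendsto_0:
  fixes U :: "real \<Rightarrow> real"
  assumes U: "mono U" and int: "integrable lborel (\<lambda>x. exp (- U (ccdist op deg x 0)))"
  shows "((\<lambda>x. ccdist op deg x 0) \<longlongrightarrow> 0) (nhds 0)"
proof (rule tendstoI)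
  obtain N R where N: "open N" "0 \<in> N" "\<And>x. x \<in> N \<Longrightarrow> ccdist op deg x 0 \<le> R"
    using ccdist_bounded_near_0[OF U int] by metis
  fix e :: real assume e: "e > 0"
  have "R \<ge> 0" using N(3)[OF N(2)] by simp
  \<comment> \<open>With this \<open>l\<close>, the \<open>l\<close>-dilate of \<open>N\<close> has
    distance at most \<open>l * R < e\<close> from 0; the added 1 covers
    \<open>R = 0\<close>.\<close>
  define l where "l = e / (R + 1)"
  have l: "l > 0" "l * R < e" using e \<open>R \<ge> 0\<close> by (auto simp: l_def field_simps)
  have "open (dil deg (1 / l) -` N)"
    using N(1) by (intro open_vimage continuous_intros) auto
  then have "\<forall>\<^sub>F x in nhds 0. x \<in> dil deg (1 / l) -` N"
    using N(2) by (intro eventually_nhds_in_open) auto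
  then show "\<forall>\<^sub>F x in nhds 0. dist (ccdist op deg x 0) 0 < e"
  proof eventually_elim
    case (elim x)
    then have "ccdist op deg (dil deg (1 / l) x) 0 \<le> R" using N(3) by simp
    then have "l * ccdist op deg (dil deg (1 / l) x) 0 < e"
      using l by (meson mult_left_mono le_less_trans less_imp_le)
    with ccdist_dil_le[OF l(1), of "dil deg (1 / l) x" 0] l(1)
    have "ccdist op deg x 0 < e" by (simp add: dil_dil)
    then show ?case using ccdist_nonneg[of x 0] by simp
  qed
qed

end

section \<open>Hopf-Lax functions\<close>

text \<open>Convexity of the square: the difference of the two sides is a perfect square over a
  positive number. It expresses that splitting a path over two time spans cannot lower its
  energy.\<close>

lemma sum_square_div_le:
  fixes a b s t :: real
  assumes "s > 0" "t > 0"
  shows "(a + b)\<^sup>2 / (2 * (t + s)) \<le> a\<^sup>2 / (2 * s) + b\<^sup>2 / (2 * t)"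
proof -
  have "a\<^sup>2 / (2 * s) + b\<^sup>2 / (2 * t) - (a + b)\<^sup>2 / (2 * (t + s)) = (t * a - s * b)\<^sup>2 / (2 * s * t * (t + s))"
    using assms by (simp add: divide_simps) algebra
  also have "\<dots> \<ge> 0" using assms by simp
  finally show ?thesis by simp
qed

locale carnot_metric = carnot_connected +
  assumes ccdist_tendsto: "((\<lambda>x. ccdist op deg x 0) \<longlongrightarrow> 0) (nhds 0)"
begin

abbreviation "cc \<equiv> ccdist op deg"

lemma cc_tendsto: "((\<lambda>y. cc y x) \<longlongrightarrow> 0) (nhds x)"
proof -
  have "((\<lambda>y. op (ginv x) y) \<longlongrightarrow> op (ginv x) x) (nhds x)"
    by (intro tendsto_intros filterlim_ident)
  then have "filterlim (\<lambda>y. op (ginv x) y) (nhds 0) (nhds x)" by simp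
  from filterlim_compose[OF ccdist_tendsto this]
  have "((\<lambda>y. cc (op (ginv x) y) (op (ginv x) x)) \<longlongrightarrow> 0) (nhds x)" by simp
  then show ?thesis by (simp only: ccdist_translate)
qed

end

locale hopf_lax_bounded = carnot_metric op deg
  for op :: "real^'n \<Rightarrow> real^'n \<Rightarrow> real^'n" and deg :: "'n \<Rightarrow> nat" +
  fixes f :: "real^'n \<Rightarrow> real" and M :: real
  assumes f_le: "\<bar>f x\<bar> \<le> M"
begin

abbreviation "hl \<equiv> \<lambda>t. hopf_lax (ccdist op deg) t f"

lemma M_nonneg: "M \<ge> 0"
  using f_le[of 0] by simp

lemma hl_eq: "t > 0 \<Longrightarrow> hl t x = (INF y. (cc x y)\<^sup>2 / (2 * t) + f y)"
  by (simp add: hopf_lax_def)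

lemma hl_arg_ge: "t > 0 \<Longrightarrow> - M \<le> (cc x y)\<^sup>2 / (2 * t) + f y"
  using f_le[of y] by (smt (verit) divide_nonneg_pos zero_le_power2)

lemma hl_le: "t > 0 \<Longrightarrow> hl t x \<le> (cc x y)\<^sup>2 / (2 * t) + f y"
  unfolding hl_eq by (rule cINF_lower) (auto intro!: bdd_belowI[of _ "- M"] hl_arg_ge)

lemma hl_ge: "t > 0 \<Longrightarrow> - M \<le> hl t x"
  unfolding hl_eq by (rule cINF_greatest) (auto intro: hl_arg_ge)

lemma hl_le_f: "t > 0 \<Longrightarrow> hl t x \<le> f x"
  using hl_le[of t x x] by simp

lemma hl_abs_le: "t > 0 \<Longrightarrow> \<bar>hl t x\<bar> \<le> M"
  using hl_ge[of t x] hl_le_f[of t x] f_le[of x] by linarith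

lemma hl_approx:
  assumes "t > 0" "e > 0"
  obtains y where "(cc x y)\<^sup>2 / (2 * t) + f y < hl t x + e"
proof -
  have "hl t x < hl t x + e" using assms by simp
  then have "(INF y. (cc x y)\<^sup>2 / (2 * t) + f y) < hl t x + e" by (simp only: hl_eq[OF assms(1)])
  then show thesis using that by (subst (asm) cINF_less_iff) (auto intro!: bdd_belowI[of _ "- M"] hl_arg_ge assms)
qed

text \<open>A point that is optimal up to 1 has cost at most \<open>hl t x + 1 - f y\<close>, hence
  at most \<open>2 * M + 1\<close>. This is the source of that constant below.\<close>

lemma hl_approx_bounded:
  assumes "t > 0" "e > 0"
  obtains y where "(cc x y)\<^sup>2 / (2 * t) + f y < hl t x + e" "(cc x y)\<^sup>2 / (2 * t) \<le> 2 * M + 1"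
proof -
  have "min e 1 > 0" using assms by simp
  from hl_approx[OF assms(1) this, of x] obtain y where y: "(cc x y)\<^sup>2 / (2 * t) + f y < hl t x + min e 1" .
  moreover have "hl t x \<le> M" using hl_abs_le[OF assms(1), of x] by simp
  ultimately show thesis using that[of y] f_le[of y] by linarith
qed

text \<open>A nearly optimal \<open>y\<close> for \<open>z\<close> is a competitor for
  \<open>x\<close>; the triangle inequality splits its cost over the two time spans.\<close>

lemma hl_step:
  assumes "t > 0" "s > 0"
  shows "hl (t + s) x \<le> hl t z + (cc x z)\<^sup>2 / (2 * s)"
proof (rule field_le_epsilon)
  fix e :: real assume "e > 0"
  from hl_approx[OF assms(1) this, of z] obtain y where y: "(cc z y)\<^sup>2 / (2 * t) + f y < hl t z + e" .
  have "hl (t + s) x \<le> (cc x y)\<^sup>2 / (2 * (t + s)) + f y" using assms by (intro hl_le) simp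
  also have "(cc x y)\<^sup>2 / (2 * (t + s)) \<le> (cc x z + cc z y)\<^sup>2 / (2 * (t + s))"
    using assms by (intro divide_right_mono power_mono ccdist_triangle ccdist_nonneg) simp
  also have "\<dots> \<le> (cc x z)\<^sup>2 / (2 * s) + (cc z y)\<^sup>2 / (2 * t)"
    by (rule sum_square_div_le[OF assms(2,1)])
  finally show "hl (t + s) x \<le> hl t z + (cc x z)\<^sup>2 / (2 * s) + e" using y by simp
qed

text \<open>The radius around \<open>x\<close> that contains suitable near-minimisers, by
  \<open>hl_approx_bounded\<close>. It is a distance; the resulting Lipschitz constant is
  \<open>lipR t / t\<close>.\<close>

definition "lipR t = sqrt (2 * t * (2 * M + 1))"

lemma lipR_nonneg: "t > 0 \<Longrightarrow> lipR t \<ge> 0"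
  using M_nonneg by (simp add: lipR_def)

text \<open>A near-minimiser for \<open>x\<close> is tested at \<open>x'\<close>. The quadratic
  remainder is kept; it disappears when the estimate is differentiated.\<close>

lemma hl_lipschitz:
  assumes t: "t > 0"
  shows "hl t x' \<le> hl t x + (2 * lipR t * cc x' x + (cc x' x)\<^sup>2) / (2 * t)"
proof (rule field_le_epsilon)
  fix e :: real assume "e > 0"
  from hl_approx_bounded[OF t this, of x] obtain y where
    y: "(cc x y)\<^sup>2 / (2 * t) + f y < hl t x + e" "(cc x y)\<^sup>2 / (2 * t) \<le> 2 * M + 1" .
  from y(2) have "(cc x y)\<^sup>2 \<le> 2 * t * (2 * M + 1)" using t by (simp add: field_simps)
  then have R: "cc x y \<le> lipR t" unfolding lipR_def by (rule real_le_rsqrt)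
  have "hl t x' \<le> (cc x' y)\<^sup>2 / (2 * t) + f y" by (rule hl_le[OF t])
  also have "(cc x' y)\<^sup>2 / (2 * t) \<le> (cc x' x + cc x y)\<^sup>2 / (2 * t)"
    using t by (intro divide_right_mono power_mono ccdist_triangle ccdist_nonneg) simp
  also have "(cc x' x + cc x y)\<^sup>2 \<le> (cc x y)\<^sup>2 + (2 * lipR t * cc x' x + (cc x' x)\<^sup>2)"
    using mult_right_mono[OF R ccdist_nonneg[of x' x]] by (simp add: power2_sum algebra_simps)
  finally show "hl t x' \<le> hl t x + (2 * lipR t * cc x' x + (cc x' x)\<^sup>2) / (2 * t) + e"
    using y(1) t by (simp add: add_divide_distrib divide_right_mono)
qed

text \<open>A near-minimiser for the later time is tested at the earlier one; its cost grows by the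
  relative amount \<open>(t' - t) / t\<close> of a quantity bounded by
  \<open>2 * M + 1\<close>.\<close>

lemma hl_time:
  assumes "0 < t" "t \<le> t'"
  shows "hl t x \<le> hl t' x + (2 * M + 1) * (t' - t) / t"
proof (rule field_le_epsilon)
  fix e :: real assume "e > 0"
  have t': "t' > 0" using assms by simp
  from hl_approx_bounded[OF t' \<open>e > 0\<close>, of x] obtain y where
    y: "(cc x y)\<^sup>2 / (2 * t') + f y < hl t' x + e" "(cc x y)\<^sup>2 / (2 * t') \<le> 2 * M + 1" .
  have "(cc x y)\<^sup>2 / (2 * t) = (cc x y)\<^sup>2 / (2 * t') + (cc x y)\<^sup>2 / (2 * t') * ((t' - t) / t)"
    using assms by (simp add: divide_simps) algebra
  also have "(cc x y)\<^sup>2 / (2 * t') * ((t' - t) / t) \<le> (2 * M + 1) * ((t' - t) / t)"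
    using assms by (intro mult_right_mono y(2)) simp
  finally show "hl t x \<le> hl t' x + (2 * M + 1) * (t' - t) / t + e"
    using hl_le[OF assms(1), of x y] y(1) by simp
qed

lemma hl_continuous:
  assumes t: "t > 0"
  shows "continuous_on UNIV (hl t)"
proof -
  have "isCont (hl t) x" for x
  proof -
    have "((\<lambda>y. hl t x + (2 * lipR t * cc y x + (cc y x)\<^sup>2) / (2 * t)) \<longlongrightarrow> hl t x + (2 * lipR t * 0 + 0\<^sup>2) / (2 * t)) (nhds x)"
      using t by (intro tendsto_intros cc_tendsto) simp
    moreover have "((\<lambda>y. hl t x - (2 * lipR t * cc y x + (cc y x)\<^sup>2) / (2 * t)) \<longlongrightarrow> hl t x - (2 * lipR t * 0 + 0\<^sup>2) / (2 * t)) (nhds x)"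
      using t by (intro tendsto_intros cc_tendsto) simp
    moreover have "hl t x - (2 * lipR t * cc y x + (cc y x)\<^sup>2) / (2 * t) \<le> hl t y" for y
      using hl_lipschitz[OF t, of x y] ccdist_sym[of x y] by simp
    ultimately have "(hl t \<longlongrightarrow> hl t x) (nhds x)"
      using hl_lipschitz[OF t, of _ x] by (intro tendsto_sandwich[of "\<lambda>y. hl t x - (2 * lipR t * cc y x + (cc y x)\<^sup>2) / (2 * t)"
         "hl t" _ "\<lambda>y. hl t x + (2 * lipR t * cc y x + (cc y x)\<^sup>2) / (2 * t)"]) (auto intro!: always_eventually)
    then show ?thesis using tendsto_within_subset[of "hl t" _ x UNIV] unfolding isCont_def
      by (simp add: tendsto_nhds_iff)
  qed
  then show ?thesis by (simp add: continuous_on_eq_continuous_at)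
qed

end

section \<open>Mollification by left translations\<close>

definition bump :: "real \<Rightarrow> 'a::real_inner \<Rightarrow> real" where
  "bump r x = flat_exp 0 (1 - (x \<bullet> x) / r\<^sup>2)"

lemma bump_nonneg: "bump r x \<ge> 0"
  by (simp add: bump_def flat_exp.simps)

lemma bump_pos: "norm x < r \<Longrightarrow> bump r x > 0"
proof -
  assume "norm x < r"
  then have "x \<bullet> x < r\<^sup>2" "r > 0"
    using power_strict_mono[of "norm x" r 2] le_less_trans[OF norm_ge_zero, of x r] by (auto simp: power2_norm_eq_inner)
  then show ?thesis by (simp add: bump_def flat_exp_pos)
qed

lemma bump_eq_0: "r > 0 \<Longrightarrow> r \<le> norm x \<Longrightarrow> bump r x = 0"
proof -
  assume "r > 0" "r \<le> norm x"
  then have "r\<^sup>2 \<le> x \<bullet> x" using power_mono[of r "norm x" 2] by (simp add: power2_norm_eq_inner)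
  then show ?thesis using \<open>r > 0\<close> by (simp add: bump_def flat_exp_nonpos)
qed

lemma bump_le: "bump r x \<le> exp (- 1)"
proof (cases "1 - (x \<bullet> x) / r\<^sup>2 > 0")
  case True
  then have "1 / (1 - (x \<bullet> x) / r\<^sup>2) \<ge> 1" by simp
  with True show ?thesis by (simp add: bump_def flat_exp_pos)
qed (simp add: bump_def flat_exp_nonpos)

lemma diffk_bump: "diffk k (bump r :: 'a::euclidean_space \<Rightarrow> real)"
proof -
  have "diffk k (\<lambda>x :: 'a. 1 + (- (1 / r\<^sup>2)) * (x \<bullet> x))"
    by (intro diffk_add diffk_const diffk_mult diffk_inner diffk_linear bounded_linear_ident)
  from diffk_compose[OF diffk_flat_exp this] show ?thesis
    by (simp add: bump_def[abs_def])
qed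

lemma integrable_continuous_compact_support:
  fixes g :: "'a::euclidean_space \<Rightarrow> real"
  assumes "continuous_on UNIV g" "compact S" "\<And>x. x \<notin> S \<Longrightarrow> g x = 0"
  shows "integrable lborel g"
proof -
  have "integrable lborel (\<lambda>x. indicator S x *\<^sub>R g x)"
    using assms by (intro borel_integrable_compact) (auto intro: continuous_on_subset)
  moreover have "(\<lambda>x. indicator S x *\<^sub>R g x) = g"
    using assms(3) by (auto simp: fun_eq_iff indicator_def)
  ultimately show ?thesis by simp
qed

lemma integral_bump_pos:
  assumes "r > 0"
  shows "(\<integral>x. bump r x \<partial>(lborel :: 'a::euclidean_space measure)) > 0"
proof -
  have c: "continuous_on UNIV (bump r :: 'a \<Rightarrow> real)" using diffk_imp_continuous_on[OF diffk_bump] .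
  have i: "integrable lborel (bump r :: 'a \<Rightarrow> real)"
    by (intro integrable_continuous_compact_support[OF c compact_cball[of 0 r]]) (simp add: bump_eq_0 assms)
  have "(\<integral>x. bump r x \<partial>(lborel :: 'a measure)) \<noteq> 0"
  proof
    assume "(\<integral>x. bump r x \<partial>(lborel :: 'a measure)) = 0"
    then have "AE x in (lborel :: 'a measure). bump r x = 0"
      using integral_nonneg_eq_0_iff_AE[OF i] bump_nonneg by auto
    then have "AE x in (lborel :: 'a measure). x \<notin> ball 0 r"
      by eventually_elim (use bump_pos in force)
    then have "ball (0::'a) r \<in> null_sets lborel"
      by (subst (asm) AE_iff_null_sets[symmetric]) auto
    then have "negligible (ball (0::'a) r)"
      unfolding negligible_iff_null_sets by (rule null_sets_completionI)
    moreover have "\<not> negligible (ball (0::'a) r)"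
      using assms by (intro open_not_negligible) auto
    ultimately show False by simp
  qed
  moreover have "(\<integral>x. bump r x \<partial>(lborel :: 'a measure)) \<ge> 0"
    by (intro integral_nonneg_AE AE_I2 bump_nonneg)
  ultimately show ?thesis by simp
qed

locale mollified = carnot op deg
  for op :: "real^'n \<Rightarrow> real^'n \<Rightarrow> real^'n" and deg :: "'n \<Rightarrow> nat" +
  fixes \<phi> :: "real^'n \<Rightarrow> real" and \<epsilon> :: real
  assumes \<phi>_smooth: "diffk k \<phi>" and \<phi>_nonneg: "\<phi> y \<ge> 0"
    and \<phi>_supp: "\<epsilon> < norm y \<Longrightarrow> \<phi> y = 0" and \<phi>_integral: "(\<integral>y. \<phi> y \<partial>lborel) = 1"
begin

lemma \<phi>_continuous: "continuous_on UNIV \<phi>"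
  using diffk_imp_continuous_on[OF \<phi>_smooth] .

lemma \<phi>_integrable: "integrable lborel \<phi>"
  using \<phi>_supp by (intro integrable_continuous_compact_support[OF \<phi>_continuous compact_cball[of 0 \<epsilon>]]) auto

definition mol :: "(real^'n \<Rightarrow> real) \<Rightarrow> real^'n \<Rightarrow> real" where
  "mol u x = (\<integral>y. \<phi> y * u (op y x) \<partial>lborel)"

lemma mol_integrable:
  assumes "continuous_on UNIV u"
  shows "integrable lborel (\<lambda>y. \<phi> y * u (op y x))"
proof (rule integrable_continuous_compact_support[OF _ compact_cball[of 0 \<epsilon>]])
  show "continuous_on UNIV (\<lambda>y. \<phi> y * u (op y x))"
    by (intro continuous_intros \<phi>_continuous continuous_on_compose2[OF assms]) auto
qed (use \<phi>_supp in auto)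

text \<open>Positivity and unit mass of the kernel preserve a comparison with an additive error.
  Left invariance of \<open>ccdist\<close> is what makes the error independent of \<open>y\<close>
  in the applications.\<close>

lemma mol_le:
  assumes u: "continuous_on UNIV u" and v: "continuous_on UNIV v"
    and le: "\<And>y. norm y \<le> \<epsilon> \<Longrightarrow> u (op y x) \<le> v (op y z) + c"
  shows "mol u x \<le> mol v z + c"
proof -
  have "mol u x \<le> (\<integral>y. \<phi> y * v (op y z) + \<phi> y * c \<partial>lborel)"
    unfolding mol_def
  proof (rule integral_mono)
    fix y show "\<phi> y * u (op y x) \<le> \<phi> y * v (op y z) + \<phi> y * c"
    proof (cases "norm y \<le> \<epsilon>")
      case True
      then show ?thesis using mult_left_mono[OF le \<phi>_nonneg] by (simp add: distrib_left)
    qed (simp add: \<phi>_supp)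
  qed (auto intro!: mol_integrable u v \<phi>_integrable)
  also have "\<dots> = mol v z + c"
    using mol_integrable[OF v] \<phi>_integrable by (simp add: mol_def \<phi>_integral)
  finally show ?thesis .
qed

lemma mol_const: "mol (\<lambda>_. c) x = c"
  by (simp add: mol_def \<phi>_integral)

lemma mol_close:
  assumes u: "continuous_on UNIV u" and le: "\<And>y. norm y \<le> \<epsilon> \<Longrightarrow> \<bar>u (op y x) - b\<bar> \<le> c"
  shows "\<bar>mol u x - b\<bar> \<le> c"
proof -
  have "mol u x \<le> mol (\<lambda>_. b) x + c"
    by (rule mol_le[OF u continuous_on_const]) (use le in fastforce)
  moreover have "mol (\<lambda>_. b) x \<le> mol u x + c"
    by (rule mol_le[OF continuous_on_const u]) (use le in fastforce)
  ultimately show ?thesis by (simp add: mol_const)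
qed

text \<open>The substitution \<open>z = op y x\<close> is a right translation in \<open>y\<close>;
  it moves the dependence on \<open>x\<close> from the merely continuous \<open>u\<close> to the
  smooth kernel.\<close>

lemma mol_eq: "mol u x = (\<integral>z. \<phi> (op z (ginv x)) * u z \<partial>lborel)"
  if u: "continuous_on UNIV u"
proof -
  have [measurable]: "(\<lambda>y. op y x) \<in> borel_measurable borel" "(\<lambda>y. op y (ginv x)) \<in> borel_measurable borel"
    "u \<in> borel_measurable borel" "\<phi> \<in> borel_measurable borel"
    by (auto intro!: borel_measurable_continuous_onI continuous_intros u \<phi>_continuous)
  have "(\<integral>z. \<phi> (op z (ginv x)) * u z \<partial>lborel) = (\<integral>z. \<phi> (op z (ginv x)) * u z \<partial>distr lborel borel (\<lambda>y. op y x))"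
    by (simp add: distr_op_right)
  also have "\<dots> = (\<integral>y. \<phi> (op (op y x) (ginv x)) * u (op y x) \<partial>lborel)"
    by (rule integral_distr) measurable
  finally show ?thesis by (simp add: mol_def)
qed

text \<open>For \<open>x\<close> within distance 1 of \<open>x0\<close>, the kernel is supported in
  the fixed compact set \<open>C\<close> of products, so integration over one box containing
  \<open>C\<close> suffices locally.\<close>

lemma diffk_mol:
  assumes u: "continuous_on UNIV u"
  shows "diffk k (mol u)"
proof (rule diffk_local)
  fix x0 :: "real^'n"
  define C where "C = (\<lambda>p. op (fst p) (snd p)) ` (cball 0 \<epsilon> \<times> cball x0 1)"
  have "compact C" unfolding C_def
    by (intro compact_continuous_image continuous_intros compact_Times compact_cball)
  then obtain a b where ab: "C \<subseteq> cbox a b"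
    using bounded_subset_cbox_symmetric compact_imp_bounded by metis
  have "diffk k (\<lambda>p. \<phi> (op (snd p) (ginv (fst p))))"
    by (intro diffk_compose[OF \<phi>_smooth] diffk_op diffk_ginv diffk_linear bounded_linear_fst bounded_linear_snd)
  from diffk_integral[OF u this, of a b]
  have 1: "diffk k (\<lambda>x. integral (cbox a b) (\<lambda>z. \<phi> (op z (ginv x)) * u z))" by simp
  have 2: "mol u x = integral (cbox a b) (\<lambda>z. \<phi> (op z (ginv x)) * u z)" if x: "x \<in> ball x0 1" for x
  proof -
    let ?g = "\<lambda>z. \<phi> (op z (ginv x)) * u z"
    have supp: "?g z = 0" if "z \<notin> cbox a b" for z
    proof -
      have "op z (ginv x) \<notin> cball 0 \<epsilon>"
      proof
        assume "op z (ginv x) \<in> cball 0 \<epsilon>"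
        then have "op (op z (ginv x)) x \<in> C" using x unfolding C_def
          by (intro image_eqI[of _ _ "(op z (ginv x), x)"]) auto
        then show False using ab that by auto
      qed
      then show ?thesis using \<phi>_supp by auto
    qed
    have "continuous_on UNIV ?g"
      by (intro continuous_intros u continuous_on_compose2[OF \<phi>_continuous]) auto
    from integrable_continuous_compact_support[OF this compact_cbox supp]
    have "(?g has_integral (\<integral>z. ?g z \<partial>lborel)) UNIV" by (rule has_integral_integral_lborel)
    then have "((\<lambda>z. if z \<in> cbox a b then ?g z else 0) has_integral (\<integral>z. ?g z \<partial>lborel)) UNIV"
      using supp by (elim has_integral_eq[rotated]) auto
    then have "(?g has_integral (\<integral>z. ?g z \<partial>lborel)) (cbox a b)"
      by (simp only: has_integral_restrict_UNIV)
    then show ?thesis by (simp add: mol_eq[OF u] integral_unique)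
  qed
  show "\<exists>N h. open N \<and> x0 \<in> N \<and> diffk k h \<and> (\<forall>y\<in>N. mol u y = h y)"
    using 1 2 by (intro exI[of _ "ball x0 1"] exI conjI) auto
qed

end

lemma (in carnot) exists_mollifier:
  assumes "r > 0"
  shows "\<exists>\<phi>. mollified op deg \<phi> r"
proof
  let ?I = "\<integral>x. bump r x \<partial>(lborel :: (real^'n) measure)"
  show "mollified op deg (\<lambda>x. (1 / ?I) * bump r x) r"
  proof
    show "diffk k (\<lambda>x :: real^'n. (1 / ?I) * bump r x)" for k
      by (rule diffk_mult[OF diffk_const diffk_bump])
  qed (use integral_bump_pos[OF assms, where 'a="real^'n"] assms in \<open>auto simp: less_imp_le bump_nonneg bump_eq_0\<close>)
qed

section \<open>The Hamilton-Jacobi inequality\<close>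

lemma (in carnot) diffk_Zder: "diffk (Suc k) f \<Longrightarrow> diffk k (Zder op j f)"
proof -
  assume f: "diffk (Suc k) f"
  have "Zder op j f x = (\<Sum>b\<in>Basis. (Zvf op j x \<bullet> b) * frechet_derivative f (at x) b)" for x
    unfolding Zder_def
    by (subst euclidean_representation[of "Zvf op j x", symmetric])
      (simp only: linear_sum[OF has_derivative_linear[OF diffk_SucD(1)[OF f]]]
        linear_cmul[OF has_derivative_linear[OF diffk_SucD(1)[OF f]]] real_scaleR_def)
  moreover have "diffk k (\<lambda>x. \<Sum>b\<in>Basis. (Zvf op j x \<bullet> b) * frechet_derivative f (at x) b)"
    by (rule diffk_sum) (rule diffk_mult[OF diffk_inner[OF diffk_Zvf diffk_const] diffk_SucD(2)[OF f]])
  ultimately show ?thesis by presburger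
qed

lemma (in carnot) Zder_eq:
  assumes "(f has_derivative f') (at x)"
  shows "Zder op j f x = f' (Zvf op j x)"
  unfolding Zder_def using frechet_derivative_at[OF assms] by metis

lemma (in carnot) flow_derivative_0:
  assumes w: "diffk (Suc 0) w"
  shows "((\<lambda>r. (w (flow h x r) - w x) / r) \<longlongrightarrow> (\<Sum>j\<in>{j. deg j = 1}. h j * Zder op j w x)) (at_right 0)"
proof -
  let ?D = "frechet_derivative w (at x)"
  have D: "(w has_derivative ?D) (at x)" using diffk_SucD(1)[OF w] .
  have "((\<lambda>r. w (flow h x r)) has_vector_derivative ?D (hvec h (flow h x 0))) (at 0)"
    using has_vector_derivative_compose[OF flow_derivative[of 0 h x, simplified]] D by simp
  then have "((\<lambda>r. w (flow h x r)) has_real_derivative ?D (hvec h x)) (at 0)"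
    by (simp add: has_real_derivative_iff_has_vector_derivative)
  then have "((\<lambda>r. (w (flow h x r) - w x) / r) \<longlongrightarrow> ?D (hvec h x)) (at 0)"
    by (simp add: DERIV_def)
  moreover have "?D (hvec h x) = (\<Sum>j\<in>{j. deg j = 1}. h j * Zder op j w x)"
    unfolding hvec_def Zder_def
    by (simp only: linear_sum[OF has_derivative_linear[OF D]] linear_cmul[OF has_derivative_linear[OF D]] real_scaleR_def)
  ultimately show ?thesis by (simp add: filterlim_at_split)
qed

lemma (in carnot) subgrad_norm_square: "(subgrad_norm op deg w x)\<^sup>2 = (\<Sum>j\<in>{j. deg j = 1}. (Zder op j w x)\<^sup>2)"
  by (simp add: subgrad_norm_def sum_nonneg)

lemma (in carnot) subgrad_norm_nonneg: "subgrad_norm op deg w x \<ge> 0"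
  by (simp add: subgrad_norm_def sum_nonneg)

locale mollified_hopf_lax = hopf_lax_bounded op deg f M + mollified op deg \<phi> \<epsilon>
  for op :: "real^'n \<Rightarrow> real^'n \<Rightarrow> real^'n" and deg :: "'n \<Rightarrow> nat" and f M \<phi> \<epsilon>
begin

definition mhl :: "real \<Rightarrow> real^'n \<Rightarrow> real" where
  "mhl t = mol (hl t)"

lemma diffk_mhl: "t > 0 \<Longrightarrow> diffk k (mhl t)"
  unfolding mhl_def by (rule diffk_mol[OF hl_continuous])

lemma mhl_abs_le: "t > 0 \<Longrightarrow> \<bar>mhl t x\<bar> \<le> M"
  unfolding mhl_def using mol_close[OF hl_continuous, of t x 0 M] hl_abs_le by simp

lemma mhl_step:
  assumes "t > 0" "s > 0"
  shows "mhl (t + s) x \<le> mhl t z + (cc x z)\<^sup>2 / (2 * s)"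
  unfolding mhl_def using hl_step[OF assms, of "op y x" "op y z" for y] assms
  by (intro mol_le hl_continuous) auto

lemma mhl_antimono:
  assumes "t > 0" "s > 0"
  shows "mhl (t + s) x \<le> mhl t x"
  using mhl_step[OF assms, of x x] by simp

lemma mhl_lipschitz:
  assumes "t > 0"
  shows "mhl t x' \<le> mhl t x + (2 * lipR t * cc x' x + (cc x' x)\<^sup>2) / (2 * t)"
  unfolding mhl_def using hl_lipschitz[OF assms, of "op y x'" "op y x" for y] assms
  by (intro mol_le hl_continuous) auto

lemma mhl_time:
  assumes "0 < t" "t \<le> t'"
  shows "\<bar>mhl t x - mhl t' x\<bar> \<le> (2 * M + 1) * (t' - t) / t"
proof -
  have "mhl t x \<le> mhl t' x + (2 * M + 1) * (t' - t) / t"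
    unfolding mhl_def using hl_time[OF assms] assms by (intro mol_le hl_continuous) auto
  moreover have "mhl t' x \<le> mhl t x"
    using mhl_antimono[of t "t' - t" x] assms by (cases "t = t'") auto
  ultimately show ?thesis by simp
qed

lemma cc_flow_le:
  assumes "r \<ge> 0" "n > 0" "(\<Sum>j\<in>{j. deg j = 1}. (h j)\<^sup>2) = n\<^sup>2"
  shows "cc (flow h x r) x \<le> r * n"
  by (rule ccdist_le[OF reach_sym[OF reach_flow[OF assms]]])

text \<open>Along the subgroup whose velocity is the gradient at \<open>x\<close>, the function
  initially grows at rate \<open>N^2\<close>, while the distance from \<open>x\<close> grows at rate
  at most \<open>N\<close>. Comparison with \<open>mhl_lipschitz\<close> yields
  \<open>N^2 <= (lipR t / t) * N\<close>.\<close>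

lemma mhl_grad_bound:
  assumes t: "t > 0"
  shows "subgrad_norm op deg (mhl t) x \<le> lipR t / t"
proof (cases "subgrad_norm op deg (mhl t) x = 0")
  case True
  then show ?thesis using lipR_nonneg[OF t] t by simp
next
  case False
  define N where "N = subgrad_norm op deg (mhl t) x"
  have N: "N > 0" using False subgrad_norm_nonneg[of "mhl t" x] by (simp add: N_def)
  define h where "h j = Zder op j (mhl t) x" for j
  have hN: "(\<Sum>j\<in>{j. deg j = 1}. (h j)\<^sup>2) = N\<^sup>2" unfolding h_def N_def subgrad_norm_square ..
  have "((\<lambda>r. (mhl t (flow h x r) - mhl t x) / r) \<longlongrightarrow> (\<Sum>j\<in>{j. deg j = 1}. h j * Zder op j (mhl t) x)) (at_right 0)"
    by (rule flow_derivative_0[OF diffk_mhl[OF t]])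
  also have "(\<Sum>j\<in>{j. deg j = 1}. h j * Zder op j (mhl t) x) = N\<^sup>2"
    using hN by (simp add: h_def power2_eq_square)
  finally have 1: "((\<lambda>r. (mhl t (flow h x r) - mhl t x) / r) \<longlongrightarrow> N\<^sup>2) (at_right 0)" .
  have 2: "((\<lambda>r. (2 * lipR t * N + r * N\<^sup>2) / (2 * t)) \<longlongrightarrow> (2 * lipR t * N + 0 * N\<^sup>2) / (2 * t)) (at_right 0)"
    using t by (intro tendsto_intros) simp
  have "(mhl t (flow h x r) - mhl t x) / r \<le> (2 * lipR t * N + r * N\<^sup>2) / (2 * t)" if r: "r > 0" for r
  proof -
    have le: "cc (flow h x r) x \<le> r * N" using cc_flow_le[OF _ N hN] r by simp
    have "mhl t (flow h x r) - mhl t x \<le> (2 * lipR t * cc (flow h x r) x + (cc (flow h x r) x)\<^sup>2) / (2 * t)"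
      using mhl_lipschitz[OF t, of "flow h x r" x] by simp
    also have "\<dots> \<le> (2 * lipR t * (r * N) + (r * N)\<^sup>2) / (2 * t)"
      using t lipR_nonneg[OF t] le ccdist_nonneg
      by (intro divide_right_mono add_mono mult_left_mono power_mono) auto
    also have "\<dots> = r * ((2 * lipR t * N + r * N\<^sup>2) / (2 * t))"
      by (simp add: power2_eq_square algebra_simps)
    finally show ?thesis using r by (simp add: divide_le_eq mult.commute)
  qed
  then have "\<forall>\<^sub>F r in at_right 0. (mhl t (flow h x r) - mhl t x) / r \<le> (2 * lipR t * N + r * N\<^sup>2) / (2 * t)"
    unfolding eventually_at_right_field by (intro exI[of _ 1]) auto
  from tendsto_le[OF trivial_limit_at_right_real 2 1 this]
  have "N * N \<le> (lipR t / t) * N" by (simp add: power2_eq_square)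
  from mult_right_le_imp_le[OF this N] show ?thesis by (simp add: N_def)
qed

text \<open>Truncating the difference quotient from below makes it bounded; the truncated
  quotient still converges because \<open>mhl\<close> is a subsolution of the Hamilton-Jacobi equation.\<close>

definition hjq :: "real \<Rightarrow> real \<Rightarrow> real^'n \<Rightarrow> real" where
  "hjq t s x = max ((mhl (t + s) x - mhl t x) / s) (- (subgrad_norm op deg (mhl t) x)\<^sup>2 / 2)"

lemma hjq_bounds:
  assumes "t > 0" "s > 0"
  shows "- (subgrad_norm op deg (mhl t) x)\<^sup>2 / 2 \<le> hjq t s x" "hjq t s x \<le> 0"
    "mhl (t + s) x \<le> mhl t x + s * hjq t s x"
proof -
  show "- (subgrad_norm op deg (mhl t) x)\<^sup>2 / 2 \<le> hjq t s x" by (simp add: hjq_def)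
  show "hjq t s x \<le> 0"
    using mhl_antimono[OF assms, of x] assms(2) by (simp add: hjq_def divide_nonpos_pos)
  have "(mhl (t + s) x - mhl t x) / s \<le> hjq t s x" by (simp add: hjq_def)
  then show "mhl (t + s) x \<le> mhl t x + s * hjq t s x" using assms(2) by (simp add: field_simps)
qed

lemma hjq_tendsto:
  assumes t: "t > 0"
  shows "((\<lambda>s. hjq t s x) \<longlongrightarrow> - (subgrad_norm op deg (mhl t) x)\<^sup>2 / 2) (at_right 0)"
proof (cases "subgrad_norm op deg (mhl t) x = 0")
  case True
  \<comment> \<open>The gradient gives no direction to move in, but the two bounds on
    \<open>hjq\<close> coincide.\<close>
  have "\<forall>\<^sub>F s in at_right 0. hjq t s x = 0"
    unfolding eventually_at_right_field
  proof (intro exI[of _ 1] conjI allI impI)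
    fix s :: real assume "0 < s"
    from hjq_bounds(1,2)[OF t this, of x] True show "hjq t s x = 0" by simp
  qed simp
  then show ?thesis using True tendsto_eventually by simp
next
  case False
  define N where "N = subgrad_norm op deg (mhl t) x"
  have N: "N > 0" using False subgrad_norm_nonneg[of "mhl t" x] by (simp add: N_def)
  define h where "h j = - Zder op j (mhl t) x" for j
  have hN: "(\<Sum>j\<in>{j. deg j = 1}. (h j)\<^sup>2) = N\<^sup>2" unfolding h_def N_def subgrad_norm_square by simp
  have "((\<lambda>r. (mhl t (flow h x r) - mhl t x) / r) \<longlongrightarrow> (\<Sum>j\<in>{j. deg j = 1}. h j * Zder op j (mhl t) x)) (at_right 0)"
    by (rule flow_derivative_0[OF diffk_mhl[OF t]])
  also have "(\<Sum>j\<in>{j. deg j = 1}. h j * Zder op j (mhl t) x) = - N\<^sup>2"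
    using hN by (simp add: h_def power2_eq_square sum_negf)
  finally have 1: "((\<lambda>r. (mhl t (flow h x r) - mhl t x) / r) \<longlongrightarrow> - N\<^sup>2) (at_right 0)" .
  \<comment> \<open>Moving against the gradient for time \<open>s\<close> gains \<open>N^2\<close>
    per unit time and costs \<open>N^2 / 2\<close> in kinetic energy, leaving exactly the truncation
    level.\<close>
  have "((\<lambda>r. max ((mhl t (flow h x r) - mhl t x) / r + N\<^sup>2 / 2) (- N\<^sup>2 / 2)) \<longlongrightarrow> max (- N\<^sup>2 + N\<^sup>2 / 2) (- N\<^sup>2 / 2)) (at_right 0)"
    by (intro tendsto_intros 1)
  then have up: "((\<lambda>r. max ((mhl t (flow h x r) - mhl t x) / r + N\<^sup>2 / 2) (- N\<^sup>2 / 2)) \<longlongrightarrow> - N\<^sup>2 / 2) (at_right 0)"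
    by simp
  have le: "(mhl (t + s) x - mhl t x) / s \<le> (mhl t (flow h x s) - mhl t x) / s + N\<^sup>2 / 2" if s: "s > 0" for s
  proof -
    have "mhl (t + s) x \<le> mhl t (flow h x s) + (cc x (flow h x s))\<^sup>2 / (2 * s)" by (rule mhl_step[OF t s])
    also have "(cc x (flow h x s))\<^sup>2 / (2 * s) \<le> (s * N)\<^sup>2 / (2 * s)"
      using s cc_flow_le[OF _ N hN, of s x] ccdist_nonneg ccdist_sym[of x "flow h x s"]
      by (intro divide_right_mono power_mono) auto
    also have "(s * N)\<^sup>2 / (2 * s) = s * (N\<^sup>2 / 2)" using s by (simp add: power2_eq_square)
    finally show ?thesis using s by (simp add: field_simps)
  qed
  have "((\<lambda>s. hjq t s x) \<longlongrightarrow> - N\<^sup>2 / 2) (at_right 0)"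
  proof (rule tendsto_sandwich[OF _ _ tendsto_const up])
    show "\<forall>\<^sub>F s in at_right 0. - N\<^sup>2 / 2 \<le> hjq t s x"
      by (simp add: hjq_def N_def)
    show "\<forall>\<^sub>F s in at_right 0. hjq t s x \<le> max ((mhl t (flow h x s) - mhl t x) / s + N\<^sup>2 / 2) (- N\<^sup>2 / 2)"
      unfolding eventually_at_right_field hjq_def N_def[symmetric]
      using le by (intro exI[of _ 1] conjI allI impI max.mono) auto
  qed
  then show ?thesis by (simp add: N_def)
qed

end

section \<open>The logarithmic Sobolev inequality for exponentials\<close>

text \<open>Provides a constant dominating the entropy integrand, also where the cutoffs make its
  argument small: \<open>ln (1 / x) <= 1 / x - 1\<close> handles \<open>x <= 1\<close>, and
  \<open>ln x <= x - 1\<close> the rest.\<close>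

lemma abs_mult_ln_le:
  fixes x B :: real
  assumes "0 \<le> x" "x \<le> B"
  shows "\<bar>x * ln x\<bar> \<le> 1 + B\<^sup>2"
proof -
  consider "x = 0" | "0 < x" "x \<le> 1" | "1 < x" using assms by linarith
  then show ?thesis
  proof cases
    case 2
    have "ln (1 / x) \<le> 1 / x - 1" using 2 by (intro ln_le_minus_one) simp
    then have "x * (- ln x) \<le> x * (1 / x - 1)" using 2 by (intro mult_left_mono) (auto simp: ln_div)
    moreover have "x * (1 / x - 1) = 1 - x" using 2 by (simp add: algebra_simps)
    moreover have "x * ln x \<le> 0" using 2 by (simp add: mult_nonneg_nonpos)
    ultimately show ?thesis using 2 by (simp add: abs_if add_increasing2)
  next
    case 3
    have "x * ln x \<le> B * B"
      using 3 assms ln_le_minus_one[of x] by (intro mult_mono) auto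
    moreover have "x * ln x \<ge> 0" using 3 by simp
    ultimately show ?thesis by (simp add: power2_eq_square)
  qed auto
qed

lemma exp_le_bound:
  fixes w :: real
  assumes "\<bar>w\<bar> \<le> M"
  shows "exp (q * w) \<le> exp (\<bar>q\<bar> * M)"
proof -
  have "q * w \<le> \<bar>q\<bar> * \<bar>w\<bar>" by (metis abs_ge_self abs_mult)
  also have "\<dots> \<le> \<bar>q\<bar> * M" using assms by (intro mult_left_mono) auto
  finally show ?thesis by simp
qed

section \<open>Dilated cutoff functions\<close>

context carnot
begin

text \<open>The factor \<open>exp 1\<close> makes the value at the origin 1. Group dilations are
  used for stretching because first-layer derivatives then scale by exactly
  \<open>1 / real (Suc n)\<close>.\<close>

definition cutoff :: "nat \<Rightarrow> real^'n \<Rightarrow> real" where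
  "cutoff n x = exp 1 * bump 1 (dil deg (1 / real (Suc n)) x)"

lemma diffk_cutoff: "diffk k (cutoff n)"
proof -
  have "diffk k (\<lambda>x. exp 1 * bump 1 (dil deg (1 / real (Suc n)) x))"
    by (rule diffk_mult[OF diffk_const diffk_compose[OF diffk_bump diffk_linear[OF bounded_linear_dil]]])
  then show ?thesis by (simp add: cutoff_def[abs_def])
qed

lemma cutoff_nonneg: "cutoff n x \<ge> 0"
  by (simp add: cutoff_def bump_nonneg)

lemma cutoff_le_1: "cutoff n x \<le> 1"
proof -
  have "cutoff n x \<le> exp 1 * exp (- 1)"
    unfolding cutoff_def by (intro mult_left_mono bump_le) simp
  then show ?thesis by (simp flip: exp_add)
qed

lemma cutoff_tendsto_1: "(\<lambda>n. cutoff n x) \<longlonglongrightarrow> 1"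
proof -
  have "(\<lambda>n. 1 / real (Suc n)) \<longlonglongrightarrow> 0" by (rule LIMSEQ_inverse_real_of_nat[unfolded inverse_eq_divide])
  then have "(\<lambda>n. dil deg (1 / real (Suc n)) x) \<longlonglongrightarrow> dil deg 0 x" by (intro tendsto_dil tendsto_const)
  moreover have "isCont (bump 1) (dil deg 0 x)"
  proof -
    have "continuous_on UNIV (bump 1 :: real^'n \<Rightarrow> real)" by (rule diffk_imp_continuous_on[OF diffk_bump])
    then show ?thesis by (simp add: continuous_on_eq_continuous_at)
  qed
  ultimately have "(\<lambda>n. exp 1 * bump 1 (dil deg (1 / real (Suc n)) x)) \<longlonglongrightarrow> exp 1 * bump 1 (dil deg 0 x)"
    by (intro tendsto_mult_left isCont_tendsto_compose[where g="bump 1"])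
  then show ?thesis by (simp add: cutoff_def bump_def flat_exp_pos flip: exp_add)
qed

lemma cutoff_support: "bounded {x. cutoff n x \<noteq> 0}"
proof (rule bounded_subset)
  show "bounded (dil deg (real (Suc n)) ` cball 0 1)"
    by (intro compact_imp_bounded compact_continuous_image continuous_intros) simp
  show "{x. cutoff n x \<noteq> 0} \<subseteq> dil deg (real (Suc n)) ` cball 0 1"
  proof
    fix x assume "x \<in> {x. cutoff n x \<noteq> 0}"
    then have "norm (dil deg (1 / real (Suc n)) x) \<le> 1"
      using bump_eq_0[of 1 "dil deg (1 / real (Suc n)) x"] unfolding cutoff_def
      by (cases "norm (dil deg (1 / real (Suc n)) x) \<le> 1") auto
    then show "x \<in> dil deg (real (Suc n)) ` cball 0 1"
      by (intro image_eqI[of _ _ "dil deg (1 / real (Suc n)) x"]) (simp_all add: dil_dil)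
  qed
qed

lemma Zder_dil:
  assumes f: "diffk (Suc 0) f" and j: "deg j = 1" and l: "l > 0"
  shows "Zder op j (\<lambda>x. f (dil deg l x)) x = l * Zder op j f (dil deg l x)"
proof -
  let ?D = "frechet_derivative f (at (dil deg l x))"
  have D: "(f has_derivative ?D) (at (dil deg l x))" using diffk_SucD(1)[OF f] .
  have "Zder op j (\<lambda>x. f (dil deg l x)) x = ?D (dil deg l (Zvf op j x))"
    by (rule Zder_eq[OF has_derivative_compose[OF bounded_linear_imp_has_derivative[OF bounded_linear_dil] D]])
  also have "dil deg l (Zvf op j x) = l *\<^sub>R Zvf op j (dil deg l x)"
    using Zvf_dil_pos[OF j l] l by simp
  finally show ?thesis by (simp only: linear_cmul[OF has_derivative_linear[OF D]] Zder_def real_scaleR_def)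
qed

lemma cutoff_Zder_bound:
  obtains C where "\<And>n j x. deg j = 1 \<Longrightarrow> \<bar>Zder op j (cutoff n) x\<bar> \<le> C / real (Suc n)" "C \<ge> 0"
proof -
  define B :: "real^'n \<Rightarrow> real" where "B x = exp 1 * bump 1 x" for x
  have B: "diffk k B" for k
    unfolding B_def[abs_def] by (rule diffk_mult[OF diffk_const diffk_bump])
  have "\<exists>K. \<forall>x. \<bar>Zder op j B x\<bar> \<le> K" for j
  proof -
    have "continuous_on (cball 0 1) (Zder op j B)"
      using diffk_imp_continuous_on[OF diffk_Zder[OF B]] continuous_on_subset by blast
    from compact_continuous_image[OF this] have "bounded (Zder op j B ` cball 0 1)"
      by (simp add: compact_imp_bounded)
    then obtain K where K: "\<forall>x\<in>cball 0 1. \<bar>Zder op j B x\<bar> \<le> K" unfolding bounded_iff by auto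
    have "Zder op j B x = 0" if "x \<notin> cball 0 1" for x
    proof -
      have "(B has_derivative (\<lambda>_. 0)) (at x)"
        by (rule has_derivative_transform_within_open[OF has_derivative_const[of 0], of "- cball 0 1"])
          (use that in \<open>auto simp: B_def bump_eq_0\<close>)
      from Zder_eq[OF this] show ?thesis .
    qed
    moreover have "K \<ge> 0" using K[rule_format, of 0] by simp
    ultimately have "\<bar>Zder op j B x\<bar> \<le> K" for x using K by (cases "x \<in> cball 0 1") auto
    then show ?thesis by blast
  qed
  then obtain K where K: "\<And>j x. \<bar>Zder op j B x\<bar> \<le> K j" by metis
  have K0: "K j \<ge> 0" for j using K[of j 0] by simp
  show thesis
  proof (rule that[of "\<Sum>j\<in>UNIV. K j"])
    fix n x and j :: 'n assume j: "deg j = 1"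
    have "Zder op j (cutoff n) x = (1 / real (Suc n)) * Zder op j B (dil deg (1 / real (Suc n)) x)"
      using Zder_dil[OF B j, of "1 / real (Suc n)" x] by (simp add: cutoff_def[abs_def] B_def)
    then have "\<bar>Zder op j (cutoff n) x\<bar> = \<bar>Zder op j B (dil deg (1 / real (Suc n)) x)\<bar> / real (Suc n)"
      by (simp add: abs_mult)
    also have "\<dots> \<le> (\<Sum>j\<in>UNIV. K j) / real (Suc n)"
      using K[of j] member_le_sum[of j UNIV K] K0 by (intro divide_right_mono) (auto intro: order_trans)
    finally show "\<bar>Zder op j (cutoff n) x\<bar> \<le> (\<Sum>j\<in>UNIV. K j) / real (Suc n)" .
  qed (simp add: K0 sum_nonneg)
qed

end

locale carnot_LSI = carnot op deg + finite_measure \<mu>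
  for op :: "real^'n \<Rightarrow> real^'n \<Rightarrow> real^'n" and deg :: "'n \<Rightarrow> nat" and \<mu> :: "(real^'n) measure" +
  fixes \<rho> :: real
  assumes sets_\<mu> [measurable_cong, simp]: "sets \<mu> = sets borel"
    and prob: "measure \<mu> UNIV = 1"
    and \<rho>_pos: "\<rho> > 0"
    and LSI: "smooth_fun g \<Longrightarrow> compact (closure {x. g x \<noteq> 0}) \<Longrightarrow>
       \<rho> * ((\<integral>x. (g x)\<^sup>2 * ln ((g x)\<^sup>2) \<partial>\<mu>) - (\<integral>x. (g x)\<^sup>2 \<partial>\<mu>) * ln (\<integral>x. (g x)\<^sup>2 \<partial>\<mu>))
         \<le> 2 * (\<integral>x. (subgrad_norm op deg g x)\<^sup>2 \<partial>\<mu>)"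
begin

lemma space_\<mu> [simp]: "space \<mu> = UNIV"
  using sets_eq_imp_space_eq[OF sets_\<mu>] by simp

lemma continuous_measurable: "continuous_on UNIV g \<Longrightarrow> g \<in> borel_measurable \<mu>"
  using borel_measurable_continuous_onI measurable_cong_sets[OF sets_\<mu> refl] by blast

lemma bounded_integrable:
  fixes g :: "real^'n \<Rightarrow> real"
  assumes "g \<in> borel_measurable \<mu>" "\<And>x. \<bar>g x\<bar> \<le> B"
  shows "integrable \<mu> g"
  using assms by (intro integrable_const_bound[of _ B]) auto

lemma bounded_convergence:
  fixes g :: "nat \<Rightarrow> real^'n \<Rightarrow> real"
  assumes "\<And>n. g n \<in> borel_measurable \<mu>" "\<And>n x. \<bar>g n x\<bar> \<le> B" "\<And>x. (\<lambda>n. g n x) \<longlonglongrightarrow> h x"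
  shows "(\<lambda>n. \<integral>x. g n x \<partial>\<mu>) \<longlonglongrightarrow> (\<integral>x. h x \<partial>\<mu>)"
proof (rule integral_dominated_convergence[where w="\<lambda>_. B"])
  show "h \<in> borel_measurable \<mu>"
    by (rule borel_measurable_LIMSEQ_metric[OF assms(1,3)])
qed (use assms in auto)

lemma integral_exp_pos:
  fixes g :: "real^'n \<Rightarrow> real"
  assumes "g \<in> borel_measurable \<mu>" "\<And>x. \<bar>g x\<bar> \<le> B"
  shows "(\<integral>x. exp (g x) \<partial>\<mu>) > 0"
proof -
  have i: "integrable \<mu> (\<lambda>x. exp (g x))"
    using assms by (intro bounded_integrable[of _ "exp B"]) (auto simp: abs_le_iff)
  have "exp (- B) = (\<integral>x. exp (- B) \<partial>\<mu>)" by (simp add: prob)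
  also have "\<dots> \<le> (\<integral>x. exp (g x) \<partial>\<mu>)"
    using assms(2) i by (intro integral_mono) (auto simp: abs_le_iff minus_le_iff)
  finally show ?thesis using exp_gt_zero[of "- B"] by linarith
qed

text \<open>The inequality passes from compactly supported functions to \<open>exp (q w / 2)\<close> by
  multiplying with \<open>cutoff n\<close>, whose horizontal gradient tends to 0 uniformly.\<close>

lemma LSI_exp:
  assumes w: "\<And>k. diffk k w" and wM: "\<And>x. \<bar>w x\<bar> \<le> M" and wC: "\<And>x. subgrad_norm op deg w x \<le> C"
  shows "\<rho> * ((\<integral>x. exp (q * w x) * (q * w x) \<partial>\<mu>) - (\<integral>x. exp (q * w x) \<partial>\<mu>) * ln (\<integral>x. exp (q * w x) \<partial>\<mu>))
    \<le> q\<^sup>2 / 2 * (\<integral>x. (subgrad_norm op deg w x)\<^sup>2 * exp (q * w x) \<partial>\<mu>)"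
proof -
  define e where "e x = exp ((q / 2) * w x)" for x
  define g where "g n x = cutoff n x * e x" for n x
  have e2: "(e x)\<^sup>2 = exp (q * w x)" for x by (simp add: e_def power2_eq_square flip: exp_add)
  have e: "diffk k e" for k
    unfolding e_def[abs_def] by (rule diffk_compose[OF diffk_exp diffk_mult[OF diffk_const w]])
  have g: "diffk k (g n)" for k n
    unfolding g_def[abs_def] by (rule diffk_mult[OF diffk_cutoff e])
  have gm [measurable]: "g n \<in> borel_measurable \<mu>" for n
    by (rule continuous_measurable[OF diffk_imp_continuous_on[OF g]])
  define B where "B = exp (\<bar>q\<bar> * M)"
  have eB: "(e x)\<^sup>2 \<le> B" for x unfolding e2 B_def by (rule exp_le_bound[OF wM])
  have B0: "B > 0" by (simp add: B_def)
  have g2: "(g n x)\<^sup>2 \<le> B" for n x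
  proof -
    have "(cutoff n x)\<^sup>2 \<le> 1" using cutoff_nonneg cutoff_le_1 by (simp add: power_le_one)
    then have "(cutoff n x)\<^sup>2 * (e x)\<^sup>2 \<le> 1 * B" using eB by (intro mult_mono) auto
    then show ?thesis by (simp add: g_def power_mult_distrib)
  qed
  have glim: "(\<lambda>n. (g n x)\<^sup>2) \<longlonglongrightarrow> exp (q * w x)" for x
  proof -
    have "(\<lambda>n. (g n x)\<^sup>2) \<longlonglongrightarrow> (1 * e x)\<^sup>2"
      unfolding g_def by (intro tendsto_intros cutoff_tendsto_1)
    then show ?thesis by (simp add: e2)
  qed
  have I1: "(\<lambda>n. \<integral>x. (g n x)\<^sup>2 \<partial>\<mu>) \<longlonglongrightarrow> (\<integral>x. exp (q * w x) \<partial>\<mu>)"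
    by (rule bounded_convergence[where B=B]) (use g2 glim in auto)
  have I2: "(\<lambda>n. \<integral>x. (g n x)\<^sup>2 * ln ((g n x)\<^sup>2) \<partial>\<mu>) \<longlonglongrightarrow> (\<integral>x. exp (q * w x) * (q * w x) \<partial>\<mu>)"
  proof (rule bounded_convergence[where B="1 + B\<^sup>2"])
    show "\<bar>(g n x)\<^sup>2 * ln ((g n x)\<^sup>2)\<bar> \<le> 1 + B\<^sup>2" for n x
      by (rule abs_mult_ln_le[OF zero_le_power2 g2])
    show "(\<lambda>n. (g n x)\<^sup>2 * ln ((g n x)\<^sup>2)) \<longlonglongrightarrow> exp (q * w x) * (q * w x)" for x
      using tendsto_mult[OF glim tendsto_ln[OF glim]] by simp
  qed measurable
  have wm: "w \<in> borel_measurable \<mu>" by (rule continuous_measurable[OF diffk_imp_continuous_on[OF w]])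
  have Ipos: "(\<integral>x. exp (q * w x) \<partial>\<mu>) > 0"
  proof (rule integral_exp_pos[where B="\<bar>q\<bar> * M"])
    show "\<bar>q * w x\<bar> \<le> \<bar>q\<bar> * M" for x using wM by (simp add: abs_mult mult_left_mono)
  qed (use wm in measurable)
  have L: "(\<lambda>n. \<rho> * ((\<integral>x. (g n x)\<^sup>2 * ln ((g n x)\<^sup>2) \<partial>\<mu>) - (\<integral>x. (g n x)\<^sup>2 \<partial>\<mu>) * ln (\<integral>x. (g n x)\<^sup>2 \<partial>\<mu>)))
    \<longlonglongrightarrow> \<rho> * ((\<integral>x. exp (q * w x) * (q * w x) \<partial>\<mu>) - (\<integral>x. exp (q * w x) \<partial>\<mu>) * ln (\<integral>x. exp (q * w x) \<partial>\<mu>))"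
    using Ipos by (intro tendsto_intros I1 I2) simp
  have Zg: "Zder op j (g n) x = e x * (Zder op j (cutoff n) x + cutoff n x * ((q / 2) * Zder op j w x))" for j n x
  proof -
    let ?W = "frechet_derivative w (at x)" and ?X = "frechet_derivative (cutoff n) (at x)"
    have "(g n has_derivative (\<lambda>v. cutoff n x * (e x * ((q / 2) * ?W v)) + ?X v * e x)) (at x)"
      unfolding g_def[abs_def] e_def
      by (rule has_derivative_mult[OF diffk_SucD(1)[OF diffk_cutoff]])
        (auto intro!: derivative_eq_intros diffk_SucD(1)[OF w])
    from Zder_eq[OF this] show ?thesis by (simp add: Zder_def algebra_simps)
  qed
  obtain K where K: "\<And>n j x. deg j = 1 \<Longrightarrow> \<bar>Zder op j (cutoff n) x\<bar> \<le> K / real (Suc n)" and K0: "K \<ge> 0"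
    using cutoff_Zder_bound by metis
  have Kn: "\<bar>Zder op j (cutoff n) x\<bar> \<le> K" if "deg j = 1" for n j x
  proof -
    have "K / real (Suc n) \<le> K" using K0 by (simp add: divide_le_eq mult_le_cancel_left1)
    with K[OF that, of n x] show ?thesis by linarith
  qed
  have C: "\<bar>Zder op j w x\<bar> \<le> \<bar>C\<bar>" if "deg j = 1" for j x
  proof -
    have "(Zder op j w x)\<^sup>2 \<le> (\<Sum>j\<in>{j. deg j = 1}. (Zder op j w x)\<^sup>2)"
      using that by (intro member_le_sum) auto
    then have "\<bar>Zder op j w x\<bar>\<^sup>2 \<le> (subgrad_norm op deg w x)\<^sup>2" by (simp only: subgrad_norm_square power2_abs)
    from power2_le_imp_le[OF this subgrad_norm_nonneg]
    have "\<bar>Zder op j w x\<bar> \<le> subgrad_norm op deg w x" .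
    with wC[of x] show ?thesis by linarith
  qed
  \<comment> \<open>The bounds on the gradients of \<open>w\<close> and of the cutoffs give a
    constant dominating all squared gradients. The factor \<open>(q / 2)^2\<close> comes from the
    exponent of \<open>e\<close>.\<close>
  have R: "(\<lambda>n. \<integral>x. (subgrad_norm op deg (g n) x)\<^sup>2 \<partial>\<mu>) \<longlonglongrightarrow> (\<integral>x. (q / 2)\<^sup>2 * ((subgrad_norm op deg w x)\<^sup>2 * exp (q * w x)) \<partial>\<mu>)"
  proof (rule bounded_convergence[where B="\<Sum>j\<in>{j. deg j = 1}. B * (K + \<bar>q / 2\<bar> * \<bar>C\<bar>)\<^sup>2"])
    show "(\<lambda>x. (subgrad_norm op deg (g n) x)\<^sup>2) \<in> borel_measurable \<mu>" for n
      unfolding subgrad_norm_square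
      by (intro continuous_measurable continuous_intros diffk_imp_continuous_on[OF diffk_Zder[OF g]])
    have "(\<Sum>j\<in>{j. deg j = 1}. (Zder op j (g n) x)\<^sup>2) \<le> (\<Sum>j\<in>{j. deg j = 1}. B * (K + \<bar>q / 2\<bar> * \<bar>C\<bar>)\<^sup>2)" for n x
    proof (rule sum_mono)
      fix j assume "j \<in> {j. deg j = 1}"
      then have j: "deg j = 1" by simp
      have "\<bar>cutoff n x * ((q / 2) * Zder op j w x)\<bar> \<le> 1 * (\<bar>q / 2\<bar> * \<bar>C\<bar>)"
        unfolding abs_mult using cutoff_nonneg cutoff_le_1 C[OF j, of x] by (intro mult_mono) auto
      then have "\<bar>Zder op j (cutoff n) x + cutoff n x * ((q / 2) * Zder op j w x)\<bar> \<le> K + \<bar>q / 2\<bar> * \<bar>C\<bar>"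
        using Kn[OF j, of n x] by linarith
      then have "\<bar>Zder op j (cutoff n) x + cutoff n x * ((q / 2) * Zder op j w x)\<bar>\<^sup>2 \<le> (K + \<bar>q / 2\<bar> * \<bar>C\<bar>)\<^sup>2"
        by (intro power_mono) auto
      then show "(Zder op j (g n) x)\<^sup>2 \<le> B * (K + \<bar>q / 2\<bar> * \<bar>C\<bar>)\<^sup>2"
        unfolding Zg power_mult_distrib using eB[of x] B0 by (intro mult_mono) auto
    qed
    then show "\<bar>(subgrad_norm op deg (g n) x)\<^sup>2\<bar> \<le> (\<Sum>j\<in>{j. deg j = 1}. B * (K + \<bar>q / 2\<bar> * \<bar>C\<bar>)\<^sup>2)" for n x
      unfolding abs_power2 by (simp only: subgrad_norm_square)
    show "(\<lambda>n. (subgrad_norm op deg (g n) x)\<^sup>2) \<longlonglongrightarrow> (q / 2)\<^sup>2 * ((subgrad_norm op deg w x)\<^sup>2 * exp (q * w x))" for x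
    proof -
      have Z0: "(\<lambda>n. Zder op j (cutoff n) x) \<longlonglongrightarrow> 0" if "deg j = 1" for j
      proof (rule Lim_null_comparison)
        show "\<forall>\<^sub>F n in sequentially. norm (Zder op j (cutoff n) x) \<le> K * (1 / real (Suc n))"
          using K[OF that] by simp
        show "(\<lambda>n. K * (1 / real (Suc n))) \<longlonglongrightarrow> 0"
          using tendsto_mult_right_zero[OF LIMSEQ_inverse_real_of_nat, of K] by (simp add: inverse_eq_divide)
      qed
      have "(\<lambda>n. \<Sum>j\<in>{j. deg j = 1}. (e x * (Zder op j (cutoff n) x + cutoff n x * ((q / 2) * Zder op j w x)))\<^sup>2)
        \<longlonglongrightarrow> (\<Sum>j\<in>{j. deg j = 1}. (e x * (0 + 1 * ((q / 2) * Zder op j w x)))\<^sup>2)"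
        by (intro tendsto_sum tendsto_power tendsto_mult tendsto_add tendsto_const cutoff_tendsto_1 Z0) simp
      moreover have "(\<Sum>j\<in>{j. deg j = 1}. (e x * (0 + 1 * ((q / 2) * Zder op j w x)))\<^sup>2)
        = (q / 2)\<^sup>2 * ((subgrad_norm op deg w x)\<^sup>2 * exp (q * w x))"
        by (simp add: subgrad_norm_square power_mult_distrib e2 power_divide sum_distrib_left sum_distrib_right mult_ac)
      ultimately show ?thesis unfolding subgrad_norm_square Zg by simp
    qed
  qed
  have supp: "compact (closure {x. g n x \<noteq> 0})" for n
    unfolding compact_closure
    by (rule bounded_subset[OF cutoff_support[of n]]) (auto simp: g_def)
  have "\<rho> * ((\<integral>x. exp (q * w x) * (q * w x) \<partial>\<mu>) - (\<integral>x. exp (q * w x) \<partial>\<mu>) * ln (\<integral>x. exp (q * w x) \<partial>\<mu>))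
    \<le> 2 * (\<integral>x. (q / 2)\<^sup>2 * ((subgrad_norm op deg w x)\<^sup>2 * exp (q * w x)) \<partial>\<mu>)"
    by (rule LIMSEQ_le[OF L tendsto_mult_left[OF R]])
      (use LSI g supp in \<open>auto simp: smooth_fun_def\<close>)
  then show ?thesis by (simp add: power_divide)
qed

end

section \<open>Monotonicity of the logarithmic norms\<close>

text \<open>The continuous extensions of these quotients to 0 allow identities free of division,
  such as \<open>z * exp1q z = exp z - 1\<close>. They serve twice: to cross the exponent 0, and to
  form difference quotients under the integral.\<close>

definition exp1q :: "real \<Rightarrow> real" where
  "exp1q z = (if z = 0 then 1 else (exp z - 1) / z)"

definition ln1q :: "real \<Rightarrow> real" where
  "ln1q z = (if z = 0 then 1 else ln (1 + z) / z)"

lemma exp1q: "z * exp1q z = exp z - 1"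
  by (simp add: exp1q_def)

lemma ln1q: "z * ln1q z = ln (1 + z)"
  by (simp add: ln1q_def)

lemma isCont_exp1q: "isCont exp1q z"
proof (cases "z = 0")
  case True
  have "((\<lambda>h. (exp (0 + h) - exp 0) / h) \<longlongrightarrow> exp (0::real)) (at 0)"
    using DERIV_exp[of "0::real"] by (simp only: DERIV_def)
  then have "(exp1q \<longlongrightarrow> 1) (at 0)"
    by (rule Lim_transform_eventually[THEN tendsto_eq_rhs])
      (auto simp: eventually_at_filter exp1q_def)
  then show ?thesis using True by (simp add: isCont_def exp1q_def)
next
  case False
  have "isCont (\<lambda>z. (exp z - 1) / z) z" using False by (intro continuous_intros)
  moreover have "\<forall>\<^sub>F y in nhds z. exp1q y = (exp y - 1) / y"
    using eventually_nhds_in_open[of "- {0}" z] False by (auto elim!: eventually_mono simp: exp1q_def)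
  ultimately show ?thesis by (simp add: isCont_cong)
qed

lemma isCont_ln1q:
  assumes "z > - 1"
  shows "isCont ln1q z"
proof (cases "z = 0")
  case True
  have "((\<lambda>h. (ln (1 + h) - ln 1) / h) \<longlongrightarrow> inverse (1::real)) (at 0)"
    using DERIV_ln[of "1::real"] by (simp only: DERIV_def)
  then have "(ln1q \<longlongrightarrow> 1) (at 0)"
    by (rule Lim_transform_eventually[THEN tendsto_eq_rhs])
      (auto simp: eventually_at_filter ln1q_def)
  then show ?thesis using True by (simp add: isCont_def ln1q_def)
next
  case False
  have "isCont (\<lambda>z. ln (1 + z) / z) z" using False assms by (intro continuous_intros) auto
  moreover have "\<forall>\<^sub>F y in nhds z. ln1q y = ln (1 + y) / y"
    using eventually_nhds_in_open[of "- {0}" z] False by (auto elim!: eventually_mono simp: ln1q_def)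
  ultimately show ?thesis by (simp add: isCont_cong)
qed

lemma exp1q_bounded:
  obtains K where "\<And>z. \<bar>z\<bar> \<le> R \<Longrightarrow> \<bar>exp1q z\<bar> \<le> K"
proof -
  have "continuous_on {-R..R} exp1q"
    using isCont_exp1q by (simp add: continuous_at_imp_continuous_on)
  from compact_continuous_image[OF this] have "bounded (exp1q ` {-R..R})" by (simp add: compact_imp_bounded)
  then obtain K where "\<forall>z\<in>{-R..R}. \<bar>exp1q z\<bar> \<le> K" unfolding bounded_iff by auto
  then show thesis using that[of K] by (simp add: abs_le_iff minus_le_iff)
qed

lemma exp1q_measurable [measurable]: "exp1q \<in> borel_measurable borel"
  using isCont_exp1q by (simp add: borel_measurable_continuous_onI continuous_at_imp_continuous_on)

text \<open>For an interior starting point, the last time at which \<open>F\<close> lies below a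
  line of slope \<open>e\<close> can only be \<open>b\<close>; then \<open>e\<close> tends to 0 and
  the starting point to \<open>a\<close>. The derivative condition concerns interior points, so the
  time of vanishing exponent may be an endpoint.\<close>

lemma right_Dini_imp_le:
  fixes F :: "real \<Rightarrow> real"
  assumes ab: "a \<le> b" and c: "continuous_on {a..b} F"
    and D: "\<And>t e. a < t \<Longrightarrow> t < b \<Longrightarrow> e > 0 \<Longrightarrow> \<forall>\<^sub>F s in at_right 0. F (t + s) \<le> F t + e * s"
  shows "F b \<le> F a"
proof -
  have 1: "F b \<le> F c + e * (b - c)" if c': "a < c" "c < b" and e: "e > 0" for c e
  proof -
    define S where "S = {t \<in> {c..b}. F t - e * (t - c) \<le> F c}"
    have "closed S" unfolding S_def
      using c' by (intro continuous_closed_preimage_constant continuous_on_closed_Collect_le continuous_intros)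
        (auto intro: continuous_on_subset[OF c])
    moreover have "c \<in> S" using c' by (simp add: S_def)
    moreover have "bdd_above S" by (auto simp: S_def intro!: bdd_aboveI[of _ b])
    ultimately have T: "Sup S \<in> S" by (intro closed_contains_Sup) auto
    define T where "T = Sup S"
    have "T = b"
    proof (rule ccontr)
      assume "T \<noteq> b"
      then have "a < T" "T < b" using T c' by (auto simp: S_def T_def)
      from D[OF this e] obtain d where d: "d > 0" "\<And>s. 0 < s \<Longrightarrow> s < d \<Longrightarrow> F (T + s) \<le> F T + e * s"
        unfolding eventually_at_right_field by auto
      define s where "s = min (d / 2) (b - T)"
      have s: "0 < s" "s < d" "T + s \<le> b" using d(1) \<open>T < b\<close> by (auto simp: s_def)
      have "F (T + s) \<le> F T + e * s" by (rule d(2)[OF s(1,2)])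
      then have "T + s \<in> S" using T s by (auto simp: S_def T_def algebra_simps)
      then have "T + s \<le> T" using \<open>bdd_above S\<close> unfolding T_def by (rule cSup_upper)
      with s show False by simp
    qed
    then show ?thesis using T by (simp add: S_def T_def)
  qed
  have 2: "F b \<le> F c" if c': "a < c" "c < b" for c
  proof (rule field_le_epsilon)
    fix e :: real assume "e > 0"
    then have "e / (b - c) > 0" using c' by simp
    from 1[OF c' this] show "F b \<le> F c + e" using c' by simp
  qed
  show ?thesis
  proof (cases "a = b")
    case False
    then have ab': "a < b" using ab by simp
    have "(F \<longlongrightarrow> F a) (at a within {a..b})"
      using c ab' by (simp add: continuous_on)
    then have "(F \<longlongrightarrow> F a) (at_right a)"
      using at_within_Icc_at_right[OF ab'] by simp
    moreover have "\<forall>\<^sub>F c in at_right a. F b \<le> F c"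
      unfolding eventually_at_right_field using 2 ab' by blast
    ultimately show ?thesis by (rule tendsto_lowerbound) simp
  qed simp
qed

section \<open>Logarithmic norms and their joint continuity\<close>

context carnot_LSI
begin

text \<open>The logarithm of \<open>anorm \<mu> q (\<lambda>x. exp (w x))\<close> for bounded
  measurable \<open>w\<close>; at \<open>q = 0\<close> the geometric mean becomes an
  integral.\<close>

definition lnorm :: "real \<Rightarrow> (real^'n \<Rightarrow> real) \<Rightarrow> real" where
  "lnorm q w = (if q = 0 then (\<integral>x. w x \<partial>\<mu>) else ln (\<integral>x. exp (q * w x) \<partial>\<mu>) / q)"

lemma integrable_exp:
  fixes w :: "real^'n \<Rightarrow> real"
  assumes "w \<in> borel_measurable \<mu>" "\<And>x. \<bar>w x\<bar> \<le> B"
  shows "integrable \<mu> (\<lambda>x. exp (q * w x))" "(\<integral>x. exp (q * w x) \<partial>\<mu>) > 0"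
proof -
  have b: "\<bar>q * w x\<bar> \<le> \<bar>q\<bar> * B" for x using assms(2) by (simp add: abs_mult mult_left_mono)
  have m: "(\<lambda>x. q * w x) \<in> borel_measurable \<mu>" using assms(1) by measurable
  show "(\<integral>x. exp (q * w x) \<partial>\<mu>) > 0" by (rule integral_exp_pos[OF m b])
  show "integrable \<mu> (\<lambda>x. exp (q * w x))"
    using m exp_le_bound[OF assms(2)] by (intro bounded_integrable[of _ "exp (\<bar>q\<bar> * B)"]) auto
qed

lemma anorm_exp:
  assumes "w \<in> borel_measurable \<mu>" "\<And>x. \<bar>w x\<bar> \<le> B"
  shows "anorm \<mu> q (\<lambda>x. exp (w x)) = exp (lnorm q w)"
  using integrable_exp(2)[OF assms, of q] by (simp add: anorm_def lnorm_def powr_def)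

text \<open>For negative \<open>q\<close> the order is reversed twice, by the exponential and by the
  division.\<close>

lemma lnorm_mono:
  assumes "w \<in> borel_measurable \<mu>" "\<And>x. \<bar>w x\<bar> \<le> B" "v \<in> borel_measurable \<mu>" "\<And>x. \<bar>v x\<bar> \<le> B"
    and le: "\<And>x. w x \<le> v x"
  shows "lnorm q w \<le> lnorm q v"
proof -
  note [intro!] = integrable_exp(1)[OF assms(1,2)] integrable_exp(1)[OF assms(3,4)]
  note pos = integrable_exp(2)[OF assms(1,2), of q] integrable_exp(2)[OF assms(3,4), of q]
  consider "q = 0" | "q > 0" | "q < 0" by linarith
  then show ?thesis
  proof cases
    case 1
    then show ?thesis
      using bounded_integrable[OF assms(1,2)] bounded_integrable[OF assms(3,4)] le
      by (simp add: lnorm_def integral_mono)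
  next
    case 2
    then have "(\<integral>x. exp (q * w x) \<partial>\<mu>) \<le> (\<integral>x. exp (q * v x) \<partial>\<mu>)"
      using le by (intro integral_mono) auto
    then show ?thesis using 2 pos by (simp add: lnorm_def divide_right_mono)
  next
    case 3
    then have "(\<integral>x. exp (q * v x) \<partial>\<mu>) \<le> (\<integral>x. exp (q * w x) \<partial>\<mu>)"
      using le by (intro integral_mono) (auto simp: mult_left_mono_neg)
    then show ?thesis using 3 pos by (simp add: lnorm_def divide_right_mono_neg)
  qed
qed

text \<open>For nonzero \<open>q\<close> the number \<open>m\<close> is the integral of
  \<open>(exp (q * w x) - 1) / q\<close>; at 0 it is the integral of \<open>w\<close>. One formula
  thus covers all exponents and is visibly continuous in \<open>q\<close>.\<close>

lemma lnorm_eq: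
  fixes w :: "real^'n \<Rightarrow> real" and q :: real
  assumes w: "w \<in> borel_measurable \<mu>" "\<And>x. \<bar>w x\<bar> \<le> B"
  defines "m \<equiv> \<integral>x. w x * exp1q (q * w x) \<partial>\<mu>"
  shows "lnorm q w = m * ln1q (q * m)" "1 + q * m > 0"
proof -
  have "q * m = (\<integral>x. (q * w x) * exp1q (q * w x) \<partial>\<mu>)"
    by (simp add: m_def mult.assoc)
  also have "\<dots> = (\<integral>x. exp (q * w x) - 1 \<partial>\<mu>)" by (simp only: exp1q)
  also have "\<dots> = (\<integral>x. exp (q * w x) \<partial>\<mu>) - 1"
    using integrable_exp(1)[OF w] by (simp add: prob)
  finally have G: "1 + q * m = (\<integral>x. exp (q * w x) \<partial>\<mu>)" by simp
  then show "1 + q * m > 0" using integrable_exp(2)[OF w] by simp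
  show "lnorm q w = m * ln1q (q * m)"
  proof (cases "q = 0")
    case True
    then show ?thesis by (simp add: lnorm_def m_def exp1q_def ln1q_def)
  next
    case False
    have "q * (m * ln1q (q * m)) = ln (1 + q * m)" using ln1q[of "q * m"] by (simp add: mult_ac)
    moreover have "lnorm q w = ln (1 + q * m) / q" using False by (simp only: lnorm_def G if_False)
    ultimately have "q * lnorm q w = q * (m * ln1q (q * m))" using False by simp
    then show ?thesis using False by simp
  qed
qed

text \<open>Exponent and function may vary together, and the limit exponent may be 0. It gives
  continuity in time, the removal of the mollifier and the passage to initial time 0.\<close>

lemma lnorm_tendsto:
  fixes w :: "nat \<Rightarrow> real^'n \<Rightarrow> real"
  assumes q: "q \<longlonglongrightarrow> q0" and wm: "\<And>n. w n \<in> borel_measurable \<mu>" and wB: "\<And>n x. \<bar>w n x\<bar> \<le> B"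
    and lim: "\<And>x. (\<lambda>n. w n x) \<longlonglongrightarrow> w0 x"
  shows "(\<lambda>n. lnorm (q n) (w n)) \<longlonglongrightarrow> lnorm q0 w0"
proof -
  have B0: "B \<ge> 0" using wB[of 0 0] by simp
  have w0: "w0 \<in> borel_measurable \<mu>" by (rule borel_measurable_LIMSEQ_metric[OF wm lim])
  have w0B: "\<bar>w0 x\<bar> \<le> B" for x
    using tendsto_rabs[OF lim[of x]] wB by (intro LIMSEQ_le_const2) auto
  obtain Q where Q: "\<And>n. \<bar>q n\<bar> \<le> Q"
    using convergent_imp_Bseq[OF convergentI[OF q]] unfolding Bseq_def by auto
  obtain K where K: "\<And>z. \<bar>z\<bar> \<le> Q * B \<Longrightarrow> \<bar>exp1q z\<bar> \<le> K" using exp1q_bounded by blast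
  have "(\<lambda>n. \<integral>x. w n x * exp1q (q n * w n x) \<partial>\<mu>) \<longlonglongrightarrow> (\<integral>x. w0 x * exp1q (q0 * w0 x) \<partial>\<mu>)"
  proof (rule bounded_convergence)
    show "(\<lambda>x. w n x * exp1q (q n * w n x)) \<in> borel_measurable \<mu>" for n using wm by measurable
    show "\<bar>w n x * exp1q (q n * w n x)\<bar> \<le> B * K" for n x
    proof -
      have "\<bar>q n * w n x\<bar> \<le> Q * B" unfolding abs_mult using Q[of n] wB[of n x] by (intro mult_mono) auto
      from K[OF this] show ?thesis unfolding abs_mult using wB[of n x] B0 by (intro mult_mono) auto
    qed
    show "(\<lambda>n. w n x * exp1q (q n * w n x)) \<longlonglongrightarrow> w0 x * exp1q (q0 * w0 x)" for x
      by (intro tendsto_mult lim isCont_tendsto_compose[OF isCont_exp1q] q)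
  qed
  moreover have "isCont ln1q (q0 * (\<integral>x. w0 x * exp1q (q0 * w0 x) \<partial>\<mu>))"
    using lnorm_eq(2)[OF w0 w0B, of q0] by (intro isCont_ln1q) simp
  ultimately show ?thesis
    unfolding lnorm_eq(1)[OF wm wB] lnorm_eq(1)[OF w0 w0B]
    by (intro tendsto_mult isCont_tendsto_compose[where g=ln1q] q)
qed

end

locale hopf_lax_LSI = mollified_hopf_lax op deg f M \<phi> \<epsilon> + carnot_LSI op deg \<mu> \<rho>
  for op :: "real^'n \<Rightarrow> real^'n \<Rightarrow> real^'n" and deg :: "'n \<Rightarrow> nat" and f M \<phi> \<epsilon> \<mu> \<rho>
begin

lemma mhl_continuous: "t > 0 \<Longrightarrow> continuous_on UNIV (mhl t)"
  by (rule diffk_imp_continuous_on[OF diffk_mhl])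

lemma mhl_measurable: "t > 0 \<Longrightarrow> mhl t \<in> borel_measurable \<mu>"
  by (rule continuous_measurable[OF mhl_continuous])

lemma subgrad_square_measurable:
  "t > 0 \<Longrightarrow> (\<lambda>x. (subgrad_norm op deg (mhl t) x)\<^sup>2) \<in> borel_measurable \<mu>"
  unfolding subgrad_norm_square
  by (intro continuous_measurable continuous_intros diffk_imp_continuous_on[OF diffk_Zder[OF diffk_mhl]])

lemma hjq_measurable:
  assumes "t > 0" "s > 0"
  shows "hjq t s \<in> borel_measurable \<mu>"
proof -
  have [measurable]: "mhl (t + s) \<in> borel_measurable \<mu>" "mhl t \<in> borel_measurable \<mu>"
    "(\<lambda>x. (subgrad_norm op deg (mhl t) x)\<^sup>2) \<in> borel_measurable \<mu>"
    using assms by (auto intro!: mhl_measurable subgrad_square_measurable)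
  show ?thesis unfolding hjq_def[abs_def] by measurable
qed

text \<open>Nonpositivity of this right derivative is the logarithmic Sobolev inequality for
  \<open>exp (q * mhl t / 2)\<close>.\<close>

lemma lnorm_hjq_derivative:
  assumes t: "t > 0" and q: "q \<noteq> 0"
  obtains L where "L \<le> 0"
    "((\<lambda>s. (lnorm (q + \<rho> * s) (\<lambda>x. mhl t x + s * hjq t s x) - lnorm q (mhl t)) / s) \<longlongrightarrow> L) (at_right 0)"
proof -
  define w where "w = mhl t"
  define N2 where "N2 x = (subgrad_norm op deg w x)\<^sup>2" for x
  define C where "C = (lipR t / t)\<^sup>2"
  have wm [measurable]: "w \<in> borel_measurable \<mu>" unfolding w_def by (rule mhl_measurable[OF t])
  have wM: "\<bar>w x\<bar> \<le> M" for x unfolding w_def by (rule mhl_abs_le[OF t])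
  have N2m [measurable]: "N2 \<in> borel_measurable \<mu>"
    unfolding N2_def[abs_def] w_def by (rule subgrad_square_measurable[OF t])
  have N2C: "0 \<le> N2 x" "N2 x \<le> C" for x
    unfolding N2_def C_def w_def using mhl_grad_bound[OF t] subgrad_norm_nonneg by (auto intro: power_mono)
  have C0: "C \<ge> 0" by (simp add: C_def)
  define G where "G = (\<integral>x. exp (q * w x) \<partial>\<mu>)"
  have G: "G > 0" unfolding G_def by (rule integrable_exp(2)[OF wm wM])
  define G' where "G' = (\<integral>x. exp (q * w x) * (\<rho> * w x + q * (- N2 x / 2)) \<partial>\<mu>)"
  \<comment> \<open>The derivative at 0 of \<open>ln G(s) / (q + \<rho> * s)\<close> by the quotient
    rule, where \<open>G(s)\<close> is the integral with initial value \<open>G\<close> and initial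
    slope \<open>G'\<close>.\<close>
  define L where "L = (G' / G) * 1 / q - \<rho> * ln G / (q * q)"
  \<comment> \<open>For increments below \<open>b\<close> the exponent \<open>q + \<rho> * s\<close>
    cannot reach 0.\<close>
  define b where "b = \<bar>q\<bar> / \<rho>"
  have b: "b > 0" using q \<rho>_pos by (simp add: b_def)
  have eb: "exp (q * w x) \<le> exp (\<bar>q\<bar> * M)" for x by (rule exp_le_bound[OF wM])
  have "((\<lambda>s. (lnorm (q + \<rho> * s) (\<lambda>x. w x + s * hjq t s x) - lnorm q w) / s) \<longlongrightarrow> L) (at_right 0)"
  proof (rule tendsto_at_right_sequentially[OF b])
    fix S :: "nat \<Rightarrow> real"
    assume S: "\<And>n. 0 < S n" "\<And>n. S n < b" "decseq S" "S \<longlonglongrightarrow> 0"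
    define D where "D n = hjq t (S n)" for n
    have Dm [measurable]: "D n \<in> borel_measurable \<mu>" for n unfolding D_def by (rule hjq_measurable[OF t S(1)])
    have Dlim: "(\<lambda>n. D n x) \<longlonglongrightarrow> - N2 x / 2" for x
    proof -
      have "filterlim S (at_right 0) sequentially"
        using S(1,4) by (simp add: filterlim_at less_imp_neq[symmetric])
      from filterlim_compose[OF hjq_tendsto[OF t] this] show ?thesis by (simp add: D_def N2_def w_def)
    qed
    have DC: "\<bar>D n x\<bar> \<le> C" for n x
      using hjq_bounds(1,2)[OF t S(1)[of n], of x] N2C[of x] by (simp add: D_def N2_def w_def abs_le_iff)
    have qS: "q + \<rho> * S n \<noteq> 0" for n
    proof -
      have "\<rho> * S n < \<bar>q\<bar>" "\<rho> * S n > 0" using S(1,2)[of n] \<rho>_pos by (auto simp: b_def field_simps)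
      then show ?thesis by (cases "q > 0") auto
    qed
    \<comment> \<open>The increment of the exponent per unit time:
      \<open>(q + \<rho> * s) * (w + s * D)\<close> equals \<open>q * w + s * B\<close>. The last
      summand vanishes in the limit.\<close>
    define B where "B n x = \<rho> * w x + q * D n x + \<rho> * S n * D n x" for n x
    have Bm [measurable]: "B n \<in> borel_measurable \<mu>" for n unfolding B_def[abs_def] by measurable
    define Bd where "Bd = \<rho> * M + \<bar>q\<bar> * C + \<rho> * b * C"
    have BB: "\<bar>B n x\<bar> \<le> Bd" for n x
    proof -
      have "\<bar>\<rho> * w x\<bar> \<le> \<rho> * M" using wM \<rho>_pos by (simp add: abs_mult)
      moreover have "\<bar>q * D n x\<bar> \<le> \<bar>q\<bar> * C" using DC by (simp add: abs_mult mult_left_mono)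
      moreover have "\<bar>\<rho> * S n * D n x\<bar> \<le> \<rho> * b * C"
        unfolding abs_mult using DC[of n x] S(1,2)[of n] \<rho>_pos b by (intro mult_mono) auto
      ultimately show ?thesis unfolding B_def Bd_def by linarith
    qed
    have Bd0: "Bd \<ge> 0" using BB[of 0 0] by simp
    have Blim: "(\<lambda>n. B n x) \<longlonglongrightarrow> \<rho> * w x + q * (- N2 x / 2)" for x
    proof -
      have "(\<lambda>n. B n x) \<longlonglongrightarrow> \<rho> * w x + q * (- N2 x / 2) + \<rho> * 0 * (- N2 x / 2)"
        unfolding B_def by (intro tendsto_intros Dlim S(4))
      then show ?thesis by simp
    qed
    define g where "g n = (\<integral>x. exp (q * w x) * (B n x * exp1q (S n * B n x)) \<partial>\<mu>)" for n
    obtain K where K: "\<And>z. \<bar>z\<bar> \<le> b * Bd \<Longrightarrow> \<bar>exp1q z\<bar> \<le> K" using exp1q_bounded by blast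
    have bound: "\<bar>exp (q * w x) * (B n x * exp1q (S n * B n x))\<bar> \<le> exp (\<bar>q\<bar> * M) * (Bd * K)" for n x
    proof -
      have "\<bar>S n * B n x\<bar> \<le> b * Bd"
        unfolding abs_mult using S(1,2)[of n] BB[of n x] b by (intro mult_mono) auto
      from K[OF this] show ?thesis
        unfolding abs_mult using BB[of n x] eb[of x] Bd0 by (intro mult_mono) auto
    qed
    have "(\<lambda>n. g n) \<longlonglongrightarrow> (\<integral>x. exp (q * w x) * ((\<rho> * w x + q * (- N2 x / 2)) * exp1q (0 * (\<rho> * w x + q * (- N2 x / 2)))) \<partial>\<mu>)"
      unfolding g_def
    proof (rule bounded_convergence[OF _ bound])
      show "(\<lambda>n. exp (q * w x) * (B n x * exp1q (S n * B n x))) \<longlonglongrightarrow>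
        exp (q * w x) * ((\<rho> * w x + q * (- N2 x / 2)) * exp1q (0 * (\<rho> * w x + q * (- N2 x / 2))))" for x
        by (intro tendsto_mult tendsto_const Blim isCont_tendsto_compose[OF isCont_exp1q] S(4))
    qed measurable
    then have glim: "g \<longlonglongrightarrow> G'" by (simp add: G'_def exp1q_def)
    have Geq: "(\<integral>x. exp ((q + \<rho> * S n) * (w x + S n * D n x)) \<partial>\<mu>) = G + S n * g n" for n
    proof -
      have "exp ((q + \<rho> * S n) * (w x + S n * D n x)) = exp (q * w x) + S n * (exp (q * w x) * (B n x * exp1q (S n * B n x)))" for x
      proof -
        have "(q + \<rho> * S n) * (w x + S n * D n x) = q * w x + S n * B n x" by (simp add: B_def algebra_simps)
        then have "exp ((q + \<rho> * S n) * (w x + S n * D n x)) = exp (q * w x) * (1 + (S n * B n x) * exp1q (S n * B n x))"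
          by (simp add: exp_add exp1q)
        then show ?thesis by (simp add: algebra_simps)
      qed
      moreover have "integrable \<mu> (\<lambda>x. exp (q * w x) * (B n x * exp1q (S n * B n x)))"
        by (rule bounded_integrable[OF _ bound]) measurable
      ultimately show ?thesis using integrable_exp(1)[OF wm wM, of q] by (simp add: G_def g_def)
    qed
    have wD: "\<bar>w x + S n * D n x\<bar> \<le> M + b * C" for n x
    proof -
      have "\<bar>S n * D n x\<bar> \<le> b * C" unfolding abs_mult using S(1,2)[of n] DC[of n x] b by (intro mult_mono) auto
      with wM[of x] show ?thesis by linarith
    qed
    have Gpos: "G + S n * g n > 0" for n
      unfolding Geq[symmetric] by (rule integrable_exp(2)[OF _ wD]) measurable
    define z where "z n = S n * g n / G" for n
    have lnG: "ln (G + S n * g n) = ln G + z n * ln1q (z n)" for n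
    proof -
      have eq: "G + S n * g n = G * (1 + z n)" using G by (simp add: z_def field_simps)
      then have "1 + z n > 0" using Gpos[of n] G by (simp add: zero_less_mult_iff)
      then show ?thesis using G by (simp add: eq ln_mult ln1q)
    qed
    have "(lnorm (q + \<rho> * S n) (\<lambda>x. w x + S n * hjq t (S n) x) - lnorm q w) / S n
      = (g n / G) * ln1q (z n) / (q + \<rho> * S n) - \<rho> * ln G / (q * (q + \<rho> * S n))" for n
    proof -
      have 1: "lnorm (q + \<rho> * S n) (\<lambda>x. w x + S n * hjq t (S n) x) = (ln G + z n * ln1q (z n)) / (q + \<rho> * S n)"
        using qS[of n] Geq[of n] lnG[of n] by (simp add: lnorm_def D_def)
      have 2: "lnorm q w = ln G / q" using q by (simp add: lnorm_def G_def)
      have 3: "z n * ln1q (z n) = S n * ((g n / G) * ln1q (z n))" by (simp add: z_def)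
      have 4: "((l + s * y) / p - l / q) / s = y / p - \<rho> * l / (q * p)" if "p = q + \<rho> * s" "p \<noteq> 0" "s > 0" for l s y p
      proof -
        have "l / p - l / q = (l * q - l * p) / (p * q)" using that q by (simp add: diff_frac_eq)
        also have "l * q - l * p = - (s * (\<rho> * l))" using that(1) by (simp add: algebra_simps)
        finally have "(l + s * y) / p - l / q = s * (y / p - \<rho> * l / (q * p))"
          by (simp add: add_divide_distrib right_diff_distrib mult.commute)
        then show ?thesis using that(3) by simp
      qed
      show ?thesis unfolding 1 2 3 by (rule 4[OF refl qS S(1)])
    qed
    moreover have "(\<lambda>n. (g n / G) * ln1q (z n) / (q + \<rho> * S n) - \<rho> * ln G / (q * (q + \<rho> * S n))) \<longlonglongrightarrow>
      (G' / G) * ln1q (0 * G' / G) / (q + \<rho> * 0) - \<rho> * ln G / (q * (q + \<rho> * 0))"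
      unfolding z_def using q G
      by (intro tendsto_intros glim S(4) isCont_tendsto_compose[where g=ln1q] isCont_ln1q) auto
    ultimately show "(\<lambda>n. (lnorm (q + \<rho> * S n) (\<lambda>x. w x + S n * hjq t (S n) x) - lnorm q w) / S n) \<longlonglongrightarrow> L"
      by (simp add: L_def ln1q_def)
  qed
  moreover have "L \<le> 0"
  proof -
    have i1: "integrable \<mu> (\<lambda>x. exp (q * w x) * (q * w x))"
    proof (rule bounded_integrable)
      show "\<bar>exp (q * w x) * (q * w x)\<bar> \<le> exp (\<bar>q\<bar> * M) * (\<bar>q\<bar> * M)" for x
        unfolding abs_mult using eb wM by (intro mult_mono) auto
    qed measurable
    have i2: "integrable \<mu> (\<lambda>x. N2 x * exp (q * w x))"
    proof (rule bounded_integrable)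
      show "\<bar>N2 x * exp (q * w x)\<bar> \<le> C * exp (\<bar>q\<bar> * M)" for x
        unfolding abs_mult using eb N2C[of x] C0 by (intro mult_mono) auto
    qed measurable
    \<comment> \<open>Multiplying by \<open>q\<close> makes the sign of \<open>q\<close> irrelevant;
      after division by \<open>q\<^sup>2 * G\<close> the estimate is precisely the inequality of
      \<open>LSI_exp\<close>.\<close>
    have "q * G' = (\<integral>x. \<rho> * (exp (q * w x) * (q * w x)) - q\<^sup>2 / 2 * (N2 x * exp (q * w x)) \<partial>\<mu>)"
      unfolding G'_def by (subst integral_mult_right_zero[symmetric]) (simp add: algebra_simps power2_eq_square)
    also have "\<dots> = \<rho> * (\<integral>x. exp (q * w x) * (q * w x) \<partial>\<mu>) - q\<^sup>2 / 2 * (\<integral>x. N2 x * exp (q * w x) \<partial>\<mu>)"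
      using i1 i2 by simp
    also have "\<dots> \<le> \<rho> * (G * ln G)"
      using LSI_exp[of w M "lipR t / t" q] diffk_mhl[OF t] wM mhl_grad_bound[OF t]
      unfolding G_def N2_def by (simp add: w_def right_diff_distrib)
    finally have "(q * G' - \<rho> * (G * ln G)) / (q\<^sup>2 * G) \<le> 0"
      using G by (simp add: divide_nonpos_nonneg)
    moreover have "L = (q * G' - \<rho> * (G * ln G)) / (q\<^sup>2 * G)"
      using q G unfolding L_def by (simp add: field_simps power2_eq_square)
    ultimately show ?thesis by simp
  qed
  ultimately show thesis using that unfolding w_def by blast
qed

text \<open>By \<open>hjq_bounds\<close> the function at time \<open>t + s\<close> lies below the
  first-order expression with \<open>hjq\<close>, and the logarithmic norm is monotone, so the
  derivative of the latter expression bounds the growth.\<close>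

lemma lnorm_mhl_Dini:
  assumes t: "t > 0" and q: "a + \<rho> * t \<noteq> 0" and e: "e > 0"
  shows "\<forall>\<^sub>F s in at_right 0. lnorm (a + \<rho> * (t + s)) (mhl (t + s)) \<le> lnorm (a + \<rho> * t) (mhl t) + e * s"
proof -
  define q where "q = a + \<rho> * t"
  obtain L where L: "L \<le> 0"
    "((\<lambda>s. (lnorm (q + \<rho> * s) (\<lambda>x. mhl t x + s * hjq t s x) - lnorm q (mhl t)) / s) \<longlongrightarrow> L) (at_right 0)"
    by (rule lnorm_hjq_derivative[OF t q, folded q_def])
  have "\<forall>\<^sub>F s in at_right 0. (lnorm (q + \<rho> * s) (\<lambda>x. mhl t x + s * hjq t s x) - lnorm q (mhl t)) / s < e"
    using L e by (intro order_tendstoD(2)[OF L(2)]) simp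
  moreover have "\<forall>\<^sub>F s in at_right (0::real). s > 0" by (simp add: eventually_at_right_less)
  ultimately show ?thesis
  proof eventually_elim
    case (elim s)
    define B where "B = M + s * (lipR t / t)\<^sup>2"
    have "M \<le> B" using elim by (simp add: B_def)
    have "lnorm (q + \<rho> * s) (mhl (t + s)) \<le> lnorm (q + \<rho> * s) (\<lambda>x. mhl t x + s * hjq t s x)"
    proof (rule lnorm_mono[where B=B])
      show "mhl (t + s) \<in> borel_measurable \<mu>" using t elim by (intro mhl_measurable) simp
      have [measurable]: "mhl t \<in> borel_measurable \<mu>" "hjq t s \<in> borel_measurable \<mu>"
        using t elim by (auto intro: mhl_measurable hjq_measurable)
      show "(\<lambda>x. mhl t x + s * hjq t s x) \<in> borel_measurable \<mu>" by measurable
      show "\<bar>mhl (t + s) x\<bar> \<le> B" for x using mhl_abs_le[of "t + s" x] t elim \<open>M \<le> B\<close> by linarith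
      show "mhl (t + s) x \<le> mhl t x + s * hjq t s x" for x by (rule hjq_bounds(3)[OF t elim(2)])
      show "\<bar>mhl t x + s * hjq t s x\<bar> \<le> B" for x
      proof -
        have "(subgrad_norm op deg (mhl t) x)\<^sup>2 \<le> (lipR t / t)\<^sup>2"
          using mhl_grad_bound[OF t] subgrad_norm_nonneg by (intro power_mono) auto
        then have "\<bar>hjq t s x\<bar> \<le> (lipR t / t)\<^sup>2"
          using hjq_bounds(1,2)[OF t elim(2), of x] zero_le_power2[of "subgrad_norm op deg (mhl t) x"]
          unfolding abs_le_iff by linarith
        then have "\<bar>s * hjq t s x\<bar> \<le> s * (lipR t / t)\<^sup>2" using elim by (simp add: abs_mult)
        then show ?thesis using mhl_abs_le[OF t, of x] unfolding B_def by linarith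
      qed
    qed
    also have "\<dots> \<le> lnorm q (mhl t) + e * s" using elim by (simp add: field_simps)
    finally show ?case by (simp add: q_def algebra_simps)
  qed
qed

lemma lnorm_mhl_continuous:
  assumes "t1 > 0"
  shows "continuous_on {t1..t2} (\<lambda>t. lnorm (a + \<rho> * t) (mhl t))"
  unfolding continuous_on_sequentially comp_def
proof (intro allI ballI impI, elim conjE)
  fix S :: "nat \<Rightarrow> real" and t assume t: "t \<in> {t1..t2}" and S: "\<forall>n. S n \<in> {t1..t2}" "S \<longlonglongrightarrow> t"
  have pos: "t > 0" "S n > 0" "t1 \<le> S n" for n
    using t S(1)[rule_format, of n] assms by (auto intro: less_le_trans)
  show "(\<lambda>n. lnorm (a + \<rho> * S n) (mhl (S n))) \<longlonglongrightarrow> lnorm (a + \<rho> * t) (mhl t)"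
  proof (rule lnorm_tendsto[where B=M])
    show "(\<lambda>n. a + \<rho> * S n) \<longlonglongrightarrow> a + \<rho> * t" by (intro tendsto_intros S)
    fix x
    have le: "\<bar>mhl (S n) x - mhl t x\<bar> \<le> (2 * M + 1) / t1 * \<bar>S n - t\<bar>" for n
    proof -
      have *: "\<bar>mhl r x - mhl r' x\<bar> \<le> (2 * M + 1) / t1 * \<bar>r - r'\<bar>" if "t1 \<le> r" "r \<le> r'" for r r'
      proof -
        have "\<bar>mhl r x - mhl r' x\<bar> \<le> (2 * M + 1) * (r' - r) / r"
          using that assms by (intro mhl_time) auto
        also have "\<dots> \<le> (2 * M + 1) * (r' - r) / t1"
          using that assms M_nonneg by (intro divide_left_mono) auto
        finally show ?thesis using that by simp
      qed
      show ?thesis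
        using *[of "S n" t] *[of t "S n"] pos(3)[of n] t by (cases "S n \<le> t") (auto simp: abs_minus_commute)
    qed
    have "(\<lambda>n. (2 * M + 1) / t1 * \<bar>S n - t\<bar>) \<longlonglongrightarrow> (2 * M + 1) / t1 * \<bar>t - t\<bar>"
      by (intro tendsto_intros S)
    then have null: "(\<lambda>n. (2 * M + 1) / t1 * \<bar>S n - t\<bar>) \<longlonglongrightarrow> 0" by simp
    have "(\<lambda>n. mhl (S n) x - mhl t x) \<longlonglongrightarrow> 0"
      by (rule Lim_null_comparison[OF always_eventually null]) (simp only: real_norm_def le simp_thms)
    then show "(\<lambda>n. mhl (S n) x) \<longlonglongrightarrow> mhl t x" by (simp add: LIM_zero_iff)
  qed (use pos mhl_abs_le mhl_measurable in auto)
qed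

text \<open>The time interval is cut at \<open>t0\<close>, the only zero of the exponent, and the
  Dini argument is applied on each side; continuity joins the pieces.\<close>

lemma lnorm_mhl_antimono:
  assumes "0 < t1" "t1 \<le> t2"
  shows "lnorm (a + \<rho> * t2) (mhl t2) \<le> lnorm (a + \<rho> * t1) (mhl t1)"
proof -
  let ?F = "\<lambda>t. lnorm (a + \<rho> * t) (mhl t)"
  have *: "?F r' \<le> ?F r" if "0 < r" "r \<le> r'" "\<And>t. r < t \<Longrightarrow> t < r' \<Longrightarrow> a + \<rho> * t \<noteq> 0" for r r'
    by (rule right_Dini_imp_le[OF that(2) lnorm_mhl_continuous[OF that(1)]])
      (use that lnorm_mhl_Dini in auto)
  define t0 where "t0 = - a / \<rho>"
  have t0: "a + \<rho> * t = 0 \<longleftrightarrow> t = t0" for t using \<rho>_pos by (auto simp: t0_def field_simps)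
  show ?thesis
  proof (cases "t1 < t0 \<and> t0 < t2")
    case True
    have "?F t2 \<le> ?F t0" using True assms t0 by (intro *) auto
    also have "?F t0 \<le> ?F t1" using True assms t0 by (intro *) auto
    finally show ?thesis .
  next
    case False
    then show ?thesis using assms t0 by (intro *) auto
  qed
qed

end

section \<open>Removing the mollification\<close>

locale hopf_lax_LSI_raw = hopf_lax_bounded op deg f M + carnot_LSI op deg \<mu> \<rho>
  for op :: "real^'n \<Rightarrow> real^'n \<Rightarrow> real^'n" and deg :: "'n \<Rightarrow> nat" and f M \<mu> \<rho>
begin

lemma hl_measurable: "t > 0 \<Longrightarrow> hl t \<in> borel_measurable \<mu>"
  by (rule continuous_measurable[OF hl_continuous])

text \<open>Everything wanted from one kernel is bundled as the existence of a family
  \<open>W\<close>, so that one such family can be chosen for each radius of a sequence tending to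
  0.\<close>

lemma mollified_approximation:
  assumes "\<epsilon> > 0"
  shows "\<exists>W. (\<forall>t>0. W t \<in> borel_measurable \<mu> \<and> (\<forall>x. \<bar>W t x\<bar> \<le> M)) \<and>
    (\<forall>t x c. t > 0 \<longrightarrow> (\<forall>y. norm y \<le> \<epsilon> \<longrightarrow> \<bar>hl t (op y x) - hl t x\<bar> \<le> c) \<longrightarrow> \<bar>W t x - hl t x\<bar> \<le> c) \<and>
    (\<forall>t1 t2. 0 < t1 \<longrightarrow> t1 \<le> t2 \<longrightarrow> lnorm (a + \<rho> * t2) (W t2) \<le> lnorm (a + \<rho> * t1) (W t1))"
proof -
  obtain \<phi> where "mollified op deg \<phi> \<epsilon>" using exists_mollifier[OF assms] by blast
  then interpret mollified op deg \<phi> \<epsilon> .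
  interpret hopf_lax_LSI op deg f M \<phi> \<epsilon> \<mu> \<rho> by unfold_locales
  have "\<bar>mhl t x - hl t x\<bar> \<le> c" if "t > 0" "\<forall>y. norm y \<le> \<epsilon> \<longrightarrow> \<bar>hl t (op y x) - hl t x\<bar> \<le> c" for t x c
    unfolding mhl_def using that by (intro mol_close hl_continuous) auto
  then show ?thesis
    using mhl_measurable mhl_abs_le lnorm_mhl_antimono by (intro exI[of _ mhl]) blast
qed

lemma lnorm_hl_antimono:
  assumes t: "0 < t1" "t1 \<le> t2"
  shows "lnorm (a + \<rho> * t2) (hl t2) \<le> lnorm (a + \<rho> * t1) (hl t1)"
proof -
  have "\<forall>n. \<exists>W. (\<forall>t>0. W t \<in> borel_measurable \<mu> \<and> (\<forall>x. \<bar>W t x\<bar> \<le> M)) \<and>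
    (\<forall>t x c. t > 0 \<longrightarrow> (\<forall>y. norm y \<le> 1 / real (Suc n) \<longrightarrow> \<bar>hl t (op y x) - hl t x\<bar> \<le> c) \<longrightarrow> \<bar>W t x - hl t x\<bar> \<le> c) \<and>
    (\<forall>t1 t2. 0 < t1 \<longrightarrow> t1 \<le> t2 \<longrightarrow> lnorm (a + \<rho> * t2) (W t2) \<le> lnorm (a + \<rho> * t1) (W t1))"
    by (intro allI mollified_approximation) simp
  from choice[OF this] obtain W where all: "\<forall>n. (\<forall>t>0. W n t \<in> borel_measurable \<mu> \<and> (\<forall>x. \<bar>W n t x\<bar> \<le> M)) \<and>
    (\<forall>t x c. t > 0 \<longrightarrow> (\<forall>y. norm y \<le> 1 / real (Suc n) \<longrightarrow> \<bar>hl t (op y x) - hl t x\<bar> \<le> c) \<longrightarrow> \<bar>W n t x - hl t x\<bar> \<le> c) \<and>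
    (\<forall>t1 t2. 0 < t1 \<longrightarrow> t1 \<le> t2 \<longrightarrow> lnorm (a + \<rho> * t2) (W n t2) \<le> lnorm (a + \<rho> * t1) (W n t1))" ..
  have W: "W n t \<in> borel_measurable \<mu>" "\<bar>W n t x\<bar> \<le> M" if "t > 0" for n t x
    using all that by blast+
  have close: "\<bar>W n t x - hl t x\<bar> \<le> c"
    if "t > 0" "\<And>y. norm y \<le> 1 / real (Suc n) \<Longrightarrow> \<bar>hl t (op y x) - hl t x\<bar> \<le> c" for n t x c
    using all that by blast
  have mono: "lnorm (a + \<rho> * t2) (W n t2) \<le> lnorm (a + \<rho> * t1) (W n t1)" for n
    using all t by blast
  have lim: "(\<lambda>n. W n t x) \<longlonglongrightarrow> hl t x" if "t > 0" for t x
  proof (rule LIMSEQ_I)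
    fix r :: real assume "r > 0"
    have "isCont (hl t) (op 0 x)"
      using hl_continuous[OF that] by (simp add: continuous_on_eq_continuous_at)
    moreover have "((\<lambda>y. op y x) \<longlongrightarrow> op 0 x) (nhds 0)"
      by (intro tendsto_op tendsto_const filterlim_ident)
    ultimately have "((\<lambda>y. hl t (op y x)) \<longlongrightarrow> hl t (op 0 x)) (nhds 0)"
      by (rule isCont_tendsto_compose)
    then have "\<forall>\<^sub>F y in nhds 0. dist (hl t (op y x)) (hl t x) < r / 2"
      using tendstoD[of _ _ _ "r / 2"] \<open>r > 0\<close> by fastforce
    then obtain d where d: "d > 0" "\<And>y. dist y 0 < d \<Longrightarrow> dist (hl t (op y x)) (hl t x) < r / 2"
      unfolding eventually_nhds_metric by blast
    obtain N where N: "1 / real (Suc N) < d" using nat_approx_posE[OF d(1)] .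
    have "norm (W n t x - hl t x) < r" if n: "n \<ge> N" for n
    proof -
      have "1 / real (Suc n) \<le> 1 / real (Suc N)" using n by (simp add: frac_le)
      then have "\<bar>hl t (op y x) - hl t x\<bar> \<le> r / 2" if "norm y \<le> 1 / real (Suc n)" for y
        using d(2)[of y] that N by (simp add: dist_real_def)
      then have "\<bar>W n t x - hl t x\<bar> \<le> r / 2" using close[OF \<open>t > 0\<close>] by blast
      then show ?thesis using \<open>r > 0\<close> by simp
    qed
    then show "\<exists>no. \<forall>n\<ge>no. norm (W n t x - hl t x) < r" by blast
  qed
  have conv: "(\<lambda>n. lnorm (a + \<rho> * t) (W n t)) \<longlonglongrightarrow> lnorm (a + \<rho> * t) (hl t)" if "t > 0" for t
    by (rule lnorm_tendsto[OF tendsto_const W[OF that] lim[OF that]])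
  show ?thesis
    by (rule LIMSEQ_le[OF conv conv]) (use t mono in auto)
qed

text \<open>For measurable \<open>f\<close> the functions \<open>hl s\<close> may fail to converge
  to \<open>f\<close> as \<open>s\<close> tends to 0. They lie below \<open>f\<close>, however, so
  monotonicity replaces \<open>hl (S n)\<close> by \<open>f\<close> and only the exponent has to
  pass to the limit.\<close>

lemma lnorm_hl_le:
  assumes t: "t > 0" and f: "f \<in> borel_measurable \<mu>"
  shows "lnorm (a + \<rho> * t) (hl t) \<le> lnorm a f"
proof (rule LIMSEQ_le_const)
  define S where "S n = t * (1 / real (Suc n))" for n
  have S: "0 < S n" "S n \<le> t" for n using t by (auto simp: S_def divide_le_eq mult_le_cancel_left1)
  have "S \<longlonglongrightarrow> t * 0"
    unfolding S_def by (intro tendsto_mult tendsto_const LIMSEQ_inverse_real_of_nat[unfolded inverse_eq_divide])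
  then have "(\<lambda>n. a + \<rho> * S n) \<longlonglongrightarrow> a + \<rho> * 0" by (intro tendsto_intros) simp
  then have "(\<lambda>n. lnorm (a + \<rho> * S n) f) \<longlonglongrightarrow> lnorm (a + \<rho> * 0) f"
    by (rule lnorm_tendsto) (use f f_le in auto)
  then show "(\<lambda>n. lnorm (a + \<rho> * S n) f) \<longlonglongrightarrow> lnorm a f" by simp
  have "lnorm (a + \<rho> * t) (hl t) \<le> lnorm (a + \<rho> * S n) f" for n
  proof -
    have "lnorm (a + \<rho> * t) (hl t) \<le> lnorm (a + \<rho> * S n) (hl (S n))"
      using S by (intro lnorm_hl_antimono)
    also have "\<dots> \<le> lnorm (a + \<rho> * S n) f"
      by (rule lnorm_mono[OF hl_measurable[OF S(1)] hl_abs_le[OF S(1)] f f_le hl_le_f[OF S(1)]])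
    finally show ?thesis .
  qed
  then show "\<exists>N. \<forall>n\<ge>N. lnorm (a + \<rho> * t) (hl t) \<le> lnorm (a + \<rho> * S n) f" by blast
qed

end

lemma finite_measure_normalized_density:
  fixes E :: "'a::euclidean_space \<Rightarrow> real"
  assumes int: "integrable lborel E" and pos: "\<And>x. E x > 0" and Z: "Z = (\<integral>x. E x \<partial>lborel)"
  shows "finite_measure (density lborel (\<lambda>x. ennreal (E x / Z)))"
    "measure (density lborel (\<lambda>x. ennreal (E x / Z))) UNIV = 1"
proof -
  have "Z \<noteq> 0"
  proof
    assume "Z = 0"
    then have "AE x in lborel. E x = 0"
      using integral_nonneg_eq_0_iff_AE[OF int] pos Z by (auto simp: less_imp_le)
    then have "AE x in (lborel :: 'a measure). False"
      by eventually_elim (use pos in \<open>metis less_irrefl\<close>)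
    then show False by (simp add: eventually_False ae_filter_eq_bot_iff emeasure_lborel_UNIV)
  qed
  moreover have "Z \<ge> 0" unfolding Z using pos by (intro integral_nonneg_AE AE_I2 less_imp_le)
  ultimately have Zpos: "Z > 0" by simp
  have [measurable]: "E \<in> borel_measurable borel" using int by (simp add: integrable_iff_bounded)
  have "emeasure (density lborel (\<lambda>x. ennreal (E x / Z))) UNIV = (\<integral>\<^sup>+x. ennreal (E x / Z) \<partial>lborel)"
    by (simp add: emeasure_density)
  also have "\<dots> = ennreal (\<integral>x. E x / Z \<partial>lborel)"
    using int pos Zpos by (intro nn_integral_eq_integral) (auto simp: less_imp_le)
  also have "\<dots> = 1" using Zpos Z by simp
  finally have 1: "emeasure (density lborel (\<lambda>x. ennreal (E x / Z))) UNIV = 1" .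
  then show "finite_measure (density lborel (\<lambda>x. ennreal (E x / Z)))"
    by (intro finite_measureI) simp
  show "measure (density lborel (\<lambda>x. ennreal (E x / Z))) UNIV = 1"
    using 1 by (simp add: measure_def)
qed

theorem theorem15:
  fixes op :: "real^'n \<Rightarrow> real^'n \<Rightarrow> real^'n"
    and deg :: "'n \<Rightarrow> nat"
    and U :: "real \<Rightarrow> real"
    and Z \<rho> :: real
    and \<mu> :: "(real^'n) measure"
  assumes G: "carnot_group op deg"
    and U_mono: "mono U"
    and U_int: "integrable lborel (\<lambda>x. exp (- U (ccdist op deg x 0)))"
    and Z_def: "Z = (\<integral>x. exp (- U (ccdist op deg x 0)) \<partial>lborel)"
    and mu_def: "\<mu> = density lborel (\<lambda>x. ennreal (exp (- U (ccdist op deg x 0)) / Z))"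
    and rho_pos: "\<rho> > 0"
    and LSI: "\<And>g. smooth_fun g \<Longrightarrow> compact (closure {x. g x \<noteq> 0}) \<Longrightarrow>
       \<rho> * ((\<integral>x. (g x)\<^sup>2 * ln ((g x)\<^sup>2) \<partial>\<mu>) - (\<integral>x. (g x)\<^sup>2 \<partial>\<mu>) * ln (\<integral>x. (g x)\<^sup>2 \<partial>\<mu>))
         \<le> 2 * (\<integral>x. (subgrad_norm op deg g x)\<^sup>2 \<partial>\<mu>)"
    and f_meas: "f \<in> borel_measurable borel"
    and f_bdd: "bounded (range f)"
    and t_nonneg: "t \<ge> 0"
  shows "anorm \<mu> (a + \<rho> * t) (\<lambda>x. exp (hopf_lax (ccdist op deg) t f x))
           \<le> anorm \<mu> a (\<lambda>x. exp (f x))"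
proof (cases "t = 0")
  case True
  then show ?thesis by (simp add: hopf_lax_def)
next
  case False
  then have t: "t > 0" using t_nonneg by simp
  obtain M where M: "\<And>x. \<bar>f x\<bar> \<le> M" using f_bdd unfolding bounded_iff by auto
  interpret carnot op deg by (unfold_locales, rule G)
  \<comment> \<open>Integrability of the density supplies both finiteness and continuity of the
    distance; only then do the Hopf-Lax estimates become available.\<close>
  interpret carnot_connected op deg by (unfold_locales, rule connected_if_integrable[OF U_int])
  interpret carnot_metric op deg by (unfold_locales, rule ccdist_tendsto_0[OF U_mono U_int])
  interpret hopf_lax_bounded op deg f M by (unfold_locales, rule M)
  have fin: "finite_measure \<mu>" "measure \<mu> UNIV = 1"
    unfolding mu_def by (rule finite_measure_normalized_density[OF U_int exp_gt_zero Z_def])+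
  interpret finite_measure \<mu> by (rule fin(1))
  interpret carnot_LSI op deg \<mu> \<rho>
    by unfold_locales (use fin(2) rho_pos LSI in \<open>auto simp: mu_def\<close>)
  interpret hopf_lax_LSI_raw op deg f M \<mu> \<rho> by unfold_locales
  have f: "f \<in> borel_measurable \<mu>" using f_meas by (simp add: mu_def)
  have "anorm \<mu> (a + \<rho> * t) (\<lambda>x. exp (hl t x)) = exp (lnorm (a + \<rho> * t) (hl t))"
    by (rule anorm_exp[OF hl_measurable[OF t] hl_abs_le[OF t]])
  also have "\<dots> \<le> exp (lnorm a f)" using lnorm_hl_le[OF t f] by simp
  also have "\<dots> = anorm \<mu> a (\<lambda>x. exp (f x))" by (rule anorm_exp[OF f f_le, symmetric])
  finally show ?thesis .
qed

end
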